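(* Let $(m,M,J_1)$ be one of the following, where $I$ is the index set of $M$: $(3,E_6,I\setminus\{5\})$, $(4,F_4,I\setminus\{4\})$, $(4,E_7,I\setminus\{5,6\})$, $(4,E_8,I\setminus\{7\})$; and let $J_2=I\setminus\{1\}$. (a) The assignments $\widehat T_i\mapsto T_{w_{J_1\cap J_2;J_i}}$, $i\in\{1,2\}$, define a Coxeter type homomorphism $\Phi_{m,M}:\mathrm{Br}^+(I_2(m))\to\mathrm{Br}^+(M)$. (b) The assignments $\widehat T_1\mapsto T_{w_\circ^{J_1\cup K}}$, $\widehat T_2\mapsto T_{w_\circ^{J_2}}$, where $K\in\{\emptyset,\{6\}\}$ if $m=4$ and $M=E_7$ and $K=\emptyset$ otherwise, define a standard homomorphism $\widehat\Phi_{m,M,K}:\mathrm{Br}^+(I_2(m))\to\mathrm{Br}^+(M)$. (c) The only optimal fully supported standard homomorphisms $\mathrm{Br}^+(I_2(m))\to\mathrm{Br}^+(M)$ where $m\in\{3,4\}$ and $M=F_4$ or $M=E_n$, $n\in\{6,7,8\}$, are, up to the diagram automorphism of $I_2(m)$ (interchanging $\widehat T_1$ and $\widehat T_2$): the homomorphisms $\widehat\Phi_{m,M,K}$ listed in (b); the composition of $\widehat\Phi_{4,F_4,\emptyset}$ with the standard unfolding $\mathrm{Br}^+(F_4)\to\mathrm{Br}^+(E_6)$, $T_1\mapsto T_1T_5$, $T_2\mapsto T_2T_4$, $T_3\mapsto T_3$, $T_4\mapsto T_6$; and the homomorphisms $\mathrm{Br}^+(B_2)\to\mathrm{Br}^+(E_6)$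 given by $\widehat T_1\mapsto T_{w_\circ^J}$, $\widehat T_2\mapsto T_{w_\circ^{[1,6]}}$, where either $J=[1,6]$, or $J\ne\tau(J)$ and $J$, $\tau(J)$ are weakly orthogonal, for $\tau=(1,5)(2,4)$.
   Context: For a Coxeter matrix $M=(m_{ij})_{i,j\in I}$, $\mathrm{Br}^+(M)$ is the Artin monoid with generators $T_i$, $i\in I$, and relations $T_iT_jT_i\cdots=T_jT_iT_j\cdots$ ($m_{ij}$ factors each), $i\neq j$; $W(M)$ is the Coxeter group, $\pi_M:\mathrm{Br}^+(M)\to W(M)$, $T_i\mapsto s_i$. For integers $a\le b$, $[a,b]=\{a,\dots,b\}$. Labelling: $E_n$ ($n\in\{6,7,8\}$) is over $[1,n]$ with $m_{i,i+1}=3$ for $1\le i\le n-2$ (chain $1-2-\cdots-(n-1)$) and $m_{3,n}=3$; $F_4$ is over $[1,4]$ with $m_{12}=m_{34}=3$, $m_{23}=4$; all other off-diagonal entries are $2$. $\mathrm{Br}^+(I_2(m))$ has generators $\widehat T_1,\widehat T_2$ with $\widehat T_1\widehat T_2\cdots=\widehat T_2\widehat T_1\cdots$ ($m$ factors each); $I_2(3)=A_2$, $I_2(4)=B_2$. For $w\in W(M)$ with reduced expression $s_{i_1}\cdots s_{i_k}$, $T_w=T_{i_1}\cdots T_{i_k}$; $w_\circ^J$ is the longest element of the parabolic subgroup generated by $s_j$, $j\in J$, and $w_{J;K}=w_\circ^Jw_\circ^K$ for $J\subset K$. A homomorphism $\Phi:\mathrm{Br}^+(I_2(m))\to\mathrm{Br}^+(M)$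 is standard if $\Phi(\widehat T_i)=T_{w_\circ^{[\Phi](i)}}$, $i\in\{1,2\}$, for some $[\Phi](i)\subset I$; fully supported if $[\Phi](1)\cup[\Phi](2)=I$; of Coxeter type if there is a group homomorphism $\phi:W(I_2(m))\to W(M)$ with $\phi\circ\pi_{I_2(m)}=\pi_M\circ\Phi$; optimal if, whenever $X_1=\Phi(\widehat T_1)\neq X_2=\Phi(\widehat T_2)$, $m$ is the smallest positive integer $k$ with $X_1X_2X_1\cdots=X_2X_1X_2\cdots$ ($k$ factors each). Subsets $J,K\subset I$ are orthogonal if $m_{jk}=2$ for all $j\in J,k\in K$; weakly orthogonal if $J\setminus K$ is orthogonal to $K$ and $K\setminus J$ is orthogonal to $J$.
   Formalization: In (c) the list is enlarged by the constant homomorphism sending both generators to T_{w∘^I}, for every m and M: with X_1=X_2 it is vacuously optimal, standard and fully supported, yet the stated list has it only for m=4, M=E_6. *)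

theory Defs
  imports "HOL-Algebra.Generated_Groups" "HOL-Combinatorics.Transposition"
begin

inductive_set pres_cong :: "'i set \<Rightarrow> ('i list \<times> 'i list) set \<Rightarrow> ('i list \<times> 'i list) set"
  for I R where
  refl: "u \<in> lists I \<Longrightarrow> (u, u) \<in> pres_cong I R"
| step: "(r, r') \<in> R \<Longrightarrow> u \<in> lists I \<Longrightarrow> v \<in> lists I
          \<Longrightarrow> (u @ r @ v, u @ r' @ v) \<in> pres_cong I R"
| sym: "(u, v) \<in> pres_cong I R \<Longrightarrow> (v, u) \<in> pres_cong I R"
| trans: "(u, v) \<in> pres_cong I R \<Longrightarrow> (v, w) \<in> pres_cong I R \<Longrightarrow> (u, w) \<in> pres_cong I R"

definition pres_monoid :: "'i set \<Rightarrow> ('i list \<times> 'i list) set \<Rightarrow> 'i list set monoid" where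
  "pres_monoid I R =
     \<lparr> carrier = lists I // pres_cong I R,
       mult = (\<lambda>X Y. \<Union>u\<in>X. \<Union>v\<in>Y. pres_cong I R `` {u @ v}),
       one = pres_cong I R `` {[]} \<rparr>"

text \<open>A \<open>hom\<close> of \<open>HOL-Algebra\<close> is only multiplicative; between monoids, preservation of
  the unit has to be required.\<close>

definition monoid_homs :: "('a, 'c) monoid_scheme \<Rightarrow> ('b, 'd) monoid_scheme \<Rightarrow> ('a \<Rightarrow> 'b) set" where
  "monoid_homs G H = {h \<in> hom G H. h \<one>\<^bsub>G\<^esub> = \<one>\<^bsub>H\<^esub>}"

primrec alternating :: "'a \<Rightarrow> 'a \<Rightarrow> nat \<Rightarrow> 'a list" where
  "alternating a b 0 = []"
| "alternating a b (Suc n) = a # alternating b a n"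

definition alt_prod :: "('a, 'c) monoid_scheme \<Rightarrow> 'a \<Rightarrow> 'a \<Rightarrow> nat \<Rightarrow> 'a" where
  "alt_prod G x y k = foldr (\<otimes>\<^bsub>G\<^esub>) (alternating x y k) \<one>\<^bsub>G\<^esub>"

text \<open>An entry \<open>\<infinity>\<close> of a Coxeter matrix would be encoded as \<open>0\<close>, which makes the
  corresponding defining relations below trivial.\<close>

record 'i coxeter_matrix =
  index :: "'i set"
  entry :: "'i \<Rightarrow> 'i \<Rightarrow> nat"

definition artin_cong :: "'i coxeter_matrix \<Rightarrow> ('i list \<times> 'i list) set" where
  "artin_cong M = pres_cong (index M)
     {(alternating i j (entry M i j), alternating j i (entry M i j)) | i j.
        i \<in> index M \<and> j \<in> index M \<and> i \<noteq> j}"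

definition artin_monoid :: "'i coxeter_matrix \<Rightarrow> 'i list set monoid" where
  "artin_monoid M = pres_monoid (index M)
     {(alternating i j (entry M i j), alternating j i (entry M i j)) | i j.
        i \<in> index M \<and> j \<in> index M \<and> i \<noteq> j}"

definition artin_elem :: "'i coxeter_matrix \<Rightarrow> 'i list \<Rightarrow> 'i list set" where
  "artin_elem M u = artin_cong M `` {u}"

abbreviation artin_gen :: "'i coxeter_matrix \<Rightarrow> 'i \<Rightarrow> 'i list set" where
  "artin_gen M i \<equiv> artin_elem M [i]"

text \<open>The Coxeter relations are \<open>(s\<^sub>i s\<^sub>j) ^ m\<^sub>i\<^sub>j = 1\<close> for all \<open>i, j\<close>. As the diagonal entries
  are \<open>1\<close>, every generator is an involution, so the monoid with this presentation is the
  group with this presentation.\<close>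

definition cox_cong :: "'i coxeter_matrix \<Rightarrow> ('i list \<times> 'i list) set" where
  "cox_cong M = pres_cong (index M)
     {(alternating i j (2 * entry M i j), []) | i j. i \<in> index M \<and> j \<in> index M}"

definition cox_group :: "'i coxeter_matrix \<Rightarrow> 'i list set monoid" where
  "cox_group M = pres_monoid (index M)
     {(alternating i j (2 * entry M i j), []) | i j. i \<in> index M \<and> j \<in> index M}"

definition cox_elem :: "'i coxeter_matrix \<Rightarrow> 'i list \<Rightarrow> 'i list set" where
  "cox_elem M u = cox_cong M `` {u}"

text \<open>The projection maps the class of a word to the Coxeter class of the same word: the
  Artin congruence refines the Coxeter congruence, so the image of an Artin class under the
  latter is a single Coxeter class.\<close>

definition cox_proj :: "'i coxeter_matrix \<Rightarrow> 'i list set \<Rightarrow> 'i list set" where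
  "cox_proj M X = cox_cong M `` X"

definition cox_length :: "'i coxeter_matrix \<Rightarrow> 'i list set \<Rightarrow> nat" where
  "cox_length M w = (LEAST n. \<exists>u\<in>w. length u = n)"

definition reduced_expr :: "'i coxeter_matrix \<Rightarrow> 'i list set \<Rightarrow> 'i list \<Rightarrow> bool" where
  "reduced_expr M w u \<longleftrightarrow> u \<in> w \<and> length u = cox_length M w"

text \<open>\<open>T\<^sub>w\<close>; by Matsumoto's theorem it does not depend on the chosen reduced expression.\<close>

definition artin_lift :: "'i coxeter_matrix \<Rightarrow> 'i list set \<Rightarrow> 'i list set" where
  "artin_lift M w = artin_elem M (SOME u. reduced_expr M w u)"

definition parabolic :: "'i coxeter_matrix \<Rightarrow> 'i set \<Rightarrow> 'i list set set" where
  "parabolic M J = generate (cox_group M) ((\<lambda>j. cox_elem M [j]) ` J)"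

definition longest :: "'i coxeter_matrix \<Rightarrow> 'i set \<Rightarrow> 'i list set" where
  "longest M J = (THE w. w \<in> parabolic M J \<and> (\<forall>v \<in> parabolic M J. cox_length M v \<le> cox_length M w))"

text \<open>\<open>w\<^bsub>J;K\<^esub>\<close>\<close>

definition longest_rel :: "'i coxeter_matrix \<Rightarrow> 'i set \<Rightarrow> 'i set \<Rightarrow> 'i list set" where
  "longest_rel M J K = longest M J \<otimes>\<^bsub>cox_group M\<^esub> longest M K"

definition orthogonal_sets :: "'i coxeter_matrix \<Rightarrow> 'i set \<Rightarrow> 'i set \<Rightarrow> bool" where
  "orthogonal_sets M J K \<longleftrightarrow> (\<forall>j\<in>J. \<forall>k\<in>K. entry M j k = 2)"

definition weakly_orthogonal_sets :: "'i coxeter_matrix \<Rightarrow> 'i set \<Rightarrow> 'i set \<Rightarrow> bool" where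
  "weakly_orthogonal_sets M J K \<longleftrightarrow> orthogonal_sets M (J - K) K \<and> orthogonal_sets M (K - J) J"

definition I2_mat :: "nat \<Rightarrow> nat coxeter_matrix" where
  "I2_mat m = \<lparr> index = {1, 2}, entry = (\<lambda>i j. if i = j then 1 else m) \<rparr>"

definition F4_mat :: "nat coxeter_matrix" where
  "F4_mat = \<lparr> index = {1..4},
     entry = (\<lambda>i j. if i = j then 1
                    else if {i, j} \<in> {{1, 2}, {3, 4}} then 3
                    else if {i, j} = {2, 3} then 4
                    else 2) \<rparr>"

definition E_mat :: "nat \<Rightarrow> nat coxeter_matrix" where
  "E_mat n = \<lparr> index = {1..n},
     entry = (\<lambda>i j. if i = j then 1
                    else if {i, j} \<in> {{k, k + 1} | k. 1 \<le> k \<and> k + 2 \<le> n} \<union> {{3, n}} then 3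
                    else 2) \<rparr>"

abbreviation dihedral_homs ::
    "nat \<Rightarrow> 'i coxeter_matrix \<Rightarrow> (nat list set \<Rightarrow> 'i list set) set" where
  "dihedral_homs m M \<equiv> monoid_homs (artin_monoid (I2_mat m)) (artin_monoid M)"

definition coxeter_type ::
    "nat \<Rightarrow> 'i coxeter_matrix \<Rightarrow> (nat list set \<Rightarrow> 'i list set) \<Rightarrow> bool" where
  "coxeter_type m M \<Phi> \<longleftrightarrow>
     (\<exists>\<phi> \<in> hom (cox_group (I2_mat m)) (cox_group M).
        \<forall>X \<in> carrier (artin_monoid (I2_mat m)). \<phi> (cox_proj (I2_mat m) X) = cox_proj M (\<Phi> X))"

text \<open>\<open>S\<close> plays the role of \<open>[\<Phi>]\<close>.\<close>

definition standard_with ::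
    "nat \<Rightarrow> 'i coxeter_matrix \<Rightarrow> (nat list set \<Rightarrow> 'i list set) \<Rightarrow> (nat \<Rightarrow> 'i set) \<Rightarrow> bool" where
  "standard_with m M \<Phi> S \<longleftrightarrow>
     (\<forall>i \<in> {1, 2}. S i \<subseteq> index M \<and> \<Phi> (artin_gen (I2_mat m) i) = artin_lift M (longest M (S i)))"

definition standard ::
    "nat \<Rightarrow> 'i coxeter_matrix \<Rightarrow> (nat list set \<Rightarrow> 'i list set) \<Rightarrow> bool" where
  "standard m M \<Phi> \<longleftrightarrow> (\<exists>S. standard_with m M \<Phi> S)"

definition fully_supported_standard ::
    "nat \<Rightarrow> 'i coxeter_matrix \<Rightarrow> (nat list set \<Rightarrow> 'i list set) \<Rightarrow> bool" where
  "fully_supported_standard m M \<Phi> \<longleftrightarrow> (\<exists>S. standard_with m M \<Phi> S \<and> S 1 \<union> S 2 = index M)"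

definition optimal ::
    "nat \<Rightarrow> 'i coxeter_matrix \<Rightarrow> (nat list set \<Rightarrow> 'i list set) \<Rightarrow> bool" where
  "optimal m M \<Phi> \<longleftrightarrow>
     (let X1 = \<Phi> (artin_gen (I2_mat m) 1);
          X2 = \<Phi> (artin_gen (I2_mat m) 2);
          braided = (\<lambda>k. alt_prod (artin_monoid M) X1 X2 k = alt_prod (artin_monoid M) X2 X1 k)
      in X1 \<noteq> X2 \<longrightarrow> 0 < m \<and> braided m \<and> (\<forall>k. 0 < k \<and> k < m \<longrightarrow> \<not> braided k))"

definition swap_aut :: "nat \<Rightarrow> (nat list set \<Rightarrow> nat list set) \<Rightarrow> bool" where
  "swap_aut m \<sigma> \<longleftrightarrow> \<sigma> \<in> dihedral_homs m (I2_mat m)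
     \<and> \<sigma> (artin_gen (I2_mat m) 1) = artin_gen (I2_mat m) 2
     \<and> \<sigma> (artin_gen (I2_mat m) 2) = artin_gen (I2_mat m) 1"

definition hom_data :: "(nat \<times> nat coxeter_matrix \<times> nat set) set" where
  "hom_data = {(3, E_mat 6, {1..6} - {5}), (4, F4_mat, {1..4} - {4}),
               (4, E_mat 7, {1..7} - {5, 6}), (4, E_mat 8, {1..8} - {7})}"

definition K_choices :: "nat \<Rightarrow> nat coxeter_matrix \<Rightarrow> nat set set" where
  "K_choices m M = (if m = 4 \<and> M = E_mat 7 then {{}, {6}} else {{}})"

text \<open>The homomorphism \<open>\<Phi>\<close> (which is determined by its values on the generators) sends
  the two generators to \<open>x\<close> and \<open>y\<close>.\<close>

definition hom_given_by ::
    "nat \<Rightarrow> 'i coxeter_matrix \<Rightarrow> (nat list set \<Rightarrow> 'i list set) \<Rightarrow> 'i list set \<Rightarrow> 'i list set \<Rightarrow> bool" where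
  "hom_given_by m M \<Phi> x y \<longleftrightarrow> \<Phi> \<in> dihedral_homs m M
     \<and> \<Phi> (artin_gen (I2_mat m) 1) = x \<and> \<Phi> (artin_gen (I2_mat m) 2) = y"

definition is_Phi ::
    "nat \<Rightarrow> nat coxeter_matrix \<Rightarrow> nat set \<Rightarrow> (nat list set \<Rightarrow> nat list set) \<Rightarrow> bool" where
  "is_Phi m M J\<^sub>1 \<Phi> \<longleftrightarrow>
     (let J\<^sub>2 = index M - {1} in
      hom_given_by m M \<Phi> (artin_lift M (longest_rel M (J\<^sub>1 \<inter> J\<^sub>2) J\<^sub>1))
                         (artin_lift M (longest_rel M (J\<^sub>1 \<inter> J\<^sub>2) J\<^sub>2)))"

definition is_hat_Phi ::
    "nat \<Rightarrow> nat coxeter_matrix \<Rightarrow> nat set \<Rightarrow> nat set \<Rightarrow> (nat list set \<Rightarrow> nat list set) \<Rightarrow> bool" where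
  "is_hat_Phi m M J\<^sub>1 K \<Phi> \<longleftrightarrow>
     (let J\<^sub>2 = index M - {1} in
      hom_given_by m M \<Phi> (artin_lift M (longest M (J\<^sub>1 \<union> K))) (artin_lift M (longest M J\<^sub>2)))"

definition is_unfolding :: "(nat list set \<Rightarrow> nat list set) \<Rightarrow> bool" where
  "is_unfolding \<upsilon> \<longleftrightarrow> \<upsilon> \<in> monoid_homs (artin_monoid F4_mat) (artin_monoid (E_mat 6))
     \<and> \<upsilon> (artin_gen F4_mat 1) = artin_elem (E_mat 6) [1, 5]
     \<and> \<upsilon> (artin_gen F4_mat 2) = artin_elem (E_mat 6) [2, 4]
     \<and> \<upsilon> (artin_gen F4_mat 3) = artin_elem (E_mat 6) [3]
     \<and> \<upsilon> (artin_gen F4_mat 4) = artin_elem (E_mat 6) [6]"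

definition \<tau> :: "nat \<Rightarrow> nat" where
  "\<tau> = transpose 1 5 \<circ> transpose 2 4"

definition E6_choices :: "nat set set" where
  "E6_choices = {{1..6}} \<union>
     {J. J \<subseteq> {1..6} \<and> J \<noteq> \<tau> ` J \<and> weakly_orthogonal_sets (E_mat 6) J (\<tau> ` J)}"

definition is_E6_hom :: "nat set \<Rightarrow> (nat list set \<Rightarrow> nat list set) \<Rightarrow> bool" where
  "is_E6_hom J \<Phi> \<longleftrightarrow> hom_given_by 4 (E_mat 6) \<Phi>
     (artin_lift (E_mat 6) (longest (E_mat 6) J)) (artin_lift (E_mat 6) (longest (E_mat 6) {1..6}))"

definition listed ::
    "nat \<Rightarrow> nat coxeter_matrix \<Rightarrow> (nat list set \<Rightarrow> nat list set) \<Rightarrow> bool" where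
  "listed m M \<Phi> \<longleftrightarrow>
     (\<exists>J\<^sub>1 K. (m, M, J\<^sub>1) \<in> hom_data \<and> K \<in> K_choices m M \<and> is_hat_Phi m M J\<^sub>1 K \<Phi>)
   \<or> (m = 4 \<and> M = E_mat 6 \<and>
        (\<exists>\<upsilon> \<Phi>0. is_unfolding \<upsilon> \<and> is_hat_Phi 4 F4_mat ({1..4} - {4}) {} \<Phi>0
           \<and> (\<forall>X \<in> carrier (artin_monoid (I2_mat 4)). \<Phi> X = \<upsilon> (\<Phi>0 X))))
   \<or> (m = 4 \<and> M = E_mat 6 \<and> (\<exists>J \<in> E6_choices. is_E6_hom J \<Phi>))"

text \<open>The constant homomorphism onto the longest element of the whole group. It is standard
  and fully supported, and as its two values coincide it satisfies the definition of optimality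
  vacuously, for every \<open>m\<close> and \<open>M\<close>. It has to appear in a classification of the optimal fully
  supported standard homomorphisms.\<close>

definition degenerate ::
    "nat \<Rightarrow> nat coxeter_matrix \<Rightarrow> (nat list set \<Rightarrow> nat list set) \<Rightarrow> bool" where
  "degenerate m M \<Phi> \<longleftrightarrow>
     hom_given_by m M \<Phi> (artin_lift M (longest M (index M))) (artin_lift M (longest M (index M)))"

end

theory Submission
  imports Defs
begin

text \<open>
  The Coxeter groups are studied through the numbers game: a word in the generators is played on the weight
  \<open>\<rho>\<close>, and it is reduced iff every played vertex carries a positive number. The exchange
  property of the game gives the theorem of Matsumoto: two reduced words for the same element are equal in the
  Artin monoid. Every relation that holds between reduced words is therefore proved by comparing two weights. For the
  homomorphisms in (a) and (b), both sides of the braid relation become products of such reduced words and of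
  longest elements of parabolic subgroups that commute with all other factors.

  For the classification, let \<open>X\<close> and \<open>Y\<close> be the lifts of the longest elements of \<open>J\<close> and \<open>K\<close>, with
  \<open>J \<union> K = I\<close>. If they satisfy the braid relation of length \<open>3\<close> or \<open>4\<close>, then the product \<open>XYXY\<close> in the
  0-Hecke monoid absorbs every generator, so it equals the longest element, and hence sends each fundamental weight
  to an antidominant one. This condition is monotone in \<open>J\<close> and \<open>K\<close>, and excludes all but a few pairs of maximal proper
  subsets. The exceptional pairs that survive are excluded by lengths, by the action on weights, or by a
  Burau representation. If \<open>K = I\<close>, then conjugation by \<open>Y\<close> is the diagram automorphism \<open>\<tau>\<close>, and the
  question becomes whether \<open>X\<close> commutes with \<open>\<tau>(X)\<close>.
\<close>

subsection \<open>Monoids given by presentations\<close>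

text \<open>Weights decide equality of reduced words only, and the words in the braid relations of
  (b) are not reduced: the longest element of \<open>J\<^sub>1 \<inter> J\<^sub>2\<close> recurs in
  every factor. Once it has been collected on one side, the remaining relation has reduced sides and
  can be checked by playing. For non-existence the Artin monoid is replaced by images in which
  equality is computable: letter counts, the linear action on weights, and the 0-Hecke monoid, where
  a reflection is applied only to a positive coordinate. The 0-Hecke test settles most pairs, but
  the truncated reflections are not visibly monotone in the word. Monotonicity, which turns finitely
  many tests into a statement about all pairs of subsets, comes from the set-valued action
  \<open>Fs\<close>, in which every letter may also be skipped. Relations that hold in the Coxeter
  group and in the 0-Hecke monoid without holding in the Artin monoid do occur; they force the use
  of a linear representation of the monoid that does not factor through the Coxeter group.\<close>

locale presentation =
  fixes I :: "'i set" and R :: "('i list \<times> 'i list) set"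
  assumes rels_in_lists: "R \<subseteq> lists I \<times> lists I"
begin

abbreviation cong :: "('i list \<times> 'i list) set" where
  "cong \<equiv> pres_cong I R"

abbreviation cls :: "'i list \<Rightarrow> 'i list set" where
  "cls u \<equiv> cong `` {u}"

lemma cong_in_lists: "(u, v) \<in> cong \<Longrightarrow> u \<in> lists I \<and> v \<in> lists I"
  by (induction rule: pres_cong.induct) (use rels_in_lists in auto)

lemma rel_cong: "(r, r') \<in> R \<Longrightarrow> (r, r') \<in> cong"
  using pres_cong.step[of r r' R "[]" I "[]"] by simp

lemma cong_equiv: "equiv (lists I) cong"
  by (intro equivI refl_onI symI transI)
    (auto intro: pres_cong.intros dest: cong_in_lists)

lemma cong_append_context:
  assumes "(u, v) \<in> cong" "a \<in> lists I" "b \<in> lists I"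
  shows "(a @ u @ b, a @ v @ b) \<in> cong"
  using assms
proof (induction rule: pres_cong.induct)
  case (refl u)
  then show ?case by (intro pres_cong.refl) auto
next
  case (step r r' u v)
  then show ?case using pres_cong.step[of r r' R "a @ u" I "v @ b"] by simp
next
  case (sym u v)
  then show ?case by (blast intro: pres_cong.sym)
next
  case (trans u v w)
  then show ?case by (blast intro: pres_cong.trans)
qed

lemma cong_append:
  assumes "(u, u') \<in> cong" "(v, v') \<in> cong"
  shows "(u @ v, u' @ v') \<in> cong"
proof -
  note l = cong_in_lists[OF assms(1)] cong_in_lists[OF assms(2)]
  have "(u @ v, u' @ v) \<in> cong" using cong_append_context[OF assms(1), of "[]" v] l by simp
  moreover have "(u' @ v, u' @ v') \<in> cong"
    using cong_append_context[OF assms(2), of u' "[]"] l by simp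
  ultimately show ?thesis by (rule pres_cong.trans)
qed

lemma cls_eq_iff: "u \<in> lists I \<Longrightarrow> v \<in> lists I \<Longrightarrow> cls u = cls v \<longleftrightarrow> (u, v) \<in> cong"
  by (meson cong_equiv eq_equiv_class_iff)

lemma carrier_eq: "carrier (pres_monoid I R) = cls ` lists I"
  by (auto simp: pres_monoid_def quotient_def)

lemma cls_in_carrier: "u \<in> lists I \<Longrightarrow> cls u \<in> carrier (pres_monoid I R)"
  by (auto simp: carrier_eq)

lemma one_eq: "\<one>\<^bsub>pres_monoid I R\<^esub> = cls []"
  by (simp add: pres_monoid_def)

lemma mult_cls:
  assumes "u \<in> lists I" "v \<in> lists I"
  shows "cls u \<otimes>\<^bsub>pres_monoid I R\<^esub> cls v = cls (u @ v)"
proof -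
  have "cls (a @ b) = cls (u @ v)" if "a \<in> cls u" "b \<in> cls v" for a b
  proof -
    have "(u @ v, a @ b) \<in> cong" using that by (intro cong_append) auto
    then show ?thesis using equiv_class_eq[OF cong_equiv] by blast
  qed
  moreover have "u \<in> cls u" "v \<in> cls v" using assms by (auto intro: pres_cong.refl)
  ultimately have "(\<Union>a\<in>cls u. \<Union>b\<in>cls v. cls (a @ b)) = cls (u @ v)" by blast
  then show ?thesis by (simp only: pres_monoid_def monoid.simps partial_object.simps)
qed

lemma is_monoid: "Group.monoid (pres_monoid I R)"
proof (rule monoidI)
  fix X Y Z :: "'i list set"
  let ?G = "pres_monoid I R"
  assume "X \<in> carrier ?G" "Y \<in> carrier ?G" "Z \<in> carrier ?G"
  then obtain x y z where "X = cls x" "Y = cls y" "Z = cls z"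
    and xyz: "x \<in> lists I" "y \<in> lists I" "z \<in> lists I" by (auto simp only: carrier_eq)
  then show "(X \<otimes>\<^bsub>?G\<^esub> Y) \<otimes>\<^bsub>?G\<^esub> Z = X \<otimes>\<^bsub>?G\<^esub> (Y \<otimes>\<^bsub>?G\<^esub> Z)"
    by (simp add: mult_cls)
next
  fix X Y :: "'i list set"
  let ?G = "pres_monoid I R"
  assume "X \<in> carrier ?G" "Y \<in> carrier ?G"
  then obtain x y where e: "X = cls x" "Y = cls y" and xy: "x \<in> lists I" "y \<in> lists I"
    by (auto simp only: carrier_eq)
  then show "X \<otimes>\<^bsub>?G\<^esub> Y \<in> carrier ?G"
    by (simp only: mult_cls cls_in_carrier append_in_lists_conv simp_thms)
next
  show "\<one>\<^bsub>pres_monoid I R\<^esub> \<in> carrier (pres_monoid I R)" by (auto simp only: one_eq cls_in_carrier lists.Nil)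
next
  fix X :: "'i list set"
  let ?G = "pres_monoid I R"
  assume "X \<in> carrier ?G"
  then obtain x where x: "X = cls x" "x \<in> lists I" by (auto simp only: carrier_eq)
  show "\<one>\<^bsub>?G\<^esub> \<otimes>\<^bsub>?G\<^esub> X = X"
    unfolding x(1) one_eq mult_cls[OF lists.Nil x(2)] by simp
  show "X \<otimes>\<^bsub>?G\<^esub> \<one>\<^bsub>?G\<^esub> = X"
    unfolding x(1) one_eq mult_cls[OF x(2) lists.Nil] by simp
qed

lemma concat_alternating_in_lists:
  "u \<in> lists I \<Longrightarrow> v \<in> lists I \<Longrightarrow> concat (alternating u v k) \<in> lists I"
  by (induction k arbitrary: u v) auto

lemma alt_prod_cls:
  "u \<in> lists I \<Longrightarrow> v \<in> lists I \<Longrightarrow>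
    alt_prod (pres_monoid I R) (cls u) (cls v) k = cls (concat (alternating u v k))"
  by (induction k arbitrary: u v)
    (auto simp: alt_prod_def one_eq mult_cls concat_alternating_in_lists)

text \<open>The union over all representatives avoids a choice; once \<open>f\<close> respects the
  relations, its members coincide (\<open>extend_cls\<close>).\<close>

definition extend :: "('i \<Rightarrow> 'j list) \<Rightarrow> 'j set \<Rightarrow> ('j list \<times> 'j list) set \<Rightarrow> 'i list set \<Rightarrow> 'j list set" where
  "extend f I' R' X = (\<Union>u\<in>X. pres_cong I' R' `` {concat (map f u)})"

lemma concat_map_in_lists: "f ` I \<subseteq> lists A \<Longrightarrow> u \<in> lists I \<Longrightarrow> concat (map f u) \<in> lists A"
  by (induction u) auto

context
  fixes f :: "'i \<Rightarrow> 'j list" and I' :: "'j set" and R'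
  assumes target: "presentation I' R'" and f_in: "f ` I \<subseteq> lists I'"
    and f_rels: "\<And>r r'. (r, r') \<in> R \<Longrightarrow> (concat (map f r), concat (map f r')) \<in> pres_cong I' R'"
begin

lemma concat_map_cong:
  assumes "(u, v) \<in> cong" shows "(concat (map f u), concat (map f v)) \<in> pres_cong I' R'"
  using assms
proof (induction rule: pres_cong.induct)
  case (refl u)
  then show ?case by (simp add: concat_map_in_lists f_in pres_cong.refl)
next
  case (step r r' u v)
  then show ?case
    using presentation.cong_append_context[OF target f_rels concat_map_in_lists[OF f_in] concat_map_in_lists[OF f_in]]
    by simp
next
  case (sym u v)
  show ?case by (rule pres_cong.sym[OF sym.IH])
next
  case (trans u v w)
  show ?case by (rule pres_cong.trans[OF trans.IH])
qed

lemma extend_cls: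
  assumes "u \<in> lists I"
  shows "extend f I' R' (cls u) = pres_cong I' R' `` {concat (map f u)}"
proof -
  have "pres_cong I' R' `` {concat (map f v)} = pres_cong I' R' `` {concat (map f u)}"
    if "v \<in> cls u" for v
  proof -
    have "(concat (map f u), concat (map f v)) \<in> pres_cong I' R'"
      using that by (intro concat_map_cong) auto
    then show ?thesis using equiv_class_eq[OF presentation.cong_equiv[OF target]] by blast
  qed
  moreover have "u \<in> cls u" using assms by (auto intro: pres_cong.refl)
  ultimately show ?thesis unfolding extend_def by blast
qed

lemma extend_hom: "extend f I' R' \<in> monoid_homs (pres_monoid I R) (pres_monoid I' R')"
proof -
  interpret T: presentation I' R' by (fact target)
  note m = concat_map_in_lists[OF f_in]
  show ?thesis
    unfolding monoid_homs_def
  proof (intro CollectI conjI homI)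
    fix X assume "X \<in> carrier (pres_monoid I R)"
    then obtain u where u: "u \<in> lists I" "X = cls u" by (auto simp only: carrier_eq)
    show "extend f I' R' X \<in> carrier (pres_monoid I' R')"
      unfolding u(2) extend_cls[OF u(1)] by (rule T.cls_in_carrier[OF m[OF u(1)]])
    fix Y assume "Y \<in> carrier (pres_monoid I R)"
    then obtain v where v: "v \<in> lists I" "Y = cls v" by (auto simp only: carrier_eq)
    have uv: "u @ v \<in> lists I" using u v by simp
    show "extend f I' R' (X \<otimes>\<^bsub>pres_monoid I R\<^esub> Y) =
        extend f I' R' X \<otimes>\<^bsub>pres_monoid I' R'\<^esub> extend f I' R' Y"
      unfolding u(2) v(2) mult_cls[OF u(1) v(1)] extend_cls[OF uv] extend_cls[OF u(1)]
        extend_cls[OF v(1)] T.mult_cls[OF m[OF u(1)] m[OF v(1)]] by simp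
  next
    show "extend f I' R' \<one>\<^bsub>pres_monoid I R\<^esub> = \<one>\<^bsub>pres_monoid I' R'\<^esub>"
      using extend_cls[of "[]"] by (simp add: one_eq T.one_eq)
  qed
qed

end

lemma hom_eq_on_carrier:
  assumes "h \<in> monoid_homs (pres_monoid I R) G" "h' \<in> monoid_homs (pres_monoid I R) G"
    and gens: "\<And>i. i \<in> I \<Longrightarrow> h (cls [i]) = h' (cls [i])"
    and "X \<in> carrier (pres_monoid I R)"
  shows "h X = h' X"
proof -
  have "h (cls u) = h' (cls u)" if "u \<in> lists I" for u
    using that
  proof (induction u)
    case Nil
    then show ?case using assms(1,2) by (simp add: monoid_homs_def one_eq[symmetric])
  next
    case (Cons i u)
    then have u: "u \<in> lists I" "[i] \<in> lists I" by auto
    have "h (cls ([i] @ u)) = h (cls [i]) \<otimes>\<^bsub>G\<^esub> h (cls u)"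
      "h' (cls ([i] @ u)) = h' (cls [i]) \<otimes>\<^bsub>G\<^esub> h' (cls u)"
      using assms(1,2) u unfolding mult_cls[OF u(2,1), symmetric]
      by (auto simp only: monoid_homs_def mem_Collect_eq intro!: hom_mult cls_in_carrier)
    moreover have "h (cls [i]) = h' (cls [i])" "h (cls u) = h' (cls u)"
      using Cons gens by auto
    ultimately show ?case by simp
  qed
  then show ?thesis using assms(4) by (auto simp: carrier_eq)
qed

end

subsection \<open>Artin monoids and Coxeter groups\<close>

abbreviation artin_rels :: "'i coxeter_matrix \<Rightarrow> ('i list \<times> 'i list) set" where
  "artin_rels M \<equiv> {(alternating i j (entry M i j), alternating j i (entry M i j)) | i j.
        i \<in> index M \<and> j \<in> index M \<and> i \<noteq> j}"

abbreviation cox_rels :: "'i coxeter_matrix \<Rightarrow> ('i list \<times> 'i list) set" where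
  "cox_rels M \<equiv> {(alternating i j (2 * entry M i j), []) | i j. i \<in> index M \<and> j \<in> index M}"

lemma set_alternating: "set (alternating a b k) \<subseteq> {a, b}"
  by (induction k arbitrary: a b) auto

lemma artin_presentation: "presentation (index M) (artin_rels M)"
  by unfold_locales (auto dest: set_alternating[THEN subsetD])

lemma cox_presentation: "presentation (index M) (cox_rels M)"
  by unfold_locales (auto dest: set_alternating[THEN subsetD])

interpretation artin: presentation "index M" "artin_rels M"
  rewrites "pres_cong (index M) (artin_rels M) = artin_cong M"
    and "pres_monoid (index M) (artin_rels M) = artin_monoid M"
  for M :: "'i coxeter_matrix"
  by (simp_all add: artin_presentation artin_cong_def artin_monoid_def)

interpretation cox: presentation "index M" "cox_rels M"
  rewrites "pres_cong (index M) (cox_rels M) = cox_cong M"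
    and "pres_monoid (index M) (cox_rels M) = cox_group M"
  for M :: "'i coxeter_matrix"
  by (simp_all add: cox_presentation cox_cong_def cox_group_def)

subsection \<open>The numbers game\<close>

text \<open>\<open>c\<close> is a Cartan matrix for \<open>M\<close>. With bonds 2, 3 and 4 only,
  weights stay integral and every rank two argument is a finite case distinction. The dihedral
  matrices for m = 3 and m = 4 are instances as well, so the theory serves both source and target of
  a homomorphism.\<close>

locale numbers_game =
  fixes M :: "'i coxeter_matrix" and c :: "'i \<Rightarrow> 'i \<Rightarrow> int"
  assumes entry_diag: "i \<in> index M \<Longrightarrow> entry M i i = 1"
    and entry_sym: "entry M i j = entry M j i"
    and cartan_diag: "i \<in> index M \<Longrightarrow> c i i = 2"
    and bond: "\<lbrakk>i \<in> index M; j \<in> index M; i \<noteq> j\<rbrakk> \<Longrightarrow>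
      entry M i j = 2 \<and> c i j = 0 \<and> c j i = 0 \<or>
      entry M i j = 3 \<and> c i j = -1 \<and> c j i = -1 \<or>
      entry M i j = 4 \<and> c i j = -1 \<and> c j i = -2 \<or>
      entry M i j = 4 \<and> c i j = -2 \<and> c j i = -1"
begin

abbreviation I where "I \<equiv> index M"

text \<open>A weight is represented by its pairings with the simple coroots; \<open>s i\<close> is the simple reflection.\<close>

definition s :: "'i \<Rightarrow> ('i \<Rightarrow> int) \<Rightarrow> 'i \<Rightarrow> int" where
  "s i v = (\<lambda>k. v k - c k i * v i)"

definition act :: "'i list \<Rightarrow> ('i \<Rightarrow> int) \<Rightarrow> 'i \<Rightarrow> int" where
  "act t v = foldr s t v"

lemma act_simps [simp]: "act [] v = v" "act (i # t) v = s i (act t v)"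
  "act (t @ u) v = act t (act u v)"
  by (simp_all add: act_def)

text \<open>The last letter of a word is the first move, hence the condition on
  \<open>act t r i\<close> for the tail \<open>t\<close>.\<close>

primrec legal :: "('i \<Rightarrow> int) \<Rightarrow> 'i list \<Rightarrow> bool" where
  "legal r [] = True"
| "legal r (i # t) = (legal r t \<and> i \<in> I \<and> act t r i > 0)"

lemma legal_append: "legal r (t @ u) \<longleftrightarrow> legal r u \<and> legal (act u r) t"
  by (induction t) auto

lemma legal_in_lists: "legal r t \<Longrightarrow> t \<in> lists I"
  by (induction t) auto

abbreviation braid_eq :: "'i list \<Rightarrow> 'i list \<Rightarrow> bool" (infix "\<approx>" 50) where
  "t \<approx> u \<equiv> (t, u) \<in> artin_cong M"

lemmas braid_sym = pres_cong.sym[of _ _ I "artin_rels M", folded artin_cong_def]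
lemmas braid_trans [trans] = pres_cong.trans[of _ _ I "artin_rels M", folded artin_cong_def]
lemmas braid_refl = pres_cong.refl[of _ I "artin_rels M", folded artin_cong_def]
lemmas braid_append = artin.cong_append[of _ _ M]
lemmas braid_induct = pres_cong.induct[of _ _ I "artin_rels M", folded artin_cong_def,
    consumes 1, case_names refl step sym trans]

lemma braid_refl': "set u \<subseteq> I \<Longrightarrow> u \<approx> u" by (rule braid_refl) auto

lemma braid_Cons: "t \<approx> u \<Longrightarrow> i \<in> I \<Longrightarrow> i # t \<approx> i # u"
  using braid_append[of "[i]" "[i]" t u] braid_refl'[of "[i]"] by simp

lemma braid_rel: "i \<in> I \<Longrightarrow> j \<in> I \<Longrightarrow> i \<noteq> j \<Longrightarrow>
    alternating i j (entry M i j) @ u \<approx> alternating j i (entry M i j) @ u" if "u \<in> lists I"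
  using that by (intro braid_append braid_refl artin.rel_cong) auto

lemma braid_lists: "t \<approx> u \<Longrightarrow> t \<in> lists I \<and> u \<in> lists I"
  by (rule artin.cong_in_lists)

lemma alternating_numeral [simp]:
  "alternating i j 2 = [i, j]" "alternating i j 3 = [i, j, i]" "alternating i j 4 = [i, j, i, j]"
  by (simp_all add: numeral_eq_Suc)

lemma s_s [simp]: "i \<in> I \<Longrightarrow> s i (s i v) = v"
  by (rule ext) (simp add: s_def cartan_diag algebra_simps)

lemma s_self: "i \<in> I \<Longrightarrow> s i v i = - v i"
  by (simp add: s_def cartan_diag)

lemma s_braid:
  assumes "i \<in> I" "j \<in> I" "i \<noteq> j"
  shows "act (alternating i j (entry M i j)) v = act (alternating j i (entry M i j)) v"
  using bond[OF assms] assms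
  by (elim disjE; intro ext; simp add: s_def cartan_diag algebra_simps)

lemma s_rel: "(x, x') \<in> artin_rels M \<Longrightarrow> act x v = act x' v"
  using s_braid by blast

lemma act_cong: "t \<approx> u \<Longrightarrow> act t v = act u v"
proof (induction rule: braid_induct)
  case (step r r' u v)
  then show ?case by (simp only: act_simps s_rel[OF step(1)])
qed auto

text \<open>The alternating word of length \<open>entry M i j\<close> plays the rank two game to its
  end, which is legal exactly from a position with both numbers positive. This is symmetric in
  \<open>i\<close> and \<open>j\<close>, and so \<open>legal\<close> is invariant under braid
  relations.\<close>

lemma legal_alternating:
  assumes "i \<in> I" "j \<in> I" "i \<noteq> j"
  shows "legal r (alternating i j (entry M i j)) \<longleftrightarrow> r i > 0 \<and> r j > 0"
  using bond[OF assms] assms by (elim disjE; auto simp: s_def cartan_diag)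

lemma legal_cong: "t \<approx> u \<Longrightarrow> legal r t \<longleftrightarrow> legal r u"
proof (induction rule: braid_induct)
  case (step x x' u v)
  then obtain i j where ij: "i \<in> I" "j \<in> I" "i \<noteq> j"
    "x = alternating i j (entry M i j)" "x' = alternating j i (entry M i j)" by auto
  then have "legal w x \<longleftrightarrow> legal w x'" for w
    using legal_alternating[of i j w] legal_alternating[of j i w] by (auto simp: entry_sym)
  then show ?case by (simp only: legal_append act_simps s_rel[OF step(1)])
qed auto

lemma sum_list_alternating:
  fixes f :: "'i \<Rightarrow> nat"
  assumes "i \<in> I" "j \<in> I" "i \<noteq> j" "entry M i j = 3 \<Longrightarrow> f i = f j"
  shows "sum_list (map f (alternating i j (entry M i j))) = sum_list (map f (alternating j i (entry M i j)))"
  using bond[OF assms(1-3)] assms(4) by (elim disjE; simp)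

text \<open>For an even bond both sides have the same letters. For a bond 3 they trade one
  \<open>i\<close> for one \<open>j\<close>, so the weights of the two letters have to
  agree.\<close>

lemma sum_list_cong:
  fixes f :: "'i \<Rightarrow> nat"
  assumes "t \<approx> u" and "\<And>i j. i \<in> I \<Longrightarrow> j \<in> I \<Longrightarrow> entry M i j = 3 \<Longrightarrow> f i = f j"
  shows "sum_list (map f t) = sum_list (map f u)"
  using assms(1)
proof (induction rule: braid_induct)
  case (step x x' u v)
  then have "sum_list (map f x) = sum_list (map f x')" using sum_list_alternating assms(2) by blast
  then show ?case by simp
qed auto

lemma length_cong: "t \<approx> u \<Longrightarrow> length t = length u"
  using sum_list_cong[of t u "\<lambda>_. 1"] by (simp add: sum_list_triv)

lemma set_cong: "t \<approx> u \<Longrightarrow> set t = set u"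
proof (induction rule: braid_induct)
  case (step x x' u v)
  then obtain i j where ij: "i \<in> I" "j \<in> I" "i \<noteq> j"
    "x = alternating i j (entry M i j)" "x' = alternating j i (entry M i j)" by auto
  have "set x = set x'" unfolding ij using bond[OF ij(1-3)] by (elim disjE; auto)
  then show ?case by auto
qed auto

lemma rev_cong: "t \<approx> u \<Longrightarrow> rev t \<approx> rev u"
proof (induction rule: braid_induct)
  case (step x x' u v)
  then obtain i j where ij: "i \<in> I" "j \<in> I" "i \<noteq> j"
    "x = alternating i j (entry M i j)" "x' = alternating j i (entry M i j)" by auto
  have "x \<approx> x'" using step(1) by (rule artin.rel_cong)
  moreover have "rev x = x \<and> rev x' = x' \<or> rev x = x' \<and> rev x' = x"
    unfolding ij(4,5) using bond[OF ij(1-3)] by (elim disjE; simp)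
  ultimately have "rev x \<approx> rev x'" by (auto intro: braid_sym)
  then show ?case using step by (auto intro!: braid_append braid_refl)
qed (auto intro: braid_refl braid_sym braid_trans)

text \<open>The exchange property: a vertex with negative coordinate can be pulled to the front of the
  played word. If its coordinate is positive after the last move but one but negative after the last
  move, one works out the rank two game on the two vertices.\<close>

lemma exchange_aux:
  assumes J: "J \<subseteq> I" and pos: "\<And>j. j \<in> J \<Longrightarrow> r j > 0"
  shows "legal r t \<Longrightarrow> t \<in> lists J \<Longrightarrow> i \<in> J \<Longrightarrow>
    act t r i > 0 \<or> act t r i < 0 \<and> (\<exists>u \<in> lists J. legal r u \<and> t \<approx> i # u)"
proof (induction "length t" arbitrary: t i rule: less_induct)
  case less
  show ?case
  proof (cases t)
    case Nil
    then show ?thesis using pos less.prems by simp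
  next
    case (Cons j t')
    have t': "legal r t'" "t' \<in> lists J" "j \<in> J" "act t' r j > 0" using less.prems Cons by auto
    have ijI: "i \<in> I" "j \<in> I" using less.prems t' J by auto
    show ?thesis
    proof (cases "i = j")
      case True
      then show ?thesis using t' ijI less.prems(1,2) Cons
          legal_in_lists[OF less.prems(1)]
        by (auto simp: s_self intro!: bexI[of _ t'] braid_refl simp del: in_lists_conv_set)
    next
      case False
      \<comment> \<open>The induction hypothesis for words shorter than \<open>t\<close>: either the
        coordinate at \<open>k\<close> is positive, or the letter \<open>k\<close> can be peeled
        off.\<close>
      have pull: "act u r k > 0 \<or> act u r k < 0 \<and> (\<exists>u'. u' \<in> lists J \<and> legal r u' \<and> u \<approx> k # u' \<and>
          act u r = s k (act u' r) \<and> act u' r k > 0 \<and> length u' < length t)"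
        if "legal r u" "u \<in> lists J" "length u < length t" "k \<in> J" for u k
      proof -
        have "\<exists>u'. u' \<in> lists J \<and> legal r u' \<and> u \<approx> k # u' \<and>
          act u r = s k (act u' r) \<and> act u' r k > 0 \<and> length u' < length t"
          if "u' \<in> lists J" "legal r u'" "u \<approx> k # u'" for u'
          using that act_cong[OF that(3), of r] length_cong[OF that(3)] \<open>length u < length t\<close>
            legal_cong[OF that(3), of r] \<open>legal r u\<close>
          by (intro exI[of _ u']) auto
        then show ?thesis using less.hyps[OF that(3) that(1,2,4)] by blast
      qed
      have br: "t \<approx> i # w" if "t' \<approx> w'" "alternating j i (entry M i j) @ x = j # w'"
          "alternating i j (entry M i j) @ x = i # w" "x \<in> lists I" for w w' x
      proof -
        have "t \<approx> j # w'" using Cons braid_Cons[OF that(1) ijI(2)] by simp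
        also have "j # w' \<approx> i # w" using braid_rel[OF that(4), of j i] ijI False that(2,3)
          by (simp add: entry_sym)
        finally show ?thesis .
      qed
      note b = bond[OF ijI False]
      note ev = Cons s_def ijI cartan_diag
      \<comment> \<open>The letters \<open>i\<close>, \<open>j\<close>, \<open>i\<close> are peeled
        alternately from \<open>t'\<close> until both coordinates are positive. The coordinate at
        \<open>i\<close> after the final move \<open>j\<close> is negative exactly if one letter
        less than \<open>entry M i j\<close> was peeled, and then \<open>br\<close> brings
        \<open>i\<close> to the front.\<close>
      let ?x = "act t' r"
      consider "?x i > 0" | u where "?x i < 0" "u \<in> lists J" "legal r u" "t' \<approx> i # u"
          "?x = s i (act u r)" "act u r i > 0" "length u < length t"
        using pull[OF t'(1,2) _ less.prems(3)] Cons by fastforce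
      then show ?thesis
      proof cases
        case 1
        have "act t r i > 0" using b 1 t'(4) by (elim disjE; simp add: ev)
        then show ?thesis ..
      next
        case (2 u)
        let ?y = "act u r"
        have uI: "u \<in> lists I" using 2(3) legal_in_lists by blast
        consider "?y j > 0" | w where "?y j < 0" "w \<in> lists J" "legal r w" "u \<approx> j # w"
          "?y = s j (act w r)" "act w r j > 0" "length w < length t"
          using pull[OF 2(3,2,7) t'(3)] by fastforce
        then show ?thesis
        proof cases
          case y: 1
          show ?thesis
          proof (cases "entry M i j = 2")
            case True
            have "act t r i < 0" using b True 2(6) y by (elim disjE; simp add: ev 2(5))
            moreover have "t \<approx> i # j # u" using br[of "i # u" u "j # u"] 2(4) True uI by simp
            moreover have "legal r (j # u)" "j # u \<in> lists J" using 2 y ijI t' by auto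
            ultimately show ?thesis by blast
          next
            case False
            have "act t r i > 0" using b False 2(6) y t'(4) by (elim disjE; simp add: ev 2(5))
            then show ?thesis ..
          qed
        next
          case (2 w)
          note u = \<open>t' \<approx> i # u\<close> \<open>?x = s i (act u r)\<close> \<open>act u r i > 0\<close>
          let ?z = "act w r"
          have wI: "w \<in> lists I" using 2(3) legal_in_lists by blast
          have tw: "t' \<approx> i # j # w" using u(1) braid_Cons[OF 2(4) ijI(1)] braid_trans by blast
          have n2: "entry M i j \<noteq> 2"
            using b t'(4) u 2(6) by (auto simp: ev 2(5))
          consider "?z i > 0" | q where "?z i < 0" "q \<in> lists J" "legal r q" "w \<approx> i # q"
            "?z = s i (act q r)" "act q r i > 0" "length q < length t"
            using pull[OF 2(3,2,7) less.prems(3)] by fastforce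
          then show ?thesis
          proof cases
            case z: 1
            show ?thesis
            proof (cases "entry M i j = 3")
              case True
              have "act t r i < 0" using b True 2(6) z by (elim disjE; simp add: ev u(2) 2(5))
              moreover have "t \<approx> i # j # i # w" using br[of "i # j # w" w "j # i # w"] tw True wI by simp
              moreover have "legal r (j # i # w)" using b True 2 z ijI by (elim disjE; simp add: ev)
              moreover have "j # i # w \<in> lists J" using 2 less.prems t' by auto
              ultimately show ?thesis by blast
            next
              case False
              have "act t r i > 0" using b False n2 2(6) z t'(4)
                by (elim disjE; simp add: ev u(2) 2(5))
              then show ?thesis ..
            qed
          next
            case q: (2 q)
            let ?q = "act q r"
            have qI: "q \<in> lists I" using q(3) legal_in_lists by blast
            have tq: "t' \<approx> i # j # i # q"
              using tw braid_Cons[OF braid_Cons[OF q(4) ijI(2)] ijI(1)] braid_trans by blast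
            have four: "entry M i j = 4" and qj: "?q j > 0"
              using b n2 t'(4) u(3) q(6) 2(6) by (auto simp: ev u(2) 2(5) q(5))
            have "act t r i < 0" using b four q(6) qj by (elim disjE; simp add: ev u(2) 2(5) q(5))
            moreover have "t \<approx> i # j # i # j # q" using br[of "i # j # i # q" q "j # i # j # q"] tq four qI by simp
            moreover have "legal r (j # i # j # q)" using b four q qj ijI by (elim disjE; simp add: ev)
            moreover have "j # i # j # q \<in> lists J" using q less.prems t' by auto
            ultimately show ?thesis by blast
          qed
        qed
      qed
    qed
  qed
qed

lemma exchange:
  assumes "J \<subseteq> I" "\<And>j. j \<in> J \<Longrightarrow> r j > 0" "legal r t" "t \<in> lists J" "i \<in> J" "act t r i \<le> 0"
  obtains u where "u \<in> lists J" "legal r u" "t \<approx> i # u" "act u r i > 0" "act u r = s i (act t r)"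
proof -
  obtain u where u: "u \<in> lists J" "legal r u" "t \<approx> i # u"
    using exchange_aux[of J r t i] assms by force
  have "legal r (i # u)" using legal_cong[OF u(3)] assms by simp
  moreover have "act u r = s i (act t r)" using act_cong[OF u(3), of r] assms by auto
  ultimately show thesis using that u by auto
qed

end

declare in_lists_conv_set [simp del] in_listsD [rule del] in_listsI [rule del]

lemma rev_in_lists [simp]: "rev u \<in> lists A \<longleftrightarrow> u \<in> lists A"
  by (simp add: in_lists_conv_set)

lemma lists_mono': "J \<subseteq> K \<Longrightarrow> u \<in> lists J \<Longrightarrow> u \<in> lists K"
  using lists_mono by blast

section \<open>Matsumoto's theorem and words of longest elements\<close>

context numbers_game
begin

definition \<rho> :: "'i \<Rightarrow> int" where
  "\<rho> k = (if k \<in> I then 1 else 0)"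

lemma rho_pos: "J \<subseteq> I \<Longrightarrow> j \<in> J \<Longrightarrow> \<rho> j > 0"
  by (auto simp: \<rho>_def)

text \<open>The first letter of \<open>t\<close> has a negative coordinate in the common final
  weight, so the exchange property brings it to the front of \<open>u\<close> as well; removing it
  leaves shorter words.\<close>

lemma matsumoto: "legal \<rho> t \<Longrightarrow> legal \<rho> u \<Longrightarrow> act t \<rho> = act u \<rho> \<Longrightarrow> t \<approx> u"
proof (induction t arbitrary: u)
  case Nil
  show ?case
  proof (cases u)
    case (Cons j u')
    then have "j \<in> I" "act u \<rho> j < 0" using Nil(2) by (simp_all add: s_self)
    then show ?thesis unfolding Nil(3)[symmetric] by (simp add: \<rho>_def)
  qed (simp add: braid_refl)
next
  case (Cons i t)
  then have i: "i \<in> I" "legal \<rho> t" "act u \<rho> i < 0" by (auto simp: s_self simp flip: Cons.prems(3))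
  obtain u' where u': "legal \<rho> u'" "u \<approx> i # u'" "act u' \<rho> = s i (act u \<rho>)"
    by (rule exchange[of I \<rho> u i]) (use i Cons.prems(2) rho_pos legal_in_lists in auto)
  have "act t \<rho> = act u' \<rho>" unfolding u'(3) Cons.prems(3)[symmetric] using i by simp
  then have "i # t \<approx> i # u'" using Cons.IH[OF i(2) u'(1)] i braid_Cons by blast
  then show ?case using u'(2) braid_sym braid_trans by blast
qed

text \<open>Legality from a weight that is positive on \<open>J\<close> depends on the word alone:
  if a move failed from \<open>r'\<close>, exchange would put the same letter at the front of the
  word already played, and the move would fail from \<open>r\<close> too.\<close>

lemma legal_dominant_mono:
  assumes "J \<subseteq> I" "\<And>j. j \<in> J \<Longrightarrow> r j > 0" "\<And>j. j \<in> J \<Longrightarrow> r' j > 0"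
  shows "u \<in> lists J \<Longrightarrow> legal r u \<Longrightarrow> legal r' u"
proof (induction u)
  case (Cons j u)
  have "act u r' j > 0"
  proof (rule ccontr)
    assume "\<not> act u r' j > 0"
    then obtain x where x: "u \<approx> j # x"
      using exchange_aux[of J r' u j] assms Cons by auto
    then have "legal r (j # x)" using legal_cong Cons by auto
    moreover have "act u r = s j (act x r)" using act_cong[OF x] by simp
    ultimately show False using Cons.prems by (simp add: s_self)
  qed
  then show ?case using Cons by auto
qed simp

lemma act_rev [simp]: "u \<in> lists I \<Longrightarrow> act u (act (rev u) v) = v"
  by (induction u arbitrary: v) auto

lemma act_rev' [simp]: "u \<in> lists I \<Longrightarrow> act (rev u) (act u v) = v"
  using act_rev[of "rev u"] by simp

lemma act_uminus: "act u (\<lambda>k. - v k) = (\<lambda>k. - act u v k)"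
  by (induction u) (auto simp: s_def)

text \<open>The longest element of the parabolic subgroup of \<open>J\<close>, described by the play
  of a reduced word; \<open>longest_eq\<close> identifies it with \<open>longest\<close>.\<close>

definition long :: "'i set \<Rightarrow> 'i list \<Rightarrow> bool" where
  "long J t \<longleftrightarrow> t \<in> lists J \<and> legal \<rho> t \<and> (\<forall>j\<in>J. act t \<rho> j < 0)"

lemma longD: "long J t \<Longrightarrow> t \<in> lists J" "long J t \<Longrightarrow> legal \<rho> t" "long J t \<Longrightarrow> t \<in> lists I"
  using legal_in_lists by (auto simp: long_def)

text \<open>Every reduced word in \<open>J\<close>, reversed, is a left factor of the longest
  element. Length bounds, uniqueness and invariance under reversal all follow from this.\<close>

lemma long_factor:
  assumes J: "J \<subseteq> I" and t: "long J t"
  shows "legal \<rho> u \<Longrightarrow> u \<in> lists J \<Longrightarrow> \<exists>x \<in> lists J. legal \<rho> x \<and> t \<approx> rev u @ x"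
proof (induction u)
  case Nil
  then show ?case using t by (auto intro!: bexI[of _ t] braid_refl simp: long_def dest: legal_in_lists)
next
  case (Cons j u)
  then obtain x where x: "x \<in> lists J" "legal \<rho> x" "t \<approx> rev u @ x" by auto
  have u: "u \<in> lists I" "legal \<rho> (j # u)" "j # u \<in> lists J" using Cons legal_in_lists by auto
  \<comment> \<open>\<open>?v\<close> is positive on \<open>J\<close>, so \<open>j # u\<close> is
    legal from it too. After a change of sign this says that \<open>j\<close> has a negative
    coordinate in \<open>act x \<rho>\<close>, where exchange applies.\<close>
  let ?v = "\<lambda>k. - act t \<rho> k"
  have "legal ?v (j # u)"
    by (rule legal_dominant_mono[OF J _ _ u(3,2)]) (use t J in \<open>auto simp: long_def rho_pos\<close>)
  then have "act u (act t \<rho>) j < 0" by (simp add: act_uminus)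
  then have neg: "j \<in> J" "act x \<rho> j \<le> 0" using act_cong[OF x(3), of \<rho>] u by simp_all
  obtain y where y: "y \<in> lists J" "legal \<rho> y" "x \<approx> j # y"
    by (rule exchange[OF J rho_pos[OF J] x(2,1) neg])
  then have "t \<approx> rev u @ j # y"
    using x(3) braid_append[OF braid_refl y(3), of "rev u"] u braid_trans by auto
  then show ?case using y by auto
qed

lemma long_length: "J \<subseteq> I \<Longrightarrow> long J t \<Longrightarrow> legal \<rho> u \<Longrightarrow> u \<in> lists J \<Longrightarrow> length u \<le> length t"
  using long_factor[of J t u] length_cong by fastforce

lemma long_rev: "J \<subseteq> I \<Longrightarrow> long J t \<Longrightarrow> t \<approx> rev t"
  using long_factor[of J t t] length_cong[of t] by (fastforce simp: long_def)

lemma long_unique_max: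
  assumes "J \<subseteq> I" "long J t" "legal \<rho> u" "u \<in> lists J" "length u = length t"
  shows "u \<approx> t"
proof -
  obtain x where "t \<approx> rev u @ x" using long_factor[OF assms(1-4)] by blast
  then have "t \<approx> rev u" using length_cong[of t "rev u @ x"] assms by auto
  then have "rev t \<approx> u" using rev_cong by fastforce
  then show ?thesis using long_rev[OF assms(1,2)] braid_sym braid_trans by blast
qed

lemma long_unique: "J \<subseteq> I \<Longrightarrow> long J t \<Longrightarrow> long J u \<Longrightarrow> u \<approx> t"
  using long_unique_max long_length[of J t u] long_length[of J u t] by (simp add: long_def)

lemma long_front:
  assumes "J \<subseteq> I" "long J t" "j \<in> J" obtains x where "x \<in> lists J" "t \<approx> j # x"
  using long_factor[of J t "[j]"] assms rho_pos[of J j] by auto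

lemma long_back:
  assumes "J \<subseteq> I" "long J t" "j \<in> J" obtains x where "x \<in> lists J" "t \<approx> x @ [j]"
proof -
  obtain x where x: "x \<in> lists J" "t \<approx> j # x" using long_front[OF assms] by blast
  have "rev t \<approx> rev x @ [j]" using rev_cong[OF x(2)] by simp
  then have "t \<approx> rev x @ [j]" using long_rev[OF assms(1,2)] braid_trans by blast
  then show thesis using that[of "rev x"] x(1) by simp
qed

lemma long_split:
  assumes "J \<subseteq> K" "K \<subseteq> I" "long J t" "long K u"
  obtains x where "x \<in> lists K" "u \<approx> t @ x"
proof -
  have "t \<in> lists K" using lists_mono'[OF assms(1)] longD(1)[OF assms(3)] by blast
  then obtain x where x: "x \<in> lists K" "u \<approx> rev t @ x"
    using long_factor[OF assms(2,4) longD(2)[OF assms(3)]] by auto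
  have "rev t @ x \<approx> t @ x"
    using x(1) assms long_rev[of J t] braid_sym lists_mono'[OF assms(2)]
    by (intro braid_append braid_refl) auto
  then show thesis using that x braid_trans by blast
qed

text \<open>Lengths of reduced words are bounded by that of the top word, and a reduced word of
  maximal length in \<open>J\<close> leaves no positive coordinate on \<open>J\<close>.\<close>

lemma ex_long:
  assumes top: "long I \<Delta>" and J: "J \<subseteq> I" shows "\<exists>t. long J t"
proof -
  have "length u \<le> length \<Delta>" if "u \<in> lists J \<and> legal \<rho> u" for u
    using long_length[OF _ top, of u] legal_in_lists[of \<rho> u] that by blast
  then obtain t where t: "t \<in> lists J" "legal \<rho> t"
    and mx: "\<And>u. u \<in> lists J \<Longrightarrow> legal \<rho> u \<Longrightarrow> length u \<le> length t"
    using ex_has_greatest_nat[of "\<lambda>t. t \<in> lists J \<and> legal \<rho> t" "[]" length "Suc (length \<Delta>)"]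
    by (auto simp: less_Suc_eq_le)
  have "act t \<rho> j < 0" if "j \<in> J" for j
    using exchange_aux[of J \<rho> t j] rho_pos[OF J] J t mx[of "j # t"] that by auto
  then show ?thesis using t by (auto simp: long_def)
qed

subsection \<open>Reduced words\<close>

lemmas cox_sym = pres_cong.sym[of _ _ I "cox_rels M", folded cox_cong_def]
lemmas cox_trans = pres_cong.trans[of _ _ I "cox_rels M", folded cox_cong_def]
lemmas cox_refl = pres_cong.refl[of _ I "cox_rels M", folded cox_cong_def]
lemmas cox_induct = pres_cong.induct[of _ _ I "cox_rels M", folded cox_cong_def,
    consumes 1, case_names refl step sym trans]

lemma alternating_even [simp]:
  "alternating i j (2 * 2) = [i, j, i, j]" "alternating i j (2 * 3) = [i, j, i, j, i, j]"
  "alternating i j (2 * 4) = [i, j, i, j, i, j, i, j]" "alternating i j (2 * Suc 0) = [i, j]"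
  "alternating i j 6 = [i, j, i, j, i, j]" "alternating i j 8 = [i, j, i, j, i, j, i, j]"
  by (simp_all add: numeral_eq_Suc)

lemma cox_rel_act: "(x, x') \<in> cox_rels M \<Longrightarrow> act x v = act x' v"
proof -
  assume "(x, x') \<in> cox_rels M"
  then obtain i j where ij: "i \<in> I" "j \<in> I" and x: "x = alternating i j (2 * entry M i j)" "x' = []"
    by auto
  show ?thesis
  proof (cases "i = j")
    case True
    then show ?thesis using ij by (simp add: x entry_diag)
  next
    case False
    have "act x v k = v k" for k
      using bond[OF ij False] ij unfolding x
      by (elim disjE; simp add: s_def cartan_diag algebra_simps)
    then show ?thesis using x by auto
  qed
qed

lemma cox_act: "(t, u) \<in> cox_cong M \<Longrightarrow> act t v = act u v"
proof (induction rule: cox_induct)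
  case (step r r' u v)
  then show ?case by (simp only: act_simps cox_rel_act[OF step(1)])
qed auto

lemma cox_square: "i \<in> I \<Longrightarrow> u \<in> lists I \<Longrightarrow> v \<in> lists I \<Longrightarrow> (u @ i # i # v, u @ v) \<in> cox_cong M"
proof -
  assume i: "i \<in> I" and uv: "u \<in> lists I" "v \<in> lists I"
  have "(alternating i i (2 * entry M i i), []) \<in> cox_rels M" using i by blast
  then have "([i, i], []) \<in> cox_rels M" unfolding entry_diag[OF i] by simp
  then show ?thesis using cox.cong_append_context[OF cox.rel_cong uv, of "[i, i]" "[]"] by simp
qed

lemma cox_rev: "u \<in> lists I \<Longrightarrow> (u @ rev u, []) \<in> cox_cong M"
proof (induction u)
  case Nil
  then show ?case by (simp add: cox_refl)
next
  case (Cons i u)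
  have "([i] @ (u @ rev u) @ [i], [i] @ [] @ [i]) \<in> cox_cong M"
    using Cons by (intro cox.cong_append_context) auto
  moreover have "([i, i], []) \<in> cox_cong M" using cox_square[of i "[]" "[]"] Cons by simp
  ultimately show ?case using cox_trans by simp
qed

lemma artin_rel_cox: "(x, x') \<in> artin_rels M \<Longrightarrow> (x, x') \<in> cox_cong M"
proof -
  assume "(x, x') \<in> artin_rels M"
  then obtain i j where ij: "i \<in> I" "j \<in> I" "i \<noteq> j"
    and x: "x = alternating i j (entry M i j)" "x' = alternating j i (entry M i j)" by auto
  have l: "x \<in> lists I" "x' \<in> lists I" 
    using ij set_alternating[of i j "entry M i j"] set_alternating[of j i "entry M i j"]
    unfolding x in_lists_conv_set by blast+
  have "alternating i j (2 * entry M i j) = x @ rev x'"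
    using bond[OF ij] unfolding x by (elim disjE; simp)
  moreover have "(alternating i j (2 * entry M i j), []) \<in> cox_cong M"
    using ij by (intro cox.rel_cong) blast
  ultimately have "(x @ rev x', []) \<in> cox_cong M" by simp
  then have "(x @ rev x' @ x', x') \<in> cox_cong M"
    using cox.cong_append_context[of "x @ rev x'" "[]" M "[]" x'] l by simp
  moreover have "(x @ rev x' @ x', x) \<in> cox_cong M"
    using cox.cong_append_context[OF cox_rev[of "rev x'"], of x "[]"] l by simp
  ultimately show ?thesis using cox_sym cox_trans by blast
qed

lemma artin_cox: "t \<approx> u \<Longrightarrow> (t, u) \<in> cox_cong M"
proof (induction rule: braid_induct)
  case (step r r' u v)
  then show ?case using artin_rel_cox by (intro cox.cong_append_context) auto
qed (blast intro: cox_refl cox_sym cox_trans)+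

text \<open>A letter whose coordinate is not positive meets a copy of itself after exchange, and the
  two cancel. The final clause makes minimal words legal, so that reduced and legal mean the
  same.\<close>

lemma cox_reduce_lists:
  assumes J: "J \<subseteq> I"
  shows "t \<in> lists J \<Longrightarrow> \<exists>u. u \<in> lists J \<and> legal \<rho> u \<and> (u, t) \<in> cox_cong M \<and> length u \<le> length t \<and>
    (length u = length t \<longrightarrow> legal \<rho> t)"
proof (induction t)
  case Nil
  then show ?case by (intro exI[of _ "[]"]) (auto intro: cox_refl)
next
  case (Cons i t)
  then obtain u where u: "u \<in> lists J" "legal \<rho> u" "(u, t) \<in> cox_cong M" "length u \<le> length t"
    "length u = length t \<longrightarrow> legal \<rho> t" by auto
  have i: "i \<in> I" "i \<in> J" using Cons J by auto
  have iu: "(i # u, i # t) \<in> cox_cong M"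
    using cox.cong_append_context[OF u(3), of "[i]" "[]"] i by simp
  show ?case
  proof (cases "act u \<rho> i > 0")
    case True
    then have "legal \<rho> (i # u)" using u i by simp
    moreover have "legal \<rho> (i # t)" if "length u = length t"
      using that u True i cox_act[OF u(3)] by simp
    ultimately show ?thesis using iu u i by (intro exI[of _ "i # u"]) auto
  next
    case False
    then have neg: "act u \<rho> i \<le> 0" by simp
    obtain x where x: "x \<in> lists J" "legal \<rho> x" "u \<approx> i # x"
      by (rule exchange[OF J rho_pos[OF J] u(2,1) i(2) neg])
    have xI: "x \<in> lists I" using x(2) by (rule legal_in_lists)
    have "(x, i # i # x) \<in> cox_cong M" using cox_square[OF i(1) _ xI, of "[]"] cox_sym by simp
    moreover have "(i # i # x, i # u) \<in> cox_cong M"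
      using cox.cong_append_context[OF artin_cox[OF braid_sym[OF x(3)]], of "[i]" "[]"] i by simp
    ultimately have "(x, i # t) \<in> cox_cong M" using iu cox_trans by blast
    moreover have "length x < length t" using length_cong[OF x(3)] u by simp
    ultimately show ?thesis using x by (intro exI[of _ x]) auto
  qed
qed

lemmas cox_reduce = cox_reduce_lists[OF subset_refl]

text \<open>The stabiliser of \<rho> is trivial: after reduction to legal words this is
  \<open>matsumoto\<close>.\<close>

lemma cox_iff_act: "t \<in> lists I \<Longrightarrow> u \<in> lists I \<Longrightarrow> (t, u) \<in> cox_cong M \<longleftrightarrow> act t \<rho> = act u \<rho>"
proof
  assume l: "t \<in> lists I" "u \<in> lists I" and e: "act t \<rho> = act u \<rho>"
  obtain t' u' where "legal \<rho> t'" "(t', t) \<in> cox_cong M" "legal \<rho> u'" "(u', u) \<in> cox_cong M"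
    using cox_reduce l by meson
  moreover from this have "t' \<approx> u'" using matsumoto cox_act e by metis
  ultimately show "(t, u) \<in> cox_cong M" using artin_cox cox_sym cox_trans by meson
qed (simp add: cox_act)

lemma cox_legal_length:
  assumes "legal \<rho> t" "(t, u) \<in> cox_cong M"
  shows "length t \<le> length u" "length t = length u \<Longrightarrow> legal \<rho> u"
proof -
  have u: "u \<in> lists I" using cox.cong_in_lists[OF assms(2)] by blast
  obtain u' where u': "legal \<rho> u'" "(u', u) \<in> cox_cong M" "length u' \<le> length u"
    "length u' = length u \<longrightarrow> legal \<rho> u" using cox_reduce[OF u] by auto
  have "t \<approx> u'" using matsumoto assms(1) u'(1) cox_act[OF assms(2)] cox_act[OF u'(2)] by simp
  then show "length t \<le> length u" "length t = length u \<Longrightarrow> legal \<rho> u" using length_cong u' by auto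
qed

lemma cox_length_eq: "legal \<rho> t \<Longrightarrow> cox_length M (cox_elem M t) = length t"
  unfolding cox_length_def cox_elem_def
  by (intro Least_equality) (auto intro!: bexI[of _ t] cox_refl legal_in_lists dest: cox_legal_length)

text \<open>The choice by \<open>SOME\<close> is harmless, since all reduced words of one element
  are equal in the Artin monoid.\<close>

lemma artin_lift_eq:
  assumes "legal \<rho> t" shows "artin_lift M (cox_elem M t) = artin_elem M t"
proof -
  have t: "t \<in> lists I" using assms by (rule legal_in_lists)
  have "reduced_expr M (cox_elem M t) t"
    using cox_length_eq[OF assms] cox_refl[OF t] by (auto simp: reduced_expr_def cox_elem_def)
  moreover have "u \<approx> t" if "reduced_expr M (cox_elem M t) u" for u
  proof -
    have u: "(t, u) \<in> cox_cong M" "length u = length t"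
      using that cox_length_eq[OF assms] by (auto simp: reduced_expr_def cox_elem_def)
    then have "legal \<rho> u" using cox_legal_length[OF assms u(1)] by simp
    then show ?thesis using matsumoto assms cox_act[OF u(1)] by metis
  qed
  ultimately have "(SOME u. reduced_expr M (cox_elem M t) u) \<approx> t" by (rule someI2)
  then show ?thesis unfolding artin_lift_def artin_elem_def
    by (rule equiv_class_eq[OF artin.cong_equiv])
qed

lemma cox_gen_inv: "j \<in> I \<Longrightarrow> inv\<^bsub>cox_group M\<^esub> (cox_elem M [j]) = cox_elem M [j]"
proof -
  assume j: "j \<in> I"
  interpret G: Group.monoid "cox_group M" by (rule cox.is_monoid)
  have "cox_elem M [j] \<otimes>\<^bsub>cox_group M\<^esub> cox_elem M [j] = \<one>\<^bsub>cox_group M\<^esub>"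
    using cox_square[of j "[]" "[]"] j
    by (auto simp: cox_elem_def cox.mult_cls cox.one_eq cox.cls_eq_iff)
  moreover have "cox_elem M [j] \<in> carrier (cox_group M)"
    using j unfolding cox_elem_def by (intro cox.cls_in_carrier) auto
  ultimately show ?thesis by (metis G.inv_unique')
qed

lemma parabolic_eq:
  assumes J: "J \<subseteq> I" shows "parabolic M J = cox_elem M ` lists J"
proof
  show "parabolic M J \<subseteq> cox_elem M ` lists J"
  proof
    fix w assume "w \<in> parabolic M J"
    then show "w \<in> cox_elem M ` lists J" unfolding parabolic_def
    proof (induction rule: generate.induct)
      case one
      then show ?case by (auto simp: cox.one_eq cox_elem_def intro!: image_eqI[of _ _ "[]"])
    next
      case (incl h)
      then show ?case by auto
    next
      case (inv h)
      then obtain j where "j \<in> J" "h = cox_elem M [j]" by auto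
      then have "inv\<^bsub>cox_group M\<^esub> h = cox_elem M [j]" "[j] \<in> lists J" using J cox_gen_inv by auto
      then show ?case by blast
    next
      case (eng h1 h2)
      then obtain a b where ab: "a \<in> lists J" "b \<in> lists J" "h1 = cox_elem M a" "h2 = cox_elem M b"
        by blast
      then have "a \<in> lists I" "b \<in> lists I" using lists_mono'[OF J] by auto
      then have "h1 \<otimes>\<^bsub>cox_group M\<^esub> h2 = cox_elem M (a @ b)"
        using ab cox.mult_cls[of a M b] by (simp add: cox_elem_def)
      moreover have "a @ b \<in> lists J" using ab by simp
      ultimately show ?case by blast
    qed
  qed
next
  have "cox_elem M u \<in> parabolic M J" if "u \<in> lists J" for u
    using that
  proof (induction u)
    case Nil
    then show ?case using generate.one[of "cox_group M"] by (simp add: parabolic_def cox.one_eq cox_elem_def)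
  next
    case (Cons j u)
    then have l: "[j] \<in> lists I" "u \<in> lists I" using J lists_mono'[OF J] by auto
    have "cox_elem M [j] \<otimes>\<^bsub>cox_group M\<^esub> cox_elem M u \<in> parabolic M J"
      using Cons unfolding parabolic_def by (auto intro: generate.eng generate.incl)
    then show ?case using cox.mult_cls[OF l] by (simp add: cox_elem_def)
  qed
  then show "cox_elem M ` lists J \<subseteq> parabolic M J" by blast
qed

lemma longest_eq:
  assumes J: "J \<subseteq> I" and t: "long J t" shows "longest M J = cox_elem M t"
proof -
  have red: "\<exists>u. u \<in> lists J \<and> legal \<rho> u \<and> v = cox_elem M u" if "v \<in> parabolic M J" for v
  proof -
    obtain x where x: "x \<in> lists J" "v = cox_elem M x" using \<open>v \<in> parabolic M J\<close> parabolic_eq[OF J] by auto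
    obtain u where u: "u \<in> lists J" "legal \<rho> u" "(u, x) \<in> cox_cong M" using cox_reduce_lists[OF J x(1)] by blast
    then show ?thesis using x(2) equiv_class_eq[OF cox.cong_equiv u(3)] unfolding cox_elem_def by auto
  qed
  show ?thesis unfolding longest_def
  proof (rule the_equality)
    show "cox_elem M t \<in> parabolic M J \<and>
      (\<forall>v\<in>parabolic M J. cox_length M v \<le> cox_length M (cox_elem M t))"
    proof (intro conjI ballI)
      show "cox_elem M t \<in> parabolic M J" using longD(1)[OF t] parabolic_eq[OF J] by blast
      fix v assume "v \<in> parabolic M J"
      then obtain u where "u \<in> lists J" "legal \<rho> u" "v = cox_elem M u" using red by blast
      then show "cox_length M v \<le> cox_length M (cox_elem M t)"
        using long_length[OF J t] cox_length_eq longD(2)[OF t] by simp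
    qed
  next
    fix w assume w: "w \<in> parabolic M J \<and> (\<forall>v\<in>parabolic M J. cox_length M v \<le> cox_length M w)"
    then obtain u where u: "u \<in> lists J" "legal \<rho> u" "w = cox_elem M u" using red by blast
    have "cox_elem M t \<in> parabolic M J" using longD(1)[OF t] parabolic_eq[OF J] by blast
    then have "length t \<le> length u" using w u cox_length_eq[OF u(2)] cox_length_eq[OF longD(2)[OF t]] by auto
    then have "u \<approx> t" using long_unique_max[OF J t u(2,1)] long_length[OF J t u(2,1)] by simp
    then show "w = cox_elem M t"
      unfolding u(3) cox_elem_def by (intro equiv_class_eq[OF cox.cong_equiv] artin_cox)
  qed
qed

lemma artin_lift_longest: "J \<subseteq> I \<Longrightarrow> long J t \<Longrightarrow> artin_lift M (longest M J) = artin_elem M t"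
  by (simp add: longest_eq artin_lift_eq long_def)

text \<open>\<open>t @ u\<close> need not be reduced, so it is compared with the reduced word
  \<open>w\<close> only through the action on \<rho>.\<close>

lemma artin_lift_longest_rel:
  assumes "J \<subseteq> I" "K \<subseteq> I" "long J t" "long K u" "legal \<rho> w" "act (t @ u) \<rho> = act w \<rho>"
  shows "artin_lift M (longest_rel M J K) = artin_elem M w"
proof -
  have l: "t \<in> lists I" "u \<in> lists I" "w \<in> lists I" using assms longD(3) legal_in_lists by auto
  then have "longest_rel M J K = cox_elem M (t @ u)"
    by (simp add: longest_rel_def longest_eq[OF assms(1,3)] longest_eq[OF assms(2,4)] cox_elem_def cox.mult_cls)
  also have "\<dots> = cox_elem M w"
    unfolding cox_elem_def by (rule equiv_class_eq[OF cox.cong_equiv]) (use cox_iff_act l assms(6) in auto)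
  finally show ?thesis using artin_lift_eq[OF assms(5)] by simp
qed

end

subsection \<open>The action of the 0-Hecke monoid\<close>

context numbers_game
begin

text \<open>The generators of the 0-Hecke monoid are idempotent; accordingly \<open>D i\<close>
  moves a weight only towards the antidominant side.\<close>

definition D :: "'i \<Rightarrow> ('i \<Rightarrow> int) \<Rightarrow> 'i \<Rightarrow> int" where
  "D i v = (if v i > 0 then s i v else v)"

definition Dact :: "'i list \<Rightarrow> ('i \<Rightarrow> int) \<Rightarrow> 'i \<Rightarrow> int" where
  "Dact t v = foldr D t v"

lemma Dact_simps [simp]: "Dact [] v = v" "Dact (i # t) v = D i (Dact t v)"
  "Dact (t @ u) v = Dact t (Dact u v)"
  by (simp_all add: Dact_def)

lemma D_nonpos: "i \<in> I \<Longrightarrow> D i v i \<le> 0"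
  by (simp add: D_def s_self)

lemma D_idem [simp]: "i \<in> I \<Longrightarrow> D i (D i v) = D i v"
  by (simp add: D_def s_self)

lemma D_braid:
  assumes "i \<in> I" "j \<in> I" "i \<noteq> j"
  shows "Dact (alternating i j (entry M i j)) v = Dact (alternating j i (entry M i j)) v"
proof -
  \<comment> \<open>All weights that occur differ from \<open>v\<close> by multiples of the two
    simple roots. In the coordinates \<open>p\<close>, \<open>q\<close> the operators are piecewise
    linear, and the braid relation becomes linear arithmetic.\<close>
  define V where "V p q = (\<lambda>k. v k - c k i * p - c k j * q)" for p q
  have v: "v = V 0 0" by (simp add: V_def)
  have Di: "D i (V p q) = (if v i - 2 * p - c i j * q > 0 then V (v i - p - c i j * q) q else V p q)" for p q
    using assms by (auto simp: V_def D_def s_def cartan_diag algebra_simps)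
  have Dj: "D j (V p q) = (if v j - c j i * p - 2 * q > 0 then V p (v j - c j i * p - q) else V p q)" for p q
    using assms by (auto simp: V_def D_def s_def cartan_diag algebra_simps)
  have eq: "V p q = V p' q'" if "p = p'" "q = q'" for p q p' q' using that by simp
  show ?thesis
    using bond[OF assms]
    by (elim disjE conjE; subst (1 2) v; simp add: Di Dj; intro conjI impI eq; linarith)
qed

lemma D_rel: "(x, x') \<in> artin_rels M \<Longrightarrow> Dact x v = Dact x' v"
  using D_braid by blast

lemma Dact_cong: "t \<approx> u \<Longrightarrow> Dact t v = Dact u v"
proof (induction rule: braid_induct)
  case (step r r' u v)
  then show ?case by (simp only: Dact_simps D_rel[OF step(1)])
qed auto

text \<open>The images of a set of weights under all subwords of a word: this also gives an action of the
  0-Hecke monoid, and it is monotone in the word.\<close>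

definition F :: "'i \<Rightarrow> ('i \<Rightarrow> int) set \<Rightarrow> ('i \<Rightarrow> int) set" where
  "F i S = S \<union> s i ` S"

definition Fs :: "'i list \<Rightarrow> ('i \<Rightarrow> int) set \<Rightarrow> ('i \<Rightarrow> int) set" where
  "Fs t S = foldr F t S"

lemma Fs_simps [simp]: "Fs [] S = S" "Fs (i # t) S = F i (Fs t S)" "Fs (t @ u) S = Fs t (Fs u S)"
  by (simp_all add: Fs_def)

lemma Fs_mono: "S \<subseteq> S' \<Longrightarrow> Fs t S \<subseteq> Fs t S'"
  by (induction t) (auto simp: F_def)

lemma Fs_increasing: "S \<subseteq> Fs t S"
  by (induction t) (auto simp: F_def)

lemma F_idem [simp]: "i \<in> I \<Longrightarrow> F i (F i S) = F i S"
  by (auto simp: F_def image_Un image_image)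

text \<open>Both sides consist of the images of \<open>S\<close> under the whole dihedral group,
  since each of its elements is a subword of either alternating word.\<close>

lemma F_braid:
  assumes "i \<in> I" "j \<in> I" "i \<noteq> j"
  shows "Fs (alternating i j (entry M i j)) S = Fs (alternating j i (entry M i j)) S"
proof -
  note b = s_braid[OF assms]
  consider "entry M i j = 2" | "entry M i j = 3" | "entry M i j = 4" using bond[OF assms] by auto
  then show ?thesis
  proof cases
    case 1
    then have "s i (s j v) = s j (s i v)" for v using b[of v] by simp
    then show ?thesis unfolding 1 by (simp add: F_def image_Un image_image) blast
  next
    case 2
    then have "s i (s j (s i v)) = s j (s i (s j v))" for v using b[of v] by simp
    then show ?thesis using assms unfolding 2 by (simp add: F_def image_Un image_image) blast
  next
    case 3
    then have "s i (s j (s i (s j v))) = s j (s i (s j (s i v)))" for v using b[of v] by simp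
    then show ?thesis using assms unfolding 3 by (simp add: F_def image_Un image_image) blast
  qed
qed

lemma F_rel: "(x, x') \<in> artin_rels M \<Longrightarrow> Fs x S = Fs x' S"
  using F_braid by blast

lemma Fs_cong: "t \<approx> u \<Longrightarrow> Fs t S = Fs u S"
proof (induction rule: braid_induct)
  case (step r r' u v)
  then show ?case by (simp only: Fs_simps F_rel[OF step(1)])
qed auto

lemma Dact_in_Fs: "v \<in> S \<Longrightarrow> Dact t v \<in> Fs t S"
  by (induction t) (auto simp: F_def D_def)

text \<open>The clause on subwords of full length feeds the length comparison in
  \<open>full_iff\<close>.\<close>

lemma Fs_subword:
  "x \<in> Fs t S \<Longrightarrow> \<exists>p v. set p \<subseteq> set t \<and> length p \<le> length t \<and> (length p = length t \<longrightarrow> p = t) \<and>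
    v \<in> S \<and> x = act p v"
proof (induction t arbitrary: x)
  case Nil
  then show ?case by auto
next
  case (Cons i t)
  then consider "x \<in> Fs t S" | y where "y \<in> Fs t S" "x = s i y" by (auto simp: F_def)
  then show ?case
  proof cases
    case 1
    from Cons.IH[OF this] obtain p v where p: "set p \<subseteq> set t" "length p \<le> length t" "v \<in> S" "x = act p v"
      by blast
    then show ?thesis by (intro exI[of _ p] exI[of _ v]) auto
  next
    case (2 y)
    from Cons.IH[OF this(1)] obtain p v where p: "set p \<subseteq> set t" "length p \<le> length t"
      "length p = length t \<longrightarrow> p = t" "v \<in> S" "y = act p v" by blast
    then show ?thesis using 2(2) by (intro exI[of _ "i # p"] exI[of _ v]) auto
  qed
qed

text \<open>As in \<open>cox_reduce_lists\<close>, except that a repeated letter is absorbed instead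
  of cancelled, for both actions at once.\<close>

lemma hecke_reduce:
  "z \<in> lists I \<Longrightarrow> \<exists>u. legal \<rho> u \<and> length u \<le> length z \<and>
    (\<forall>v. Dact z v = Dact u v) \<and> (\<forall>S. Fs z S = Fs u S)"
proof (induction z)
  case Nil
  then show ?case by (intro exI[of _ "[]"]) auto
next
  case (Cons i z)
  then obtain u where u: "legal \<rho> u" "length u \<le> length z" "\<And>v. Dact z v = Dact u v"
    "\<And>S. Fs z S = Fs u S" by auto
  have i: "i \<in> I" using Cons by auto
  show ?case
  proof (cases "act u \<rho> i > 0")
    case True
    then show ?thesis using u i by (intro exI[of _ "i # u"]) auto
  next
    case False
    then have neg: "act u \<rho> i \<le> 0" by simp
    obtain x where x: "u \<approx> i # x"
      by (rule exchange[OF subset_refl rho_pos[OF subset_refl] u(1) legal_in_lists[OF u(1)] i neg])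
    have "D i (Dact z v) = Dact u v" for v using Dact_cong[OF x, of v] u i by simp
    moreover have "F i (Fs z S) = Fs u S" for S using Fs_cong[OF x, of S] u i by simp
    ultimately show ?thesis using u by (intro exI[of _ u]) auto
  qed
qed

lemma Dact_legal: "legal r u \<Longrightarrow> Dact u r = act u r"
  by (induction u) (auto simp: D_def)

lemma Dact_long_nonpos: "J \<subseteq> I \<Longrightarrow> long J t \<Longrightarrow> j \<in> J \<Longrightarrow> Dact t v j \<le> 0"
proof -
  assume a: "J \<subseteq> I" "long J t" "j \<in> J"
  then obtain x where "t \<approx> j # x" using long_front by blast
  then show ?thesis using Dact_cong[of t "j # x" v] D_nonpos a by auto
qed

lemma Dact_fix: "\<forall>j\<in>J. v j \<le> 0 \<Longrightarrow> t \<in> lists J \<Longrightarrow> Dact t v = v"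
  by (induction t) (auto simp: D_def not_less)

text \<open>The longest element absorbs every generator of \<open>J\<close> on its right, so its
  effect can be computed along any play in \<open>J\<close> that ends antidominant on
  \<open>J\<close>. The greedy play of \<open>antidom\<close> is therefore sound.\<close>

lemma Dact_long:
  assumes J: "J \<subseteq> I" and t: "long J t" and p: "p \<in> lists J"
    and np: "\<And>j. j \<in> J \<Longrightarrow> Dact p v j \<le> 0"
  shows "Dact t v = Dact p v"
proof -
  have "Dact t (D j w) = Dact t w" if j: "j \<in> J" for j w
  proof -
    obtain x where x: "t \<approx> x @ [j]" using long_back[OF J t j] by blast
    show ?thesis using Dact_cong[OF x] j J by auto
  qed
  then have "q \<in> lists J \<Longrightarrow> Dact t (Dact q v) = Dact t v" for q by (induction q) auto
  then have "Dact t v = Dact t (Dact p v)" using p by simp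
  also have "\<dots> = Dact p v" by (rule Dact_fix[OF _ longD(1)[OF t]]) (use np in blast)
  finally show ?thesis .
qed

text \<open>The image of \<open>z\<close> in the 0-Hecke monoid is the longest element; the weight
  \<rho> suffices to detect this.\<close>

definition full :: "'i list \<Rightarrow> bool" where
  "full z \<longleftrightarrow> (\<forall>i \<in> I. Dact z \<rho> i \<le> 0)"

lemma legal_nonpos_long: "legal \<rho> u \<Longrightarrow> (\<And>i. i \<in> I \<Longrightarrow> act u \<rho> i \<le> 0) \<Longrightarrow> long I u"
  using exchange_aux[OF subset_refl rho_pos[OF subset_refl], where t = u] legal_in_lists[of \<rho> u]
  unfolding long_def by fastforce

lemma full_long:
  assumes "z \<in> lists I" "full z"
  obtains u where "long I u" "\<And>v. Dact z v = Dact u v" "\<And>S. Fs z S = Fs u S"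
proof -
  obtain u where u: "legal \<rho> u" "\<And>v. Dact z v = Dact u v" "\<And>S. Fs z S = Fs u S"
    using hecke_reduce[OF assms(1)] by auto
  then have "long I u" using assms(2) Dact_legal[OF u(1)] by (intro legal_nonpos_long) (auto simp: full_def)
  then show thesis using that u by blast
qed

lemma full_nonpos: "z \<in> lists I \<Longrightarrow> full z \<Longrightarrow> i \<in> I \<Longrightarrow> Dact z v i \<le> 0"
  by (metis full_long Dact_long_nonpos subset_refl)

lemma full_length: "long I \<Delta> \<Longrightarrow> z \<in> lists I \<Longrightarrow> full z \<Longrightarrow> length \<Delta> \<le> length z"
proof -
  assume D: "long I \<Delta>" and z: "z \<in> lists I" "full z"
  obtain u where u: "legal \<rho> u" "length u \<le> length z" "\<And>v. Dact z v = Dact u v"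
    using hecke_reduce[OF z(1)] by auto
  then have "long I u" using z(2) Dact_legal[OF u(1)] by (intro legal_nonpos_long) (auto simp: full_def)
  then show ?thesis using length_cong[OF long_unique[OF subset_refl D]] u(2) by simp
qed

text \<open>This trades \<open>Dact\<close> for the monotone \<open>Fs\<close>. If a subword
  \<open>p\<close> of the reduced word \<open>u\<close> reaches the lowest weight, it is at least as
  long as \<Delta>, hence as long as \<open>u\<close>, and so equals \<open>u\<close>.\<close>

lemma full_iff:
  assumes D: "long I \<Delta>" and z: "z \<in> lists I"
  shows "full z \<longleftrightarrow> act \<Delta> \<rho> \<in> Fs z {\<rho>}"
proof
  assume "full z"
  with z obtain u where u: "long I u" "\<And>v. Dact z v = Dact u v" by (metis full_long)
  then have "Dact z \<rho> = act \<Delta> \<rho>"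
    using Dact_legal[of \<rho> u] act_cong[OF long_unique[OF subset_refl D u(1)]] by (simp add: longD)
  then show "act \<Delta> \<rho> \<in> Fs z {\<rho>}" using Dact_in_Fs[of \<rho> "{\<rho>}" z] by simp
next
  assume w: "act \<Delta> \<rho> \<in> Fs z {\<rho>}"
  obtain u where u: "legal \<rho> u" "\<And>v. Dact z v = Dact u v" "\<And>S. Fs z S = Fs u S"
    using hecke_reduce[OF z] by auto
  then obtain p where p: "set p \<subseteq> set u" "length p \<le> length u" "length p = length u \<longrightarrow> p = u"
    "act \<Delta> \<rho> = act p \<rho>" using Fs_subword[of "act \<Delta> \<rho>" u "{\<rho>}"] w by auto
  have ul: "u \<in> lists I" using u(1) by (rule legal_in_lists)
  then have pl: "p \<in> lists I" using p(1) by (auto simp: in_lists_conv_set)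
  have "(\<Delta>, p) \<in> cox_cong M" using cox_iff_act longD(3)[OF D] pl p(4) by simp
  then have "length \<Delta> \<le> length p" by (rule cox_legal_length[OF longD(2)[OF D]])
  moreover have "length u \<le> length \<Delta>" using long_length[OF subset_refl D u(1) ul] .
  ultimately have "p = u" using p by simp
  then have "Dact z \<rho> = act \<Delta> \<rho>" using u(2) Dact_legal[OF u(1)] p(4) by simp
  then show "full z" using D by (auto simp: full_def long_def intro: less_imp_le)
qed

lemma Fs_long_mono: "J \<subseteq> K \<Longrightarrow> K \<subseteq> I \<Longrightarrow> long J t \<Longrightarrow> long K u \<Longrightarrow> Fs t S \<subseteq> Fs u S"
  by (metis long_split Fs_cong Fs_simps(3) Fs_increasing Fs_mono)

lemma full_mono:
  assumes "long I \<Delta>" and "J \<subseteq> J'" "K \<subseteq> K'" "J' \<subseteq> I" "K' \<subseteq> I"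
    and "long J x" "long K y" "long J' x'" "long K' y'" and "full (x @ y @ x @ y)"
  shows "full (x' @ y' @ x' @ y')"
proof -
  note mx = Fs_long_mono[OF assms(2,4,6,8)] and my = Fs_long_mono[OF assms(3,5,7,9)]
  have "Fs x (Fs y S) \<subseteq> Fs x' (Fs y' S)" for S by (meson mx my Fs_mono subset_trans)
  then have "Fs (x @ y @ x @ y) S \<subseteq> Fs (x' @ y' @ x' @ y') S" for S
    by simp (meson Fs_mono subset_trans)
  moreover have "x @ y @ x @ y \<in> lists I" "x' @ y' @ x' @ y' \<in> lists I" using assms longD(3) by auto
  ultimately show ?thesis using full_iff[OF assms(1)] assms(10) by blast
qed

text \<open>A common right multiple of the longest elements of \<open>J\<close> and \<open>K\<close>
  can be written with any letter of \<open>J\<close> or of \<open>K\<close> in front, and the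
  operator of the first letter makes that coordinate nonpositive.\<close>

lemma full_common_multiple:
  assumes JK: "J \<union> K = I" and x: "long J x" and y: "long K y" and b: "x @ u \<approx> y @ w"
  shows "full (x @ u)"
  unfolding full_def
proof
  fix i assume "i \<in> I"
  then consider "i \<in> J" | "i \<in> K" using JK by blast
  then show "Dact (x @ u) \<rho> i \<le> 0"
  proof cases
    case 1
    then show ?thesis using Dact_long_nonpos[OF _ x] JK by auto
  next
    case 2
    then have "Dact (y @ w) \<rho> i \<le> 0" using Dact_long_nonpos[OF _ y] JK by auto
    then show ?thesis using Dact_cong[OF b] by simp
  qed
qed

lemma full_append:
  assumes D: "long I \<Delta>" and l: "x \<in> lists I" "y \<in> lists I" and f: "full x"
  shows "full (x @ y)"
proof -
  have "Fs x {\<rho>} \<subseteq> Fs x (Fs y {\<rho>})" by (intro Fs_mono Fs_increasing)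
  then show ?thesis using full_iff[OF D] l f by auto
qed

text \<open>Remove \<open>j\<close> from the front of \<open>t\<close> and append \<open>i\<close>:
  the hypothesis gives the same weight at the same length. The new word is therefore reduced, and an
  identity in the Coxeter group lifts to the Artin monoid.\<close>

lemma long_conj:
  assumes J: "J \<subseteq> I" and t: "long J t" and ij: "i \<in> J" "j \<in> J"
    and e: "act t (s i \<rho>) = s j (act t \<rho>)"
  shows "t @ [i] \<approx> j # t"
proof -
  obtain u where u: "u \<in> lists J" "t \<approx> j # u" using long_front[OF J t ij(2)] by blast
  have I: "i \<in> I" "j \<in> I" "u \<in> lists I" using ij J lists_mono'[OF J] u by auto
  have "act u (s i \<rho>) = act t \<rho>"
    using act_cong[OF u(2), of "s i \<rho>"] e I by (metis act_simps(2) s_s)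
  then have "act (u @ [i]) \<rho> = act t \<rho>" by simp
  then have "(t, u @ [i]) \<in> cox_cong M" using cox_iff_act longD(3)[OF t] I by simp
  then have "legal \<rho> (u @ [i])" using cox_legal_length(2)[OF longD(2)[OF t]] length_cong[OF u(2)] by simp
  then have t': "u @ [i] \<approx> t" using matsumoto longD(2)[OF t] \<open>act (u @ [i]) \<rho> = act t \<rho>\<close> by blast
  have "t @ [i] \<approx> j # u @ [i]" using braid_append[OF u(2) braid_refl, of "[i]"] I by simp
  also have "j # u @ [i] \<approx> j # t" by (rule braid_Cons[OF t' I(2)])
  finally show ?thesis .
qed

end

subsection \<open>Homomorphisms from dihedral Artin monoids\<close>

lemma map_alternating: "map f (alternating a b k) = alternating (f a) (f b) k"
  by (induction k arbitrary: a b) auto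

lemma concat_alternating_lists:
  "u \<in> lists A \<Longrightarrow> v \<in> lists A \<Longrightarrow> concat (alternating u v k) \<in> lists A"
  by (induction k arbitrary: u v) auto

lemma I2_index [simp]: "index (I2_mat m) = {1, 2}" "index (I2_mat m) = {Suc 0, 2}"
  by (simp_all add: I2_mat_def)

lemma I2_entry: "entry (I2_mat m) i j = (if i = j then 1 else m)"
  by (simp add: I2_mat_def)

lemma artin_elem_eq_iff:
  "u \<in> lists (index M) \<Longrightarrow> v \<in> lists (index M) \<Longrightarrow>
    artin_elem M u = artin_elem M v \<longleftrightarrow> (u, v) \<in> artin_cong M"
  by (simp add: artin_elem_def artin.cls_eq_iff)

lemma alt_prod_artin:
  "u \<in> lists (index M) \<Longrightarrow> v \<in> lists (index M) \<Longrightarrow>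
    alt_prod (artin_monoid M) (artin_elem M u) (artin_elem M v) k
      = artin_elem M (concat (alternating u v k))"
  by (simp add: artin_elem_def artin.alt_prod_cls)

lemma artin_hom_word:
  assumes h: "h \<in> monoid_homs (artin_monoid N) (artin_monoid M)"
    and f: "\<And>i. i \<in> index N \<Longrightarrow> f i \<in> lists (index M)"
      "\<And>i. i \<in> index N \<Longrightarrow> h (artin_gen N i) = artin_elem M (f i)"
  shows "w \<in> lists (index N) \<Longrightarrow> h (artin_elem N w) = artin_elem M (concat (map f w))"
proof (induction w)
  case Nil
  then show ?case
    using h by (simp add: monoid_homs_def artin_elem_def artin.one_eq)
next
  case (Cons i w)
  then have l: "[i] \<in> lists (index N)" "w \<in> lists (index N)" "f i \<in> lists (index M)"
    "concat (map f w) \<in> lists (index M)"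
    using f(1) by (auto simp: in_lists_conv_set)
  have "artin_elem N (i # w) = artin_gen N i \<otimes>\<^bsub>artin_monoid N\<^esub> artin_elem N w"
    using artin.mult_cls[OF l(1,2)] by (simp add: artin_elem_def)
  also have "h \<dots> = h (artin_gen N i) \<otimes>\<^bsub>artin_monoid M\<^esub> h (artin_elem N w)"
    using h artin.cls_in_carrier[OF l(1)] artin.cls_in_carrier[OF l(2)]
    by (simp only: monoid_homs_def artin_elem_def mem_Collect_eq hom_mult)
  also have "\<dots> = artin_elem M (f i @ concat (map f w))"
    using Cons f(2) artin.mult_cls[OF l(3,4)] by (simp add: artin_elem_def)
  finally show ?case by simp
qed

lemma artin_homs_eq:
  assumes "h \<in> monoid_homs (artin_monoid N) G" "h' \<in> monoid_homs (artin_monoid N) G"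
    and "\<And>i. i \<in> index N \<Longrightarrow> h (artin_gen N i) = h' (artin_gen N i)"
    and "X \<in> carrier (artin_monoid N)"
  shows "h X = h' X"
  using artin.hom_eq_on_carrier[OF assms(1,2) _ assms(4)] assms(3) by (simp add: artin_elem_def)

lemma artin_hom_exists:
  assumes f: "\<And>i. i \<in> index N \<Longrightarrow> f i \<in> lists (index M)"
    and r: "\<And>i j. i \<in> index N \<Longrightarrow> j \<in> index N \<Longrightarrow> i \<noteq> j \<Longrightarrow>
      (concat (alternating (f i) (f j) (entry N i j)), concat (alternating (f j) (f i) (entry N i j)))
        \<in> artin_cong M"
  obtains h where "h \<in> monoid_homs (artin_monoid N) (artin_monoid M)"
    "\<And>i. i \<in> index N \<Longrightarrow> h (artin_gen N i) = artin_elem M (f i)"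
proof -
  have img: "f ` index N \<subseteq> lists (index M)" using f by blast
  have rels: "(concat (map f a), concat (map f b)) \<in> pres_cong (index M) (artin_rels M)"
    if "(a, b) \<in> artin_rels N" for a b
    using that r by (auto simp: map_alternating simp flip: artin_cong_def)
  note ex = artin.extend_hom[OF artin_presentation img rels]
    and cl = artin.extend_cls[OF artin_presentation img rels]
  show thesis
  proof (rule that)
    show "artin.extend f (index M) (artin_rels M) \<in> monoid_homs (artin_monoid N) (artin_monoid M)"
      using ex by (simp add: artin_monoid_def)
    show "artin.extend f (index M) (artin_rels M) (artin_gen N i) = artin_elem M (f i)"
      if "i \<in> index N" for i
      using cl[of "[i]"] that by (simp add: artin_elem_def artin_cong_def)
  qed
qed

lemma dihedral_hom_exists:
  assumes "x \<in> lists (index M)" "y \<in> lists (index M)"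
    and "(concat (alternating x y m), concat (alternating y x m)) \<in> artin_cong M"
  obtains \<Phi> where "hom_given_by m M \<Phi> (artin_elem M x) (artin_elem M y)"
proof (rule artin_hom_exists[of "I2_mat m" "\<lambda>i. if i = 1 then x else y" M])
  fix \<Phi> assume \<Phi>: "\<Phi> \<in> dihedral_homs m M" "\<And>i. i \<in> index (I2_mat m) \<Longrightarrow>
    \<Phi> (artin_gen (I2_mat m) i) = artin_elem M (if i = 1 then x else y)"
  show thesis
    by (rule that[of \<Phi>]) (use \<Phi>(1) \<Phi>(2)[of 1] \<Phi>(2)[of 2] in \<open>simp add: hom_given_by_def\<close>)
next
  show "(if i = 1 then x else y) \<in> lists (index M)" for i :: nat using assms by simp
next
  fix i j :: nat assume "i \<in> index (I2_mat m)" "j \<in> index (I2_mat m)" "i \<noteq> j"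
  then show "(concat (alternating (if i = 1 then x else y) (if j = 1 then x else y) (entry (I2_mat m) i j)),
      concat (alternating (if j = 1 then x else y) (if i = 1 then x else y) (entry (I2_mat m) i j)))
        \<in> artin_cong M"
    using assms(3) pres_cong.sym[of _ _ "index M" "artin_rels M", folded artin_cong_def]
    by (auto simp: I2_entry)
qed

lemma dihedral_hom_word:
  assumes "hom_given_by m M \<Phi> (artin_elem M x) (artin_elem M y)"
    and "x \<in> lists (index M)" "y \<in> lists (index M)" and "w \<in> lists {1, 2}"
  shows "\<Phi> (artin_elem (I2_mat m) w) = artin_elem M (concat (map (\<lambda>i. if i = 1 then x else y) w))"
  by (rule artin_hom_word) (use assms in \<open>auto simp: hom_given_by_def\<close>)

lemma dihedral_hom_braid:
  assumes "hom_given_by m M \<Phi> (artin_elem M x) (artin_elem M y)"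
    and "x \<in> lists (index M)" "y \<in> lists (index M)"
  shows "(concat (alternating x y m), concat (alternating y x m)) \<in> artin_cong M"
proof -
  have l: "alternating 1 2 m \<in> lists {1, 2 :: nat}" "alternating 2 1 m \<in> lists {1, 2 :: nat}"
    using set_alternating[of 1 "2 :: nat" m] set_alternating[of 2 "1 :: nat" m]
    unfolding in_lists_conv_set by blast+
  have "(alternating 1 2 (entry (I2_mat m) 1 2), alternating 2 1 (entry (I2_mat m) 1 2))
      \<in> artin_rels (I2_mat m)"
    by (rule CollectI, intro exI[of _ 1] exI[of _ 2]) simp
  then have "artin_elem (I2_mat m) (alternating 1 2 m) = artin_elem (I2_mat m) (alternating 2 1 m)"
    using artin.rel_cong[of "alternating 1 2 m" "alternating 2 1 m" "I2_mat m"] l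
    by (simp add: artin_elem_eq_iff I2_entry)
  then have "artin_elem M (concat (alternating x y m)) = artin_elem M (concat (alternating y x m))"
    using dihedral_hom_word[OF assms l(1)] dihedral_hom_word[OF assms l(2)]
    by (simp add: map_alternating)
  then show ?thesis using assms by (simp add: artin_elem_eq_iff concat_alternating_lists)
qed

lemma swap_aut_exists: obtains \<sigma> where "swap_aut m \<sigma>"
proof -
  have "(concat (alternating [2] [1] m), concat (alternating [1] [2] m)) \<in> artin_cong (I2_mat m)"
  proof -
    have "(alternating 2 1 (entry (I2_mat m) 2 1), alternating 1 2 (entry (I2_mat m) 2 1))
        \<in> artin_rels (I2_mat m)"
      by (rule CollectI, intro exI[of _ 2] exI[of _ 1]) simp
    moreover have "concat (alternating [a] [b] k) = alternating a b k" for a b :: nat and k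
      by (induction k arbitrary: a b) auto
    ultimately show ?thesis using artin.rel_cong[of "alternating 2 1 m" "alternating 1 2 m" "I2_mat m"]
      by (simp add: I2_entry del: One_nat_def)
  qed
  then obtain \<sigma> where "hom_given_by m (I2_mat m) \<sigma> (artin_gen (I2_mat m) 2) (artin_gen (I2_mat m) 1)"
    using dihedral_hom_exists[of "[2]" "I2_mat m" "[1]" m] by auto
  then show thesis using that by (auto simp: hom_given_by_def swap_aut_def)
qed

lemma monoid_homs_comp:
  "g \<in> monoid_homs G H \<Longrightarrow> h \<in> monoid_homs H K \<Longrightarrow> h \<circ> g \<in> monoid_homs G K"
  by (auto simp: monoid_homs_def hom_def Pi_iff)

lemma I2_numbers_game: "numbers_game (I2_mat m) (\<lambda>i j. if i = j then 2 else if i = 1 \<and> m = 4 then -2 else -1)"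
  if "m \<in> {3, 4}"
  using that by unfold_locales (auto simp: I2_entry)

section \<open>Braid relations with commuting factors, and Coxeter type\<close>

context numbers_game
begin

lemma braid_interchange:
  assumes "a @ z' \<approx> z' @ a" "z \<in> lists I" "d \<in> lists I"
  shows "(z @ a) @ z' @ d \<approx> (z @ z') @ a @ d"
  using artin.cong_append_context[OF assms] by simp

lemma commute_append_left:
  assumes "a @ z \<approx> z @ a" "d @ z \<approx> z @ d" shows "(a @ d) @ z \<approx> z @ a @ d"
proof -
  have "a \<in> lists I" "d \<in> lists I" using braid_lists[OF assms(1)] braid_lists[OF assms(2)] by auto
  then have "a @ (d @ z) \<approx> a @ (z @ d)" "(a @ z) @ d \<approx> (z @ a) @ d"
    using braid_append[OF braid_refl assms(2)] braid_append[OF assms(1) braid_refl] by blast+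
  then show ?thesis using braid_trans[of "a @ d @ z" "a @ z @ d" "z @ a @ d"] by simp
qed

lemma commute_append_right:
  assumes "a @ z \<approx> z @ a" "a @ z' \<approx> z' @ a" shows "a @ z @ z' \<approx> (z @ z') @ a"
  using commute_append_left[OF braid_sym[OF assms(1)] braid_sym[OF assms(2)]] braid_sym by simp

context
  fixes z1 z2 c1 c2
  assumes z1: "c1 @ z1 \<approx> z1 @ c1" "c2 @ z1 \<approx> z1 @ c2"
    and z2: "c1 @ z2 \<approx> z2 @ c1" "c2 @ z2 \<approx> z2 @ c2"
begin

private lemma in_lists: "z1 \<in> lists I" "z2 \<in> lists I" "c1 \<in> lists I" "c2 \<in> lists I"
  using braid_lists[OF z1(1)] braid_lists[OF z2(2)] by auto

text \<open>All factors \<open>z1\<close>, \<open>z2\<close> move to the front. Each side contains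
  both of them twice, so they may differ as long as they commute.\<close>

lemma twisted_braid4:
  assumes z: "z1 @ z2 \<approx> z2 @ z1" and c: "c1 @ c2 @ c1 @ c2 \<approx> c2 @ c1 @ c2 @ c1"
  shows "(z1 @ c1) @ (z2 @ c2) @ (z1 @ c1) @ (z2 @ c2) \<approx> (z2 @ c2) @ (z1 @ c1) @ (z2 @ c2) @ (z1 @ c1)"
proof -
  note C = commute_append_right[OF commute_append_left[OF z1] commute_append_left[OF z2]]
    commute_append_right[OF commute_append_left[OF z2(2,1)] commute_append_left[OF z1(2,1)]]

  have 1: "(z1 @ c1) @ (z2 @ c2) \<approx> (z1 @ z2) @ c1 @ c2"
    by (rule braid_interchange[OF z2(1)]) (use in_lists in auto)
  have 2: "(z2 @ c2) @ (z1 @ c1) \<approx> (z2 @ z1) @ c2 @ c1"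
    by (rule braid_interchange[OF z1(2)]) (use in_lists in auto)
  have "((z1 @ z2) @ c1 @ c2) @ ((z1 @ z2) @ c1 @ c2) \<approx> ((z1 @ z2) @ (z1 @ z2)) @ (c1 @ c2) @ c1 @ c2"
    by (rule braid_interchange[OF C(1)]) (use in_lists in auto)
  moreover have "((z2 @ z1) @ c2 @ c1) @ ((z2 @ z1) @ c2 @ c1) \<approx> ((z2 @ z1) @ (z2 @ z1)) @ (c2 @ c1) @ c2 @ c1"
    by (rule braid_interchange[OF C(2)]) (use in_lists in auto)
  moreover have "((z1 @ z2) @ (z1 @ z2)) @ (c1 @ c2) @ c1 @ c2 \<approx> ((z2 @ z1) @ (z2 @ z1)) @ (c2 @ c1) @ c2 @ c1"
    using braid_append[OF braid_append[OF z z] c] by simp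
  ultimately have "((z1 @ z2) @ c1 @ c2) @ ((z1 @ z2) @ c1 @ c2) \<approx> ((z2 @ z1) @ c2 @ c1) @ ((z2 @ z1) @ c2 @ c1)"
    by (meson braid_trans braid_sym)
  then have "((z1 @ c1) @ (z2 @ c2)) @ ((z1 @ c1) @ (z2 @ c2)) \<approx> ((z2 @ c2) @ (z1 @ c1)) @ ((z2 @ c2) @ (z1 @ c1))"
    using braid_append[OF 1 1] braid_append[OF 2 2] by (meson braid_trans braid_sym)
  then show ?thesis by simp
qed

end

text \<open>Here one side has two factors of the first kind and the other side two of the second, so
  the same \<open>z\<close> has to accompany both words.\<close>

lemma twisted_braid3:
  assumes z: "c1 @ z \<approx> z @ c1" "c2 @ z \<approx> z @ c2" and c: "c1 @ c2 @ c1 \<approx> c2 @ c1 @ c2"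
  shows "(z @ c1) @ (z @ c2) @ (z @ c1) \<approx> (z @ c2) @ (z @ c1) @ (z @ c2)"
proof -
  have l: "z \<in> lists I" "c1 \<in> lists I" "c2 \<in> lists I"
    using braid_lists[OF z(1)] braid_lists[OF z(2)] by auto
  have key: "(z @ a) @ (z @ b) @ (z @ a) \<approx> (z @ z @ z) @ a @ b @ a"
    if "a @ z \<approx> z @ a" "b @ z \<approx> z @ b" "a \<in> lists I" "b \<in> lists I" for a b
  proof -
    have "(z @ b) @ (z @ a) \<approx> (z @ z) @ b @ a"
      by (rule braid_interchange[OF that(2)]) (use l that in auto)
    then have "(z @ a) @ (z @ b) @ (z @ a) \<approx> (z @ a) @ (z @ z) @ b @ a"
      using l that braid_append[OF braid_refl, of "z @ a"] by (simp del: append_assoc)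
    also have "(z @ a) @ (z @ z) @ b @ a \<approx> (z @ z @ z) @ a @ b @ a"
      by (rule braid_interchange[OF commute_append_right[OF that(1,1)]]) (use l that in auto)
    finally show ?thesis .
  qed
  have "(z @ z @ z) @ c1 @ c2 @ c1 \<approx> (z @ z @ z) @ c2 @ c1 @ c2"
    using l by (intro braid_append braid_refl c) auto
  then show ?thesis using key[OF z l(2,3)] key[OF z(2,1) l(3,2)] by (meson braid_trans braid_sym)
qed

lemma cox_proj_elem: "w \<in> lists I \<Longrightarrow> cox_proj M (artin_elem M w) = cox_elem M w"
proof -
  assume w: "w \<in> lists I"
  show ?thesis unfolding cox_proj_def artin_elem_def cox_elem_def
  proof
    show "cox_cong M `` (artin_cong M `` {w}) \<subseteq> cox_cong M `` {w}"
      using artin_cox cox_trans by blast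
    show "cox_cong M `` {w} \<subseteq> cox_cong M `` (artin_cong M `` {w})"
      using braid_refl[OF w] by blast
  qed
qed

text \<open>By \<open>cox_iff_act\<close> a Coxeter relation holds as soon as its word fixes \<rho>.
  The squares are the diagonal relations, and the alternating words occur in both orders because the
  relations are indexed by ordered pairs.\<close>

lemma coxeter_typeI:
  assumes m: "m \<in> {3, 4}" and \<Phi>: "hom_given_by m M \<Phi> (artin_elem M x) (artin_elem M y)"
    and l: "x \<in> lists I" "y \<in> lists I"
    and xx: "act (x @ x) \<rho> = \<rho>" and yy: "act (y @ y) \<rho> = \<rho>"
    and xy: "act (concat (alternating x y (2 * m))) \<rho> = \<rho>"
    and yx: "act (concat (alternating y x (2 * m))) \<rho> = \<rho>"
  shows "coxeter_type m M \<Phi>"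
proof -
  interpret I2: numbers_game "I2_mat m" "\<lambda>i j. if i = j then 2 else if i = 1 \<and> m = 4 then -2 else -1"
    by (rule I2_numbers_game[OF m])
  let ?f = "\<lambda>i. if i = 1 then x else y"
  let ?\<phi> = "cox.extend ?f I (cox_rels M)"
  have triv: "(w, []) \<in> cox_cong M" if "w \<in> lists I" "act w \<rho> = \<rho>" for w
    using that by (simp add: cox_iff_act)
  have img: "?f ` index (I2_mat m) \<subseteq> lists I" using l by auto
  have rels: "(concat (map ?f a), concat (map ?f b)) \<in> pres_cong I (cox_rels M)"
    if "(a, b) \<in> cox_rels (I2_mat m)" for a b
  proof -
    from that obtain i j where ij: "i \<in> {1, 2}" "j \<in> {1, 2}" and b: "b = []"
      and a: "a = alternating i j (2 * entry (I2_mat m) i j)" by auto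
    have "act (concat (map ?f a)) \<rho> = \<rho>"
      using ij xx yy xy yx by (auto simp: a map_alternating I2_entry)
    moreover have "concat (map ?f a) \<in> lists I"
      using l by (simp add: a map_alternating concat_alternating_lists)
    ultimately show ?thesis using triv unfolding b by (simp only: cox_cong_def concat.simps list.map)
  qed
  note hom = cox.extend_hom[OF cox_presentation img rels]
    and cls = cox.extend_cls[OF cox_presentation img rels]
  have "?\<phi> \<in> hom (cox_group (I2_mat m)) (cox_group M)"
    using hom by (simp add: monoid_homs_def cox_group_def)
  moreover have "?\<phi> (cox_proj (I2_mat m) X) = cox_proj M (\<Phi> X)"
    if "X \<in> carrier (artin_monoid (I2_mat m))" for X
  proof -
    obtain w where w: "w \<in> lists {1, 2}" "X = artin_elem (I2_mat m) w"
      using \<open>X \<in> _\<close> unfolding artin.carrier_eq artin_elem_def I2_index(1) by blast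
    have "?\<phi> (cox_proj (I2_mat m) X) = cox_elem M (concat (map ?f w))"
    proof -
      have 1: "cox_proj (I2_mat m) X = cox_cong (I2_mat m) `` {w}"
        using I2.cox_proj_elem[of w] w by (simp add: cox_elem_def)
      show ?thesis unfolding 1 cox_elem_def cox_cong_def[of M]
        by (rule cls, assumption, unfold I2_index(1), rule w(1))
    qed
    moreover have "concat (map ?f w) \<in> lists I"
      using l by (auto simp: in_lists_conv_set split: if_splits)
    ultimately show ?thesis
      using cox_proj_elem dihedral_hom_word[OF \<Phi> l w(1)] w(2) by simp
  qed
  ultimately show ?thesis unfolding coxeter_type_def by blast
qed

lemma commute_lists: "(\<And>i. i \<in> set u \<Longrightarrow> f i \<in> I \<and> d @ [i] \<approx> f i # d) \<Longrightarrow> d \<in> lists I \<Longrightarrow> d @ u \<approx> map f u @ d"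
proof (induction u)
  case Nil
  then show ?case by (simp add: braid_refl)
next
  case (Cons i u)
  have i: "f i \<in> I" "d @ [i] \<approx> f i # d" using Cons.prems(1) by auto
  have IH: "d @ u \<approx> map f u @ d" using Cons by auto
  have "u \<in> lists I" using braid_lists[OF IH] by simp
  then have "d @ i # u \<approx> f i # d @ u" using braid_append[OF i(2) braid_refl, of u] by simp
  also have "f i # d @ u \<approx> f i # map f u @ d" by (rule braid_Cons[OF IH i(1)])
  finally show ?case by simp
qed

end

section \<open>Finite Coxeter groups and standard homomorphisms\<close>

locale finite_game = numbers_game +
  fixes \<Delta> assumes long_top: "long I \<Delta>"
begin

definition lw :: "'a set \<Rightarrow> 'a list" where
  "lw J = (SOME t. long J t)"

abbreviation T :: "'a set \<Rightarrow> 'a list set" where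
  "T J \<equiv> artin_lift M (longest M J)"

lemma long_lw: "J \<subseteq> I \<Longrightarrow> long J (lw J)"
  unfolding lw_def using ex_long[OF long_top] by (rule someI_ex)

lemma lw_lists: "J \<subseteq> I \<Longrightarrow> lw J \<in> lists I"
  using long_lw longD(3) by blast

lemma T_eq: "J \<subseteq> I \<Longrightarrow> T J = artin_elem M (lw J)"
  by (rule artin_lift_longest[OF _ long_lw])

lemma lw_unique: "J \<subseteq> I \<Longrightarrow> long J t \<Longrightarrow> lw J \<approx> t"
  using long_unique long_lw by blast

lemma set_long: "J \<subseteq> I \<Longrightarrow> long J t \<Longrightarrow> set t = J"
proof
  assume a: "J \<subseteq> I" "long J t"
  show "set t \<subseteq> J" using longD(1)[OF a(2)] by (auto simp: in_lists_conv_set)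
  show "J \<subseteq> set t"
  proof
    fix j assume "j \<in> J"
    then obtain x where "t \<approx> j # x" using long_front[OF a] by blast
    then show "j \<in> set t" using set_cong by fastforce
  qed
qed

lemma lw_braid_iff: "J \<subseteq> I \<Longrightarrow> K \<subseteq> I \<Longrightarrow> lw J \<approx> lw K \<longleftrightarrow> J = K"
  using set_cong[of "lw J" "lw K"] set_long long_lw lw_lists by (metis braid_refl)

lemma T_inj: "J \<subseteq> I \<Longrightarrow> K \<subseteq> I \<Longrightarrow> T J = T K \<longleftrightarrow> J = K"
  by (simp add: T_eq artin_elem_eq_iff lw_lists lw_braid_iff)

definition braided :: "'a set \<Rightarrow> 'a set \<Rightarrow> nat \<Rightarrow> bool" where
  "braided J K k \<longleftrightarrow> concat (alternating (lw J) (lw K) k) \<approx> concat (alternating (lw K) (lw J) k)"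

lemma braided_sym: "braided J K k \<longleftrightarrow> braided K J k"
  unfolding braided_def using braid_sym by blast

lemma concat_alternating_cong:
  "x \<approx> x' \<Longrightarrow> y \<approx> y' \<Longrightarrow> concat (alternating x y k) \<approx> concat (alternating x' y' k)"
  by (induction k arbitrary: x y x' y') (auto intro: braid_append simp: braid_refl)

lemma braided_iff:
  assumes "J \<subseteq> I" "K \<subseteq> I" "long J x" "long K y"
  shows "braided J K k \<longleftrightarrow> concat (alternating x y k) \<approx> concat (alternating y x k)"
  using concat_alternating_cong[OF lw_unique[OF assms(1,3)] lw_unique[OF assms(2,4)], of k]
    concat_alternating_cong[OF lw_unique[OF assms(2,4)] lw_unique[OF assms(1,3)], of k]
  unfolding braided_def by (meson braid_sym braid_trans)

lemma braided_alt_prod: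
  "J \<subseteq> I \<Longrightarrow> K \<subseteq> I \<Longrightarrow>
    alt_prod (artin_monoid M) (T J) (T K) k = alt_prod (artin_monoid M) (T K) (T J) k \<longleftrightarrow> braided J K k"
  by (simp add: T_eq alt_prod_artin lw_lists artin_elem_eq_iff concat_alternating_lists braided_def)

lemma hom_exists: "J \<subseteq> I \<Longrightarrow> K \<subseteq> I \<Longrightarrow> braided J K m \<Longrightarrow> \<exists>\<Phi>. hom_given_by m M \<Phi> (T J) (T K)"
  by (metis T_eq lw_lists braided_def dihedral_hom_exists)

lemma hom_braided: "J \<subseteq> I \<Longrightarrow> K \<subseteq> I \<Longrightarrow> hom_given_by m M \<Phi> (T J) (T K) \<Longrightarrow> braided J K m"
  unfolding braided_def using dihedral_hom_braid[of m M \<Phi> "lw J" "lw K"] by (simp add: T_eq lw_lists)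

lemma hom_standard:
  assumes "J \<subseteq> I" "K \<subseteq> I" "hom_given_by m M \<Phi> (T J) (T K)" shows "standard m M \<Phi>"
  using assms unfolding standard_def standard_with_def hom_given_by_def
  by (intro exI[of _ "\<lambda>i. if i = 1 then J else K"]) auto

lemma supported_optimal_iff:
  assumes \<Phi>: "\<Phi> \<in> dihedral_homs m M" and m: "m > 0"
  shows "fully_supported_standard m M \<Phi> \<and> optimal m M \<Phi> \<longleftrightarrow>
    (\<exists>J K. J \<union> K = I \<and> hom_given_by m M \<Phi> (T J) (T K) \<and>
      (J \<noteq> K \<longrightarrow> (\<forall>k. 0 < k \<and> k < m \<longrightarrow> \<not> braided J K k)))"
    (is "?l \<longleftrightarrow> (\<exists>J K. ?r J K)")
proof
  assume l: ?l
  then obtain S where S: "standard_with m M \<Phi> S" "S 1 \<union> S 2 = I"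
    unfolding fully_supported_standard_def by blast
  then have h: "hom_given_by m M \<Phi> (T (S 1)) (T (S 2))"
    using \<Phi> by (simp add: standard_with_def hom_given_by_def)
  have sub: "S 1 \<subseteq> I" "S 2 \<subseteq> I" using S(2) by auto
  have "?r (S 1) (S 2)"
    using l h S(2) T_inj[OF sub] braided_alt_prod[OF sub]
    by (simp add: optimal_def Let_def hom_given_by_def)
  then show "\<exists>J K. ?r J K" by blast
next
  assume "\<exists>J K. ?r J K"
  then obtain J K where r: "?r J K" by blast
  then have sub: "J \<subseteq> I" "K \<subseteq> I" by auto
  have "standard_with m M \<Phi> (\<lambda>i. if i = 1 then J else K)"
    using r sub by (auto simp: standard_with_def hom_given_by_def)
  then have "fully_supported_standard m M \<Phi>"
    using r unfolding fully_supported_standard_def by (intro exI[of _ "\<lambda>i. if i = 1 then J else K"]) auto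
  moreover have "optimal m M \<Phi>"
    using r m T_inj[OF sub] braided_alt_prod[OF sub] hom_braided[OF sub]
    by (auto simp: optimal_def Let_def hom_given_by_def)
  ultimately show ?l by blast
qed

end

text \<open>The classification for one pair (m, M) is reduced to a list \<open>L\<close> of pairs of
  subsets. As 2 < m, optimality lets \<open>complete\<close> assume that the two longest elements do
  not commute; the pairs with J = K force both to be the whole index set and are the degenerate
  case.\<close>

lemma classify:
  fixes M :: "nat coxeter_matrix"
  assumes "finite_game M c \<Delta>" and m: "m \<in> {3, 4}" and \<Phi>: "\<Phi> \<in> dihedral_homs m M"
    and L: "\<And>J K. (J, K) \<in> L \<Longrightarrow> J \<union> K = index M"
    and listed_iff: "\<And>\<Psi>. \<Psi> \<in> dihedral_homs m M \<Longrightarrow> listed m M \<Psi> \<longleftrightarrow>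
      (\<exists>(J, K)\<in>L. hom_given_by m M \<Psi> (artin_lift M (longest M J)) (artin_lift M (longest M K)))"
    and optimal: "\<And>J K k. (J, K) \<in> L \<Longrightarrow> J \<noteq> K \<Longrightarrow> 0 < k \<Longrightarrow> k < m \<Longrightarrow> \<not> finite_game.braided M c J K k"
    and complete: "\<And>J K. \<lbrakk>J \<union> K = index M; J \<noteq> K; finite_game.braided M c J K m;
      \<not> finite_game.braided M c J K 2\<rbrakk> \<Longrightarrow> (J, K) \<in> L \<or> (K, J) \<in> L"
  shows "fully_supported_standard m M \<Phi> \<and> optimal m M \<Phi> \<longleftrightarrow>
    listed m M \<Phi> \<or> (\<exists>\<sigma>. swap_aut m \<sigma> \<and> listed m M (\<Phi> \<circ> \<sigma>)) \<or> degenerate m M \<Phi>"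
proof -
  interpret finite_game M c \<Delta> by fact
  have pos: "m > 0" and two: "2 < m" using m by auto
  have comp: "\<Phi> \<circ> \<sigma> \<in> dihedral_homs m M \<and> (hom_given_by m M (\<Phi> \<circ> \<sigma>) x y \<longleftrightarrow> hom_given_by m M \<Phi> y x)"
    if "swap_aut m \<sigma>" for \<sigma> x y
    using that \<Phi> monoid_homs_comp[of \<sigma> _ _ \<Phi>] by (auto simp: swap_aut_def hom_given_by_def)
  obtain \<sigma> where \<sigma>: "swap_aut m \<sigma>" by (rule swap_aut_exists)
  have swapped: "(\<exists>\<sigma>. swap_aut m \<sigma> \<and> listed m M (\<Phi> \<circ> \<sigma>)) \<longleftrightarrow>
      (\<exists>(J, K)\<in>L. hom_given_by m M \<Phi> (T K) (T J))"
    using comp \<sigma> listed_iff by fastforce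
  show ?thesis
    unfolding supported_optimal_iff[OF \<Phi> pos] swapped listed_iff[OF \<Phi>] degenerate_def
  proof (intro iffI)
    assume "\<exists>J K. J \<union> K = I \<and> hom_given_by m M \<Phi> (T J) (T K) \<and>
      (J \<noteq> K \<longrightarrow> (\<forall>k. 0 < k \<and> k < m \<longrightarrow> \<not> braided J K k))"
    then obtain J K where *: "J \<union> K = I" "hom_given_by m M \<Phi> (T J) (T K)"
      "J \<noteq> K \<Longrightarrow> \<forall>k. 0 < k \<and> k < m \<longrightarrow> \<not> braided J K k" by blast
    show "(\<exists>(J, K)\<in>L. hom_given_by m M \<Phi> (T J) (T K)) \<or> (\<exists>(J, K)\<in>L. hom_given_by m M \<Phi> (T K) (T J)) \<or>
      hom_given_by m M \<Phi> (T I) (T I)"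
    proof (cases "J = K")
      case True
      then show ?thesis using * by simp
    next
      case False
      have "braided J K m" using hom_braided[OF _ _ *(2)] *(1) by blast
      then have "(J, K) \<in> L \<or> (K, J) \<in> L" using complete * two False by simp
      then show ?thesis using *(2) by blast
    qed
  next
    assume "(\<exists>(J, K)\<in>L. hom_given_by m M \<Phi> (T J) (T K)) \<or> (\<exists>(J, K)\<in>L. hom_given_by m M \<Phi> (T K) (T J)) \<or>
      hom_given_by m M \<Phi> (T I) (T I)"
    then obtain J K where JK: "hom_given_by m M \<Phi> (T J) (T K)" "(J, K) \<in> L \<or> (K, J) \<in> L \<or> J = I \<and> K = I"
      by blast
    moreover have "J \<union> K = I" using JK(2) L by blast
    moreover have "J \<noteq> K \<Longrightarrow> \<forall>k. 0 < k \<and> k < m \<longrightarrow> \<not> braided J K k"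
      using JK(2) optimal braided_sym by metis
    ultimately show "\<exists>J K. J \<union> K = I \<and> hom_given_by m M \<Phi> (T J) (T K) \<and>
      (J \<noteq> K \<longrightarrow> (\<forall>k. 0 < k \<and> k < m \<longrightarrow> \<not> braided J K k))" by blast
  qed
qed

subsection \<open>Playing the game on lists\<close>

text \<open>The entry \<open>i - 1\<close> of \<open>C\<close> lists the coordinates of the simple root \<open>i\<close>.\<close>

definition lmove :: "int list list \<Rightarrow> nat \<Rightarrow> int list \<Rightarrow> int list" where
  "lmove C i xs = map2 (\<lambda>r x. x - r * xs ! (i - 1)) (C ! (i - 1)) xs"

primrec lact :: "int list list \<Rightarrow> nat list \<Rightarrow> int list \<Rightarrow> int list" where
  "lact C [] xs = xs"
| "lact C (i # t) xs = lmove C i (lact C t xs)"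

primrec lplay :: "int list list \<Rightarrow> nat list \<Rightarrow> int list \<Rightarrow> int list option" where
  "lplay C [] xs = Some xs"
| "lplay C (i # t) xs = (case lplay C t xs of None \<Rightarrow> None
     | Some ys \<Rightarrow> if ys ! (i - 1) > 0 then Some (lmove C i ys) else None)"

primrec antidom :: "int list list \<Rightarrow> nat \<Rightarrow> nat list \<Rightarrow> int list \<Rightarrow> int list option" where
  "antidom C 0 js xs = None"
| "antidom C (Suc k) js xs = (case List.find (\<lambda>j. xs ! (j - 1) > 0) js of None \<Rightarrow> Some xs
     | Some j \<Rightarrow> antidom C k js (lmove C j xs))"

text \<open>The head of the list acts first. The fuel 64 suffices: the largest parabolic subgroup
  tested is E_7 inside E_8, a play there has at most 63 moves, and one more call recognises the end.
  Running out of fuel counts as failure.\<close>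

primrec refutes :: "int list list \<Rightarrow> nat list list \<Rightarrow> int list \<Rightarrow> bool" where
  "refutes C [] xs = list_ex (\<lambda>x. x > 0) xs"
| "refutes C (js # w) xs = (case antidom C 64 js xs of None \<Rightarrow> False | Some ys \<Rightarrow> refutes C w ys)"

definition lnegative :: "nat list \<Rightarrow> int list option \<Rightarrow> bool" where
  "lnegative js z = (case z of None \<Rightarrow> False | Some ys \<Rightarrow> list_all (\<lambda>j. ys ! (j - 1) < 0) js)"

locale matrix_game =
  fixes M :: "nat coxeter_matrix" and C :: "int list list" and n :: nat
  assumes index_eq: "index M = {1..n}"
    and length_C: "length C = n" "list_all (\<lambda>r. length r = n) C"
    and entry_sym': "entry M i j = entry M j i"
    and diag: "i \<in> {1..n} \<Longrightarrow> entry M i i = 1 \<and> C ! (i - 1) ! (i - 1) = 2"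
    and bonds: "\<lbrakk>i \<in> {1..n}; j \<in> {1..n}; i \<noteq> j\<rbrakk> \<Longrightarrow>
      (entry M i j, C ! (j - 1) ! (i - 1), C ! (i - 1) ! (j - 1))
        \<in> {(2, 0, 0), (3, -1, -1), (4, -1, -2), (4, -2, -1)}"
begin

definition cartan :: "nat \<Rightarrow> nat \<Rightarrow> int" where
  "cartan k i = (if k \<in> {1..n} \<and> i \<in> {1..n} then C ! (i - 1) ! (k - 1) else 0)"

sublocale numbers_game M cartan
proof
  show "entry M i j = entry M j i" for i j by (rule entry_sym')
next
  fix i j assume "i \<in> index M" "j \<in> index M" "i \<noteq> j"
  then show "entry M i j = 2 \<and> cartan i j = 0 \<and> cartan j i = 0 \<or>
      entry M i j = 3 \<and> cartan i j = -1 \<and> cartan j i = -1 \<or>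
      entry M i j = 4 \<and> cartan i j = -1 \<and> cartan j i = -2 \<or>
      entry M i j = 4 \<and> cartan i j = -2 \<and> cartan j i = -1"
    using bonds[of i j] by (auto simp: index_eq cartan_def)
qed (use diag in \<open>auto simp: index_eq cartan_def\<close>)

definition vec :: "int list \<Rightarrow> nat \<Rightarrow> int" where
  "vec xs k = (if k \<in> {1..n} then xs ! (k - 1) else 0)"

lemma length_row: "i \<in> {1..n} \<Longrightarrow> length (C ! (i - 1)) = n"
  using length_C by (auto simp: list_all_length)

lemma length_lmove [simp]: "i \<in> {1..n} \<Longrightarrow> length xs = n \<Longrightarrow> length (lmove C i xs) = n"
  using length_row by (simp add: lmove_def)

lemma s_vec: "i \<in> {1..n} \<Longrightarrow> length xs = n \<Longrightarrow> s i (vec xs) = vec (lmove C i xs)"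
proof
  fix k assume i: "i \<in> {1..n}" "length xs = n"
  then show "s i (vec xs) k = vec (lmove C i xs) k"
    using length_row[OF i(1)] by (auto simp: s_def vec_def cartan_def lmove_def)
qed

lemma rho_vec: "\<rho> = vec (replicate n 1)"
  by (rule ext) (auto simp: \<rho>_def vec_def index_eq)

lemma act_vec: "t \<in> lists {1..n} \<Longrightarrow> length xs = n \<Longrightarrow>
    length (lact C t xs) = n \<and> act t (vec xs) = vec (lact C t xs)"
  by (induction t) (auto simp: s_vec simp del: atLeastAtMost_iff)

lemma legal_vec: "t \<in> lists {1..n} \<Longrightarrow> length xs = n \<Longrightarrow> lplay C t xs = Some ys \<Longrightarrow>
    legal (vec xs) t \<and> act t (vec xs) = vec ys \<and> length ys = n"
proof (induction t arbitrary: ys)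
  case (Cons i t)
  then obtain zs where z: "lplay C t xs = Some zs" "zs ! (i - 1) > 0" "ys = lmove C i zs"
    by (auto split: option.splits if_splits)
  have i: "i \<in> {1..n}" "t \<in> lists {1..n}" using Cons.prems(1) by auto
  have IH: "legal (vec xs) t" "act t (vec xs) = vec zs" "length zs = n"
    using Cons.IH[OF i(2) Cons.prems(2) z(1)] by auto
  have "vec zs i > 0" using z(2) i(1) by (simp add: vec_def)
  then show ?case using IH i(1) z(3) by (simp add: s_vec index_eq)
qed auto

lemma legal_eqI:
  assumes "t \<in> lists {1..n}" "lplay C t (replicate n 1) \<noteq> None"
  shows "legal \<rho> t" "act t \<rho> = vec (the (lplay C t (replicate n 1)))"
  using legal_vec[OF assms(1)] assms(2) by (auto simp: rho_vec)

text \<open>Matsumoto's theorem as an evaluation: two plays that both succeed and end at the same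
  weight prove equality in the Artin monoid.\<close>

lemma braid_eqI:
  assumes "t \<in> lists {1..n}" "u \<in> lists {1..n}" "lplay C t (replicate n 1) \<noteq> None"
    "lplay C u (replicate n 1) = lplay C t (replicate n 1)"
  shows "t \<approx> u"
proof (rule matsumoto)
  show "legal \<rho> t" "legal \<rho> u" using legal_eqI assms by auto
  show "act t \<rho> = act u \<rho>" using legal_eqI[OF assms(1)] legal_eqI[OF assms(2)] assms by auto
qed

lemma longI:
  assumes js: "set js \<subseteq> {1..n}" and t: "t \<in> lists (set js)"
    and neg: "lnegative js (lplay C t (replicate n 1))"
  shows "long (set js) t"
proof -
  obtain ys where ys: "lplay C t (replicate n 1) = Some ys" "list_all (\<lambda>j. ys ! (j - 1) < 0) js"
    using neg by (auto simp: lnegative_def split: option.splits)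
  have "legal \<rho> t" "act t \<rho> = vec ys"
    using legal_vec[OF lists_mono'[OF js t] _ ys(1)] by (auto simp: rho_vec)
  then show ?thesis using t ys(2) js by (auto simp: long_def vec_def list_all_iff)
qed

lemma antidom_sound:
  "set js \<subseteq> {1..n} \<Longrightarrow> length xs = n \<Longrightarrow> antidom C k js xs = Some ys \<Longrightarrow>
    length ys = n \<and> (\<forall>j\<in>set js. ys ! (j - 1) \<le> 0) \<and> (\<exists>p \<in> lists (set js). Dact p (vec xs) = vec ys)"
proof (induction k arbitrary: xs)
  case (Suc k)
  show ?case
  proof (cases "List.find (\<lambda>j. xs ! (j - 1) > 0) js")
    case None
    then have "ys = xs" "\<forall>j\<in>set js. xs ! (j - 1) \<le> 0"
      using Suc.prems(3) None by (simp, auto simp: find_None_iff not_less)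
    moreover have "Dact [] (vec xs) = vec xs" by simp
    ultimately show ?thesis using Suc.prems(2) by blast
  next
    case (Some j)
    then have j: "j \<in> set js" "xs ! (j - 1) > 0" by (auto simp: find_Some_iff)
    then have jn: "j \<in> {1..n}" using Suc.prems by blast
    have D: "D j (vec xs) = vec (lmove C j xs)"
      using j(2) jn s_vec[OF jn] Suc.prems by (auto simp: D_def vec_def)
    obtain p where p: "p \<in> lists (set js)" "Dact p (vec (lmove C j xs)) = vec ys"
      and r: "length ys = n" "\<forall>j\<in>set js. ys ! (j - 1) \<le> 0"
      using Suc.IH[of "lmove C j xs"] Some Suc.prems jn by auto
    have "Dact (p @ [j]) (vec xs) = vec ys" using p(2) D by simp
    moreover have "p @ [j] \<in> lists (set js)" using p(1) j by simp
    ultimately show ?thesis using r by blast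
  qed
qed simp

lemma Dact_antidom:
  assumes "set js \<subseteq> {1..n}" "length xs = n" "antidom C k js xs = Some ys" "long (set js) t"
  shows "Dact t (vec xs) = vec ys" "length ys = n"
proof -
  from antidom_sound[OF assms(1-3)] obtain p where p: "p \<in> lists (set js)" "Dact p (vec xs) = vec ys"
    and ys: "length ys = n" "\<forall>j\<in>set js. ys ! (j - 1) \<le> 0" by auto
  have "Dact p (vec xs) j \<le> 0" if "j \<in> set js" for j
    using p(2) ys that by (simp add: vec_def)
  then show "Dact t (vec xs) = vec ys"
    using Dact_long[of "set js" t p] assms p by (simp add: index_eq)
  show "length ys = n" by fact
qed

lemma refutes_sound:
  "list_all2 (\<lambda>js t. set js \<subseteq> {1..n} \<and> long (set js) t) w ts \<Longrightarrow> length xs = n \<Longrightarrow> refutes C w xs \<Longrightarrow>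
    \<exists>i \<in> I. Dact (concat (rev ts)) (vec xs) i > 0"
proof (induction w ts arbitrary: xs rule: list_all2_induct)
  case Nil
  then obtain k where "k < n" "xs ! k > 0" by (auto simp: list_ex_length)
  then show ?case using Nil by (auto simp: vec_def index_eq intro!: bexI[of _ "Suc k"])
next
  case (Cons js w t ts)
  then obtain ys where ys: "antidom C 64 js xs = Some ys" "refutes C w ys"
    by (auto split: option.splits)
  note d = Dact_antidom[OF _ Cons.prems(1) ys(1)]
  show ?case using Cons.IH[OF _ ys(2)] d[of t] Cons.hyps by simp
qed

end

locale finite_matrix_game = matrix_game +
  fixes \<Delta>
  assumes top: "set \<Delta> \<subseteq> {1..n}" "lnegative [1..<Suc n] (lplay C \<Delta> (replicate n 1))"
begin

sublocale finite_game M cartan \<Delta>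
proof
  have "long (set [1..<Suc n]) \<Delta>"
    by (rule longI) (use top in \<open>auto simp: in_lists_conv_set\<close>)
  then show "long I \<Delta>" by (simp add: index_eq atLeastLessThanSuc_atLeastAtMost del: upt_Suc)
qed

definition full_pair :: "nat set \<Rightarrow> nat set \<Rightarrow> bool" where
  "full_pair J K \<longleftrightarrow> full (lw J @ lw K @ lw J @ lw K)"

lemma full_pair_mono: "full_pair J K \<Longrightarrow> J \<subseteq> J' \<Longrightarrow> K \<subseteq> K' \<Longrightarrow> J' \<subseteq> I \<Longrightarrow> K' \<subseteq> I \<Longrightarrow> full_pair J' K'"
  unfolding full_pair_def
  using full_mono[OF long_top _ _ _ _ long_lw long_lw long_lw long_lw] by (meson subset_trans)

lemma braided4D: "braided J K 4 \<longleftrightarrow> lw J @ lw K @ lw J @ lw K \<approx> lw K @ lw J @ lw K @ lw J"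
  by (simp add: braided_def)

lemma braided3D: "braided J K 3 \<longleftrightarrow> lw J @ lw K @ lw J \<approx> lw K @ lw J @ lw K"
  by (simp add: braided_def)

text \<open>For m = 3 the product of three factors is already full, and a further factor does not
  destroy this. One family of tests thus serves both values of m.\<close>

lemma braided_full_pair:
  assumes JK: "J \<union> K = I" and b: "braided J K m" and m: "m \<in> {3, 4}" shows "full_pair J K"
proof -
  have l: "long J (lw J)" "long K (lw K)" using JK long_lw by blast+
  note lI = longD(3)[OF l(1)] longD(3)[OF l(2)]
  show ?thesis
  proof (cases "m = 4")
    case True
    then show ?thesis using full_common_multiple[OF JK l] b unfolding full_pair_def by (auto simp: braided4D)
  next
    case False
    then have "full (lw J @ lw K @ lw J)"
      using full_common_multiple[OF JK l] b m by (auto simp: braided3D)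
    then show ?thesis
      using full_append[OF long_top, of "lw J @ lw K @ lw J" "lw K"] lI by (simp add: full_pair_def)
  qed
qed

lemma refutes_full_pair:
  assumes "refutes C [ks, js, ks, js] xs" "length xs = n" "set js \<subseteq> {1..n}" "set ks \<subseteq> {1..n}"
  shows "\<not> full_pair (set js) (set ks)"
proof
  assume f: "full_pair (set js) (set ks)"
  let ?x = "lw (set js)" and ?y = "lw (set ks)"
  have l: "long (set js) ?x" "long (set ks) ?y" using assms long_lw by (auto simp: index_eq)
  obtain i where "i \<in> I" "Dact (concat (rev [?y, ?x, ?y, ?x])) (vec xs) i > 0"
    using refutes_sound[OF _ assms(2,1), of "[?y, ?x, ?y, ?x]"] l assms by auto
  moreover have "?x @ ?y @ ?x @ ?y \<in> lists I" using l longD(3) by auto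
  ultimately show False
    using full_nonpos[of "?x @ ?y @ ?x @ ?y" i "vec xs"] f by (simp add: full_pair_def)
qed

definition drop_indices :: "nat list \<Rightarrow> nat list" where
  "drop_indices as = filter (\<lambda>x. x \<notin> set as) [1..<Suc n]"

lemma set_drop_indices: "set (drop_indices as) = {1..n} - set as"
  by (auto simp: drop_indices_def)

text \<open>The test \<open>(as, bs, d)\<close> starts the game at the fundamental weight \<open>d\<close>.\<close>

definition tests :: "(nat list \<times> nat list \<times> nat) list \<Rightarrow> bool" where
  "tests ts = list_all (\<lambda>(as, bs, d). refutes C
     [drop_indices bs, drop_indices as, drop_indices bs, drop_indices as] (map (\<lambda>i. if i = d then 1 else 0) [1..<Suc n])) ts"

text \<open>By monotonicity a single refuted pair excludes all pairs of smaller subsets, and since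
  \<open>braided\<close> is symmetric it excludes them in either order.\<close>

lemma testsD:
  assumes "tests ts" "(as, bs, d) \<in> set ts" "J \<union> K = I" "m \<in> {3, 4}" "braided J K m"
  shows "\<not> (set as \<inter> J = {} \<and> set bs \<inter> K = {})" "\<not> (set as \<inter> K = {} \<and> set bs \<inter> J = {})"
proof -
  have r: "refutes C [drop_indices bs, drop_indices as, drop_indices bs, drop_indices as]
      (map (\<lambda>i. if i = d then 1 else 0) [1..<Suc n])"
    using assms(1,2) unfolding tests_def list_all_iff by fast
  have "\<not> full_pair (set (drop_indices as)) (set (drop_indices bs))"
    by (rule refutes_full_pair[OF r]) (auto simp: set_drop_indices)
  then have nf: "\<not> full_pair ({1..n} - set as) ({1..n} - set bs)" by (simp add: set_drop_indices)
  have "full_pair J K" "full_pair K J"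
    using braided_full_pair[OF assms(3,5,4)] braided_full_pair[of K J m] assms braided_sym by (auto simp: Un_commute)
  moreover have "J \<subseteq> {1..n}" "K \<subseteq> {1..n}" using assms(3) index_eq by auto
  ultimately show "\<not> (set as \<inter> J = {} \<and> set bs \<inter> K = {})" "\<not> (set as \<inter> K = {} \<and> set bs \<inter> J = {})"
    using nf full_pair_mono[of J K "{1..n} - set as" "{1..n} - set bs"]
      full_pair_mono[of K J "{1..n} - set as" "{1..n} - set bs"] by (auto simp: index_eq)
qed

end

subsection \<open>The types \<open>F\<^sub>4\<close>, \<open>E\<^sub>6\<close>, \<open>E\<^sub>7\<close>, \<open>E\<^sub>8\<close>\<close>

lemma E_mat_index: "index (E_mat n) = {1..n}"
  by (simp add: E_mat_def)

lemma E_mat_entry: "entry (E_mat n) i j = (if i = j then 1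
    else if j = i + 1 \<and> 1 \<le> i \<and> i + 2 \<le> n \<or> i = j + 1 \<and> 1 \<le> j \<and> j + 2 \<le> n \<or>
      i = 3 \<and> j = n \<or> i = n \<and> j = 3 then 3 else 2)"
  by (auto simp: E_mat_def doubleton_eq_iff)

lemma F4_index: "index F4_mat = {1..4}"
  by (simp add: F4_mat_def)

lemma F4_entry: "entry F4_mat i j = (if i = j then 1
    else if i = 1 \<and> j = 2 \<or> i = 2 \<and> j = 1 \<or> i = 3 \<and> j = 4 \<or> i = 4 \<and> j = 3 then 3
    else if i = 2 \<and> j = 3 \<or> i = 3 \<and> j = 2 then 4 else 2)"
  by (auto simp: F4_mat_def doubleton_eq_iff)

lemma atLeastAtMost_4: "{1..4} = {1, 2, 3, 4 :: nat}"
  and atLeastAtMost_6: "{1..6} = {1, 2, 3, 4, 5, 6 :: nat}"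
  and atLeastAtMost_7: "{1..7} = {1, 2, 3, 4, 5, 6, 7 :: nat}"
  and atLeastAtMost_8: "{1..8} = {1, 2, 3, 4, 5, 6, 7, 8 :: nat}"
  by auto


lemma matrix_gameI:
  assumes "index M = {1..n}" "\<And>i j. entry M i j = entry M j i" "\<And>i. entry M i i = 1"
    and "length C = n \<and> list_all (\<lambda>r. length r = n) C"
    and "\<forall>i\<in>{1..n}. C ! (i - 1) ! (i - 1) = 2 \<and> (\<forall>j\<in>{1..n}. i \<noteq> j \<longrightarrow>
      (entry M i j, C ! (j - 1) ! (i - 1), C ! (i - 1) ! (j - 1))
        \<in> {(2, 0, 0), (3, -1, -1), (4, -1, -2), (4, -2, -1)})"
  shows "matrix_game M C n"
  by unfold_locales (use assms in blast)+

text \<open>The double bond is oriented so that the simple roots 1 and 2 are long.\<close>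

definition F4_roots :: "int list list" where
  "F4_roots = [[2, -1, 0, 0],
    [-1, 2, -2, 0],
    [0, -1, 2, -1],
    [0, 0, -1, 2]]"

definition F4_top :: "nat list" where
  "F4_top = [4, 3, 2, 3, 1, 2, 3, 4, 3, 2, 3, 1, 2, 3, 4, 3, 2, 3, 1, 2, 3, 1, 2, 1]"

interpretation F4: matrix_game "F4_mat" F4_roots 4
  by (rule matrix_gameI, unfold atLeastAtMost_4) (auto simp: F4_index F4_entry F4_roots_def)

interpretation F4: finite_matrix_game "F4_mat" F4_roots 4 F4_top
  by unfold_locales code_simp+

definition E6_roots :: "int list list" where
  "E6_roots = [[2, -1, 0, 0, 0, 0],
    [-1, 2, -1, 0, 0, 0],
    [0, -1, 2, -1, 0, -1],
    [0, 0, -1, 2, -1, 0],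
    [0, 0, 0, -1, 2, 0],
    [0, 0, -1, 0, 0, 2]]"

definition E6_top :: "nat list" where
  "E6_top = [6, 3, 4, 5, 2, 3, 4, 1, 2, 3, 6, 3, 4, 5, 2, 3, 4, 1, 2, 3, 6, 1, 2, 3, 4, 5, 1, 2, 3, 4, 1, 2, 3, 1, 2, 1]"

interpretation E6: matrix_game "E_mat 6" E6_roots 6
  by (rule matrix_gameI, unfold atLeastAtMost_6) (auto simp: E_mat_index E_mat_entry E6_roots_def)

interpretation E6: finite_matrix_game "E_mat 6" E6_roots 6 E6_top
  by unfold_locales code_simp+

definition E7_roots :: "int list list" where
  "E7_roots = [[2, -1, 0, 0, 0, 0, 0],
    [-1, 2, -1, 0, 0, 0, 0],
    [0, -1, 2, -1, 0, 0, -1],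
    [0, 0, -1, 2, -1, 0, 0],
    [0, 0, 0, -1, 2, -1, 0],
    [0, 0, 0, 0, -1, 2, 0],
    [0, 0, -1, 0, 0, 0, 2]]"

definition E7_top :: "nat list" where
  "E7_top = [7, 3, 4, 2, 3, 7, 5, 6, 4, 5, 3, 4, 1, 2, 3, 7, 4, 5, 6, 3, 4, 5, 2, 3, 4, 1, 2, 3, 7, 4, 5, 6, 3, 4, 5, 2, 3, 4, 1, 2, 3, 7, 1, 2, 3, 4, 5, 6, 1, 2, 3, 4, 5, 1, 2, 3, 4, 1, 2, 3, 1, 2, 1]"

interpretation E7: matrix_game "E_mat 7" E7_roots 7
  by (rule matrix_gameI, unfold atLeastAtMost_7) (auto simp: E_mat_index E_mat_entry E7_roots_def)

interpretation E7: finite_matrix_game "E_mat 7" E7_roots 7 E7_top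
  by unfold_locales code_simp+

definition E8_roots :: "int list list" where
  "E8_roots = [[2, -1, 0, 0, 0, 0, 0, 0],
    [-1, 2, -1, 0, 0, 0, 0, 0],
    [0, -1, 2, -1, 0, 0, 0, -1],
    [0, 0, -1, 2, -1, 0, 0, 0],
    [0, 0, 0, -1, 2, -1, 0, 0],
    [0, 0, 0, 0, -1, 2, -1, 0],
    [0, 0, 0, 0, 0, -1, 2, 0],
    [0, 0, -1, 0, 0, 0, 0, 2]]"

definition E8_top :: "nat list" where
  "E8_top = [8, 3, 4, 2, 3, 8, 5, 6, 4, 5, 3, 4, 1, 2, 3, 8, 7, 4, 5, 6, 3, 4, 5, 2, 3, 4, 1, 2, 3, 8, 7, 4, 5, 6, 3, 4, 5, 2, 3, 4, 1, 2, 3, 8, 5, 6, 7, 4, 5, 6, 3, 4, 5, 2, 3, 4, 1, 2, 3, 8, 5, 6, 7, 4, 5, 6, 3, 4, 5, 2, 3, 4, 1, 2, 3, 8, 5, 6, 7, 4, 5, 6, 3, 4, 5, 2, 3, 4, 1, 2, 3, 8, 1, 2, 3, 4, 5, 6, 7, 1, 2, 3, 4, 5, 6, 1, 2, 3, 4, 5, 1, 2, 3, 4, 1, 2, 3, 1, 2, 1]"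

interpretation E8: matrix_game "E_mat 8" E8_roots 8
  by (rule matrix_gameI, unfold atLeastAtMost_8) (auto simp: E_mat_index E_mat_entry E8_roots_def)

interpretation E8: finite_matrix_game "E_mat 8" E8_roots 8 E8_top
  by unfold_locales code_simp+

definition F4_tests :: "(nat list \<times> nat list \<times> nat) list" where
  "F4_tests = [([1], [2], 4), ([1], [3], 4), ([2], [3], 3), ([2], [4], 4), ([3], [4], 4)]"

lemma F4_tests: "F4.tests F4_tests"
  unfolding F4.tests_def F4.drop_indices_def by code_simp

text \<open>Three pairs of single vertices survive and form the triangle 1, 5, 6, so larger
  complements have to be considered too; the last two tests refute two of them.\<close>

definition E6_tests :: "(nat list \<times> nat list \<times> nat) list" where
  "E6_tests = [([1], [2], 5), ([1], [3], 5), ([1], [4], 5), ([2], [3], 5), ([2], [4], 5),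
    ([2], [5], 5), ([2], [6], 5), ([3], [4], 1), ([3], [5], 5), ([3], [6], 6),
    ([4], [5], 5), ([4], [6], 1), ([1, 6], [5], 5), ([1], [5, 6], 5)]"

lemma E6_tests: "E6.tests E6_tests"
  unfolding E6.tests_def E6.drop_indices_def by code_simp

definition E7_tests :: "(nat list \<times> nat list \<times> nat) list" where
  "E7_tests = [([1], [2], 6), ([1], [3], 6), ([1], [4], 6), ([1], [7], 7), ([2], [3], 6),
    ([2], [4], 6), ([2], [5], 6), ([2], [6], 6), ([2], [7], 6), ([3], [4], 1),
    ([3], [5], 6), ([3], [6], 6), ([3], [7], 7), ([4], [5], 5), ([4], [6], 6),
    ([4], [7], 7), ([5], [6], 6), ([5], [7], 6), ([6], [7], 6)]"

lemma E7_tests: "E7.tests E7_tests"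
  unfolding E7.tests_def E7.drop_indices_def by code_simp

definition E8_tests :: "(nat list \<times> nat list \<times> nat) list" where
  "E8_tests = [([1], [2], 7), ([1], [3], 7), ([1], [4], 7), ([1], [5], 7), ([1], [6], 7),
    ([1], [8], 8), ([2], [3], 7), ([2], [4], 7), ([2], [5], 7), ([2], [6], 7),
    ([2], [7], 7), ([2], [8], 7), ([3], [4], 1), ([3], [5], 7), ([3], [6], 7),
    ([3], [7], 7), ([3], [8], 8), ([4], [5], 5), ([4], [6], 7), ([4], [7], 7),
    ([4], [8], 8), ([5], [6], 6), ([5], [7], 7), ([5], [8], 7), ([6], [7], 7),
    ([6], [8], 7), ([7], [8], 7)]"

lemma E8_tests: "E8.tests E8_tests"
  unfolding E8.tests_def E8.drop_indices_def by code_simp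

subsection \<open>Computed words\<close>

abbreviation ones :: "int list list \<Rightarrow> int list" where
  "ones C \<equiv> replicate (length C) 1"

primrec lword :: "int list list \<Rightarrow> nat \<Rightarrow> nat list \<Rightarrow> int list \<Rightarrow> nat list" where
  "lword C 0 js xs = []"
| "lword C (Suc k) js xs = (case List.find (\<lambda>j. xs ! (j - 1) > 0) js of None \<Rightarrow> []
     | Some j \<Rightarrow> lword C k js (lmove C j xs) @ [j])"

definition word_of :: "int list list \<Rightarrow> nat list \<Rightarrow> nat list" where
  "word_of C js = lword C 64 js (ones C)"

definition long_ok :: "int list list \<Rightarrow> nat list \<Rightarrow> nat list \<Rightarrow> bool" where
  "long_ok C js t \<longleftrightarrow> list_all (\<lambda>j. 1 \<le> j \<and> j \<le> length C) js \<and> list_all (\<lambda>j. j \<in> set js) t \<and>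
     lnegative js (lplay C t (ones C))"

definition legal_ok :: "int list list \<Rightarrow> nat list \<Rightarrow> bool" where
  "legal_ok C t \<longleftrightarrow> list_all (\<lambda>j. 1 \<le> j \<and> j \<le> length C) t \<and> lplay C t (ones C) \<noteq> None"

definition braid_ok :: "int list list \<Rightarrow> nat list \<Rightarrow> nat list \<Rightarrow> bool" where
  "braid_ok C t u \<longleftrightarrow> legal_ok C t \<and> legal_ok C u \<and> lplay C u (ones C) = lplay C t (ones C)"

definition same_ok :: "int list list \<Rightarrow> nat list \<Rightarrow> nat list \<Rightarrow> bool" where
  "same_ok C t u \<longleftrightarrow> lact C t (ones C) = lact C u (ones C)"

text \<open>Writing \<open>l\<close>, \<open>l @ c\<^sub>1\<close>, \<open>l @ e @ c\<^sub>2\<close> for words of the longest elements of \<open>J\<^sub>1 \<inter> J\<^sub>2\<close>, \<open>J\<^sub>1\<close>, \<open>J\<^sub>2\<close>,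
  the words \<open>c\<^sub>1\<close> and \<open>e @ c\<^sub>2\<close> represent the images of the two generators under the homomorphism \<open>\<Phi>\<close>.
  The word \<open>e\<close> is empty except for \<open>E\<^sub>7\<close>, where it is the letter \<open>6\<close>, which commutes with everything else.\<close>

definition hom_ok :: "int list list \<Rightarrow> nat list \<Rightarrow> nat list \<Rightarrow> nat list \<Rightarrow> nat list \<Rightarrow>
    nat list \<Rightarrow> nat list \<Rightarrow> nat list \<Rightarrow> nat \<Rightarrow> bool" where
  "hom_ok C ls js ks l e c1 c2 m \<longleftrightarrow>
     long_ok C ls l \<and> long_ok C js (l @ c1) \<and> long_ok C ks (l @ e @ c2) \<and>
     legal_ok C c1 \<and> legal_ok C (e @ c2) \<and>
     braid_ok C (c1 @ l) (l @ c1) \<and> braid_ok C (c2 @ l) (l @ c2) \<and>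
     braid_ok C (c1 @ e) (e @ c1) \<and> braid_ok C (c2 @ e) (e @ c2) \<and> braid_ok C (e @ l) (l @ e) \<and>
     braid_ok C (concat (alternating c1 c2 m)) (concat (alternating c2 c1 m)) \<and>
     same_ok C (l @ l @ c1) c1 \<and> same_ok C (l @ l @ e @ c2) (e @ c2) \<and>
     same_ok C (c1 @ c1) [] \<and> same_ok C ((e @ c2) @ e @ c2) [] \<and>
     same_ok C (concat (alternating c1 (e @ c2) (2 * m))) [] \<and>
     same_ok C (concat (alternating (e @ c2) c1 (2 * m))) []"

text \<open>Continuing the greedy play after \<open>l\<close>, or after \<open>e @ l\<close>, yields
  \<open>c1 @ l\<close> and \<open>c2 @ e @ l\<close>. That \<open>hom_ok\<close> has the factors in
  the opposite order is harmless because they commute.\<close>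

definition computed_hom_ok :: "int list list \<Rightarrow> nat list \<Rightarrow> nat list \<Rightarrow> nat list \<Rightarrow> nat list \<Rightarrow> nat \<Rightarrow> bool" where
  "computed_hom_ok C ls js ks e m \<longleftrightarrow> hom_ok C ls js ks (word_of C ls) e
     (lword C 64 js (lact C (word_of C ls) (ones C))) (lword C 64 ks (lact C (e @ word_of C ls) (ones C))) m"

text \<open>\<open>f\<close> is a weight of the letters that is preserved by the braid relations.\<close>

definition small_ok :: "int list list \<Rightarrow> (nat \<Rightarrow> nat) \<Rightarrow> nat \<Rightarrow> nat list \<Rightarrow> nat list \<Rightarrow> bool" where
  "small_ok C f N js ks \<longleftrightarrow> long_ok C js (word_of C js) \<and> long_ok C ks (word_of C ks) \<and>
     length (word_of C js) + length (word_of C ks) < N \<and>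
     sum_list (map f (word_of C js)) \<noteq> sum_list (map f (word_of C ks))"

lemma lact_append: "lact C (t @ u) xs = lact C t (lact C u xs)"
  by (induction t) auto

context matrix_game
begin

text \<open>\<open>B\<close> need not be the Cartan matrix: any matrix whose moves satisfy the braid
  relations gives an invariant of the Artin monoid. It will be applied to Burau matrices.\<close>

lemma lact_cong:
  assumes B: "length B = n" "list_all (\<lambda>r. length r = n) B"
    and rel: "\<And>i j xs. i \<in> I \<Longrightarrow> j \<in> I \<Longrightarrow> i \<noteq> j \<Longrightarrow> length xs = n \<Longrightarrow>
      lact B (alternating i j (entry M i j)) xs = lact B (alternating j i (entry M i j)) xs"
  shows "t \<approx> u \<Longrightarrow> length xs = n \<Longrightarrow> lact B t xs = lact B u xs"
proof (induction arbitrary: xs rule: braid_induct)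
  have len: "length (lmove B i xs) = n" if "i \<in> I" "length xs = n" for i xs
  proof -
    have "length (B ! (i - 1)) = n" using B that(1) by (auto simp: list_all_length index_eq)
    then show ?thesis using that(2) by (simp add: lmove_def)
  qed
  have len': "u \<in> lists I \<Longrightarrow> length xs = n \<Longrightarrow> length (lact B u xs) = n" for u xs
    by (induction u) (auto simp: len)
  {
    case (refl u)
    then show ?case by simp
  next
    case (step r r' u v)
    then have "lact B r (lact B v xs) = lact B r' (lact B v xs)"
      using rel len'[of v xs] by blast
    then show ?case by (simp add: lact_append)
  next
    case (sym u v)
    then show ?case by metis
  next
    case (trans u v w)
    then show ?case by metis
  }
qed

lemma ones_eq: "ones C = replicate n 1" "length (ones C) = n"
  using length_C by simp_all

lemma long_okD: "long_ok C js t \<Longrightarrow> set js \<subseteq> I \<and> long (set js) t"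
proof -
  assume ok: "long_ok C js t"
  have js: "set js \<subseteq> {1..n}" using ok length_C by (fastforce simp: long_ok_def list_all_iff)
  moreover have "t \<in> lists (set js)" using ok by (auto simp: long_ok_def list_all_iff in_lists_conv_set)
  ultimately show ?thesis using longI[OF js] ok length_C by (simp add: long_ok_def index_eq)
qed

lemma legal_okD:
  assumes "legal_ok C t" shows "legal \<rho> t" "t \<in> lists {1..n}"
proof -
  show "t \<in> lists {1..n}"
    using assms length_C by (auto simp: legal_ok_def list_all_iff in_lists_conv_set)
  then show "legal \<rho> t" using assms legal_eqI(1)[of t] length_C by (simp add: legal_ok_def)
qed

lemma braid_okD: "braid_ok C t u \<Longrightarrow> t \<approx> u"
  using legal_okD[of t] legal_okD[of u] braid_eqI[of t u] length_C by (simp add: braid_ok_def legal_ok_def)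

lemma same_okD:
  assumes "same_ok C t u" "t \<in> lists I" "u \<in> lists I" shows "act t \<rho> = act u \<rho>"
  using assms act_vec[of t "ones C"] act_vec[of u "ones C"] length_C
  by (simp add: same_ok_def rho_vec index_eq del: atLeastAtMost_iff)

lemma vec_inj: "length xs = n \<Longrightarrow> length ys = n \<Longrightarrow> vec xs = vec ys \<Longrightarrow> xs = ys"
proof (rule nth_equalityI)
  fix i assume "length xs = n" "length ys = n" "vec xs = vec ys" "i < length xs"
  then have "vec xs (Suc i) = vec ys (Suc i)" "i < n" by simp_all
  then show "xs ! i = ys ! i" by (simp add: vec_def)
qed simp

lemma act_same:
  assumes "act t \<rho> = act u \<rho>" "t \<in> lists I" "u \<in> lists I" shows "same_ok C t u"
proof -
  have l: "t \<in> lists {1..n}" "u \<in> lists {1..n}" using assms(2,3) by (simp_all add: index_eq)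
  have r: "\<rho> = vec (ones C)" by (simp only: rho_vec ones_eq(1))
  note v = act_vec[OF l(1) ones_eq(2)] act_vec[OF l(2) ones_eq(2)]
  have "vec (lact C t (ones C)) = vec (lact C u (ones C))"
    by (rule HOL.trans[OF conjunct2[OF v(1), symmetric] HOL.trans[OF assms(1)[unfolded r] conjunct2[OF v(2)]]])
  then show ?thesis unfolding same_ok_def by (rule vec_inj[OF conjunct1[OF v(1)] conjunct1[OF v(2)]])
qed

lemma braid_same:
  assumes "t \<approx> u" shows "same_ok C t u"
  using act_same[OF act_cong[OF assms]] braid_lists[OF assms] by blast

end

section \<open>Criteria for and against braid relations\<close>

context finite_matrix_game
begin

lemma hom_ok_consequences:
  assumes ok: "hom_ok C ls js ks l e c1 c2 m" and m: "m = 4 \<or> m = 3 \<and> e = []"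
  shows "\<exists>\<Phi>. hom_given_by m M \<Phi> (artin_lift M (longest_rel M (set ls) (set js)))
      (artin_lift M (longest_rel M (set ls) (set ks))) \<and> coxeter_type m M \<Phi>" (is ?a)
    and "braided (set js) (set ks) m" (is ?b)
    and "m = 4 \<Longrightarrow> long_ok C js' (l @ e @ c1) \<Longrightarrow> braided (set js') (set ks) m" (is "_ \<Longrightarrow> _ \<Longrightarrow> ?c")
proof -
  note ok' = ok[unfolded hom_ok_def]
  have L: "set ls \<subseteq> I" "long (set ls) l" "set js \<subseteq> I" "long (set js) (l @ c1)"
    "set ks \<subseteq> I" "long (set ks) (l @ e @ c2)" using ok' long_okD by blast+
  have B: "c1 @ l \<approx> l @ c1" "c2 @ l \<approx> l @ c2" "c1 @ e \<approx> e @ c1" "c2 @ e \<approx> e @ c2" "e @ l \<approx> l @ e"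
    "concat (alternating c1 c2 m) \<approx> concat (alternating c2 c1 m)" using ok' braid_okD by blast+
  have lI: "l \<in> lists I" "c1 \<in> lists I" "c2 \<in> lists I" "e \<in> lists I"
    using braid_lists[OF B(1)] braid_lists[OF B(4)] by auto
  have leg: "legal \<rho> c1" "legal \<rho> (e @ c2)" using ok' legal_okD by blast+
  have le: "c1 @ l @ e \<approx> (l @ e) @ c1" "c2 @ l @ e \<approx> (l @ e) @ c2"
    using commute_append_right B by blast+
  have lle: "l @ l @ e \<approx> (l @ e) @ l"
    using commute_append_right[OF braid_refl braid_sym[OF B(5)]] lI by simp
  have lele: "(l @ e) @ (l @ e) \<approx> (l @ e) @ (l @ e)" using lI by (intro braid_refl) auto
  \<comment> \<open>For m = 4 the letter \<open>e\<close> accompanies only the second generator,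
    that is, the commuting factors are \<open>[]\<close> and \<open>e\<close>.\<close>
  have xy: "concat (alternating c1 (e @ c2) m) \<approx> concat (alternating (e @ c2) c1 m)"
  proof (cases "m = 4")
    case True
    then show ?thesis
      using twisted_braid4[of c1 "[]" c2 e] B lI by (simp add: braid_refl)
  next
    case False
    then show ?thesis using m B(6) by auto
  qed
  have l2: "e @ c2 \<in> lists I" using lI by simp
  obtain \<Phi> where \<Phi>: "hom_given_by m M \<Phi> (artin_elem M c1) (artin_elem M (e @ c2))"
    using dihedral_hom_exists[OF lI(2) l2 xy] by blast
  have sm: "act t \<rho> = act u \<rho>" if "same_ok C t u" "t \<in> lists I" "u \<in> lists I" for t u
    using same_okD that by blast
  have "coxeter_type m M \<Phi>"
  proof (rule coxeter_typeI[OF _ \<Phi> lI(2) l2])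
    show "m \<in> {3, 4}" using m by auto
    show "act (c1 @ c1) \<rho> = \<rho>" "act ((e @ c2) @ e @ c2) \<rho> = \<rho>"
      using ok' sm[of "c1 @ c1" "[]"] sm[of "(e @ c2) @ e @ c2" "[]"] lI by auto
    show "act (concat (alternating c1 (e @ c2) (2 * m))) \<rho> = \<rho>"
      "act (concat (alternating (e @ c2) c1 (2 * m))) \<rho> = \<rho>"
      using ok' sm[of "concat (alternating c1 (e @ c2) (2 * m))" "[]"]
        sm[of "concat (alternating (e @ c2) c1 (2 * m))" "[]"] 
        concat_alternating_lists[OF lI(2) l2] concat_alternating_lists[OF l2 lI(2)] by auto
  qed
  moreover have "artin_lift M (longest_rel M (set ls) (set js)) = artin_elem M c1"
    by (rule artin_lift_longest_rel[OF L(1,3,2,4) leg(1)]) (rule sm, use ok' lI in auto)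
  moreover have "artin_lift M (longest_rel M (set ls) (set ks)) = artin_elem M (e @ c2)"
    by (rule artin_lift_longest_rel[OF L(1,5,2,6) leg(2)]) (rule sm, use ok' lI in auto)
  ultimately show ?a using \<Phi> by auto
  \<comment> \<open>Now the commuting factors are \<open>l\<close> and \<open>l @ e\<close>; for m =
    3 the word \<open>e\<close> is empty and they agree.\<close>
  show ?b
  proof (cases "m = 4")
    case True
    then show ?thesis
      using twisted_braid4[OF B(1,2) le lle] B(6) unfolding braided_iff[OF L(3,5,4,6)] by simp
  next
    case False
    then show ?thesis
      using twisted_braid3[OF B(1,2)] m B(6) L unfolding braided_iff[OF L(3,5,4,6)] by simp
  qed
  \<comment> \<open>The enlarged first subset has the extra letter \<open>e\<close> as well, so
    \<open>l @ e\<close> is the commuting factor on both sides.\<close>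
  show ?c if "m = 4" "long_ok C js' (l @ e @ c1)"
  proof -
    have L': "set js' \<subseteq> I" "long (set js') (l @ e @ c1)" using long_okD[OF that(2)] by auto
    show ?thesis
      using twisted_braid4[OF le le lele] B(6) that(1) unfolding braided_iff[OF L'(1) L(5) L'(2) L(6)] by simp
  qed
qed

lemma braided_1: "J \<subseteq> I \<Longrightarrow> K \<subseteq> I \<Longrightarrow> braided J K (Suc 0) \<longleftrightarrow> J = K"
  by (simp add: braided_def lw_braid_iff)

lemma braided_2: "braided J K 2 \<longleftrightarrow> lw J @ lw K \<approx> lw K @ lw J"
  by (simp add: braided_def)

text \<open>If the longest elements commute, their product is a common multiple, hence full, hence
  at least as long as \<Delta>.\<close>

lemma braided_2_length:
  assumes "braided J K 2" "J \<union> K = I" "long J x" "long K y"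
  shows "length \<Delta> \<le> length x + length y"
proof -
  have JK: "J \<subseteq> I" "K \<subseteq> I" using assms(2) by auto
  have xy: "x @ y \<approx> y @ x" using braided_iff[OF JK assms(3,4), of 2] assms(1) by simp
  have "full (x @ y)" by (rule full_common_multiple[OF assms(2,3,4) xy])
  then show ?thesis using full_length[OF long_top, of "x @ y"] longD(3)[OF assms(3)] longD(3)[OF assms(4)] by simp
qed

text \<open>The two sides of the relation differ by one copy of \<open>x\<close> against one copy of
  \<open>y\<close>, so every letter count that the braid relations preserve agrees on them.\<close>

lemma braided_3_weight:
  fixes f :: "nat \<Rightarrow> nat"
  assumes "braided J K 3" "J \<subseteq> I" "K \<subseteq> I" "long J x" "long K y"
    and "\<And>i j. i \<in> I \<Longrightarrow> j \<in> I \<Longrightarrow> entry M i j = 3 \<Longrightarrow> f i = f j"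
  shows "sum_list (map f x) = sum_list (map f y)"
  using sum_list_cong[of "x @ y @ x" "y @ x @ y" f] assms braided_iff[OF assms(2-5), of 3] by simp

lemma braided_3_length:
  assumes "braided J K 3" "J \<subseteq> I" "K \<subseteq> I" "long J x" "long K y"
  shows "length x = length y"
  using braided_3_weight[OF assms, of "\<lambda>_. 1"] by (simp add: sum_list_triv)

text \<open>For commuting involutions the relation of length 3 collapses to their equality in the
  Coxeter group.\<close>

lemma braided_2_3:
  assumes "braided J K 2" "braided J K 3" "J \<subseteq> I" "K \<subseteq> I"
  shows "J = K"
proof -
  let ?x = "lw J" and ?y = "lw K"
  have l: "?x \<in> lists I" "?y \<in> lists I" using assms lw_lists by auto
  have inv: "act (lw A) (act (lw A) v) = v" if "A \<subseteq> I" for A v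
    using act_cong[OF long_rev[OF that long_lw[OF that]], of "act (lw A) v"] lw_lists[OF that] by simp
  have xy: "act ?x (act ?y v) = act ?y (act ?x v)" for v
    using act_cong[OF assms(1)[unfolded braided_2], of v] by simp
  have "act ?x (act ?y (act ?x \<rho>)) = act ?y (act ?x (act ?y \<rho>))"
    using act_cong[OF assms(2)[unfolded braided3D], of \<rho>] by simp
  then have "act ?y \<rho> = act ?x \<rho>" using xy inv assms by metis
  then have "?y \<approx> ?x" using matsumoto long_lw assms longD(2) by blast
  then show ?thesis using lw_braid_iff assms by blast
qed

text \<open>This expresses that conjugation by the longest element induces \<open>f\<close> on the
  generators. One weight suffices, as \<rho> has trivial stabiliser; \<open>long_conj\<close> lifts
  the result to the Artin monoid.\<close>

definition conj_ok :: "(nat \<Rightarrow> nat) \<Rightarrow> bool" where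
  "conj_ok f \<longleftrightarrow> list_all (\<lambda>i. 1 \<le> f i \<and> f i \<le> n \<and>
     lact C \<Delta> (lmove C i (ones C)) = lmove C (f i) (lact C \<Delta> (ones C))) [1..<Suc n]"

lemma top_commute:
  assumes ok: "conj_ok f" and u: "u \<in> lists I" shows "\<Delta> @ u \<approx> map f u @ \<Delta>"
proof (rule commute_lists)
  fix i assume "i \<in> set u"
  then have i: "i \<in> {1..n}" using u by (auto simp: in_lists_conv_set index_eq)
  then have f: "f i \<in> {1..n}" "lact C \<Delta> (lmove C i (ones C)) = lmove C (f i) (lact C \<Delta> (ones C))"
    using ok by (auto simp: conj_ok_def list_all_iff simp del: upt_Suc)
  have D: "\<Delta> \<in> lists {1..n}" using longD(3)[OF long_top] by (simp add: index_eq)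
  have "act \<Delta> (s i \<rho>) = s (f i) (act \<Delta> \<rho>)"
    using i f D act_vec[OF D] s_vec ones_eq by (simp add: rho_vec del: atLeastAtMost_iff)
  then show "f i \<in> I \<and> \<Delta> @ [i] \<approx> f i # \<Delta>"
    using long_conj[OF subset_refl long_top] i f(1) by (simp add: index_eq)
qed (use longD(3)[OF long_top] in simp)

text \<open>If the longest element is central, as in F_4, E_7 and E_8, a pair with one member equal
  to the whole index set commutes and cannot be optimal.\<close>

lemma central_top_braided_2:
  assumes "conj_ok (\<lambda>i. i)" "J \<subseteq> I" shows "braided J I 2"
  using top_commute[OF assms(1), of "lw J"] assms(2) long_lw[OF assms(2)] lw_lists[OF assms(2)] braid_sym
    braided_iff[OF assms(2) subset_refl long_lw[OF assms(2)] long_top, of 2] by simp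

text \<open>\<open>S\<close> lists the exceptional pairs. Equal vertices are exempt because the
  complements of \<open>J\<close> and \<open>K\<close> are disjoint.\<close>

definition covers :: "(nat list \<times> nat list \<times> nat) list \<Rightarrow> (nat \<times> nat) list \<Rightarrow> bool" where
  "covers ts S \<longleftrightarrow> list_all (\<lambda>a. list_all (\<lambda>b. a = b \<or> (a, b) \<in> set S \<or> (b, a) \<in> set S \<or>
     list_ex (\<lambda>(as, bs, d). as = [a] \<and> bs = [b] \<or> as = [b] \<and> bs = [a]) ts) [1..<Suc n]) [1..<Suc n]"

lemma survivors:
  assumes "tests ts" "covers ts S" "J \<union> K = I" "m \<in> {3, 4}" "braided J K m"
    and "a \<in> I - J" "b \<in> I - K"
  shows "(a, b) \<in> set S \<or> (b, a) \<in> set S"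
proof (rule ccontr)
  assume n: "\<not> ?thesis"
  have "a \<in> set [1..<Suc n]" "b \<in> set [1..<Suc n]" using assms(6,7) by (auto simp: index_eq)
  moreover have "a \<noteq> b" using assms(3,6,7) by blast
  ultimately obtain as bs d where t: "(as, bs, d) \<in> set ts"
    "as = [a] \<and> bs = [b] \<or> as = [b] \<and> bs = [a]"
    using assms(2) n unfolding covers_def list_all_iff list_ex_iff by blast
  show False using testsD[OF assms(1) t(1) assms(3-5)] t(2) assms(6,7) by auto
qed

end

subsection \<open>Orthogonal sets and diagram automorphisms\<close>

context numbers_game
begin

lemma orthogonal_cartan:
  assumes "orthogonal_sets M A B" "A \<subseteq> I" "B \<subseteq> I" "a \<in> A" "b \<in> B"
  shows "a \<noteq> b" "c a b = 0" "c b a = 0"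
proof -
  have e: "entry M a b = 2" "a \<in> I" "b \<in> I" using assms by (auto simp: orthogonal_sets_def)
  show n: "a \<noteq> b" using e entry_diag by auto
  show "c a b = 0" "c b a = 0" using bond[OF e(2,3) n] e(1) by auto
qed

lemma orthogonal_sym: "orthogonal_sets M A B \<Longrightarrow> orthogonal_sets M B A"
  unfolding orthogonal_sets_def using entry_sym by metis

lemma orthogonal_commute:
  assumes o: "orthogonal_sets M A B" "A \<subseteq> I" "B \<subseteq> I" and u: "u \<in> lists A" "v \<in> lists B"
  shows "u @ v \<approx> v @ u"
proof -
  have ij: "[i] @ [j] \<approx> [j] @ [i]" if "i \<in> A" "j \<in> B" for i j
  proof -
    have *: "i \<in> I" "j \<in> I" "entry M i j = 2" using o that by (auto simp: orthogonal_sets_def)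
    then show ?thesis using braid_rel[of "[]" i j] orthogonal_cartan(1)[OF o that] by simp
  qed
  have "[i] @ v \<approx> v @ [i]" if i: "i \<in> A" for i
    using u(2)
  proof (induction v)
    case Nil
    then show ?case using o i by (auto intro!: braid_refl)
  next
    case (Cons j v)
    then show ?case using commute_append_right[of "[i]" "[j]" v] ij i by simp
  qed
  then show ?thesis using u(1)
  proof (induction u)
    case Nil
    then show ?case using lists_mono'[OF o(3) u(2)] by (simp add: braid_refl)
  next
    case (Cons i u)
    then show ?case using commute_append_left[of "[i]" v u] by simp
  qed
qed

lemma act_orthogonal:
  assumes "orthogonal_sets M A B" "A \<subseteq> I" "B \<subseteq> I" "a \<in> A" shows "u \<in> lists B \<Longrightarrow> act u v a = v a"
  by (induction u) (use orthogonal_cartan(2)[OF assms(1-4)] in \<open>auto simp: s_def\<close>)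

lemma act_local: "u \<in> lists A \<Longrightarrow> \<forall>a\<in>A. v a = w a \<Longrightarrow> \<forall>a\<in>A. act u v a = act u w a"
  by (induction u) (auto simp: s_def)

lemma long_union:
  assumes o: "orthogonal_sets M A B" "A \<subseteq> I" "B \<subseteq> I" and a: "long A x" and b: "long B y"
  shows "long (A \<union> B) (x @ y)"
proof -
  have l: "x \<in> lists A" "y \<in> lists B" using a b longD by auto
  have y: "act y \<rho> j = \<rho> j" if "j \<in> A" for j by (rule act_orthogonal[OF o that l(2)])
  have "legal (act y \<rho>) x"
    by (rule legal_dominant_mono[OF o(2) _ _ l(1) longD(2)[OF a]]) (use y o(2) rho_pos in auto)
  then have "legal \<rho> (x @ y)" using longD(2)[OF b] by (simp add: legal_append)
  moreover have "act (x @ y) \<rho> j < 0" if "j \<in> A" for j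
    using act_local[OF l(1), of "act y \<rho>" \<rho>] y a that by (simp add: long_def)
  moreover have "act (x @ y) \<rho> j < 0" if "j \<in> B" for j
    using act_orthogonal[OF orthogonal_sym[OF o(1)] o(3,2) that l(1)] b that by (simp add: long_def)
  moreover have "x @ y \<in> lists (A \<union> B)"
    using lists_mono'[of A "A \<union> B" x] lists_mono'[of B "A \<union> B" y] l by auto
  ultimately show ?thesis by (auto simp: long_def)
qed

lemma long_automorphism:
  assumes inv: "\<And>k. f (f k) = k" and c: "\<And>k i. c (f k) (f i) = c k i" and I: "f ` I \<subseteq> I"
    and t: "long J t"
  shows "long (f ` J) (map f t)"
proof -
  have s: "s (f i) (\<lambda>k. v (f k)) = (\<lambda>k. s i v (f k))" for i v
  proof
    fix k
    have "c k (f i) = c (f k) i" using c[of "f k" i] inv by simp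
    then show "s (f i) (\<lambda>k. v (f k)) k = s i v (f k)" by (simp add: s_def inv)
  qed
  have r: "(\<lambda>k. \<rho> (f k)) = \<rho>"
  proof
    fix k show "\<rho> (f k) = \<rho> k" using I inv[of k] by (auto simp: \<rho>_def)
  qed
  have a: "act (map f u) \<rho> = (\<lambda>k. act u \<rho> (f k))" for u
    by (induction u) (simp_all add: r s)
  have "legal \<rho> u \<Longrightarrow> legal \<rho> (map f u)" for u
    using I by (induction u) (auto simp: a inv)
  then show ?thesis using t by (auto simp: long_def a inv in_lists_conv_set)
qed

end

context finite_game
begin

text \<open>The common part B is orthogonal to both differences A and D, which are orthogonal to
  each other. The two longest elements thus factor as \<open>a @ b\<close> and \<open>d @ b\<close>
  with mutually commuting \<open>a\<close>, \<open>b\<close>, \<open>d\<close>.\<close>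

lemma weakly_orthogonal_commute:
  assumes w: "weakly_orthogonal_sets M J K" and JK: "J \<subseteq> I" "K \<subseteq> I" and x: "long J x" and y: "long K y"
  shows "x @ y \<approx> y @ x"
proof -
  define A B D where "A = J - K" and "B = J \<inter> K" and "D = K - J"
  have sub: "A \<subseteq> I" "B \<subseteq> I" "D \<subseteq> I" using JK by (auto simp: A_def B_def D_def)
  have o: "orthogonal_sets M A B" "orthogonal_sets M D B" "orthogonal_sets M A D"
    using w by (auto simp: weakly_orthogonal_sets_def orthogonal_sets_def A_def B_def D_def)
  let ?a = "lw A" and ?b = "lw B" and ?d = "lw D"
  note la = longD(1)[OF long_lw[OF sub(1)]] and lb = longD(1)[OF long_lw[OF sub(2)]]
    and ld = longD(1)[OF long_lw[OF sub(3)]]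
  have "long J (?a @ ?b)" "long K (?d @ ?b)"
  proof -
    have "A \<union> B = J" "D \<union> B = K" by (auto simp: A_def B_def D_def)
    then show "long J (?a @ ?b)" "long K (?d @ ?b)"
      using long_union[OF o(1) sub(1,2) long_lw long_lw] long_union[OF o(2) sub(3,2) long_lw long_lw] sub
      by simp_all
  qed
  then have e: "x \<approx> ?a @ ?b" "y \<approx> ?d @ ?b"
    using long_unique[OF JK(1) _ x] long_unique[OF JK(2) _ y] by blast+
  have bI: "?a \<in> lists I" "?b \<in> lists I" "?d \<in> lists I" using sub lw_lists by auto
  have "(?a @ ?b) @ ?d @ ?b \<approx> (?a @ ?d) @ ?b @ ?b"
    by (rule braid_interchange[OF braid_sym[OF orthogonal_commute[OF o(2) sub(3,2) ld lb]] bI(1,2)])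
  also have "(?a @ ?d) @ ?b @ ?b \<approx> (?d @ ?a) @ ?b @ ?b"
    using bI by (intro braid_append braid_refl orthogonal_commute[OF o(3) sub(1,3) la ld]) auto
  also have "(?d @ ?a) @ ?b @ ?b \<approx> (?d @ ?b) @ ?a @ ?b"
    by (rule braid_sym[OF braid_interchange[OF braid_sym[OF orthogonal_commute[OF o(1) sub(1,2) la lb]] bI(3,2)]])
  finally show ?thesis
    using braid_append[OF e(1) e(2)] braid_append[OF e(2) e(1)] by (meson braid_sym braid_trans)
qed

lemma long_length_less:
  assumes "J \<subseteq> I" "J \<noteq> I" "long J x" shows "length x < length \<Delta>"
proof (rule ccontr)
  assume n: "\<not> ?thesis"
  have "\<Delta> \<approx> x" using long_unique_max[OF subset_refl long_top longD(2)[OF assms(3)] longD(3)[OF assms(3)]]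
      long_length[OF subset_refl long_top longD(2)[OF assms(3)] longD(3)[OF assms(3)]] n braid_sym by simp
  then have "I = J" using set_cong set_long[OF subset_refl long_top] set_long[OF assms(1,3)] by simp
  then show False using assms by simp
qed

context
  fixes f :: "'a \<Rightarrow> 'a"
  assumes f_inv: "\<And>k. f (f k) = k" and f_cartan: "\<And>k i. c (f k) (f i) = c k i" and f_I: "f ` I \<subseteq> I"
    and conj: "\<And>u. u \<in> lists I \<Longrightarrow> \<Delta> @ u \<approx> map f u @ \<Delta>"
    and top_invol: "act \<Delta> \<rho> = (\<lambda>k. - \<rho> k)"
begin

lemma image_long: "long J x \<Longrightarrow> long (f ` J) (map f x)"
  by (rule long_automorphism[OF f_inv f_cartan f_I])

text \<open>Moving \<Delta> across turns the relation into one between \<open>lw J\<close> and its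
  image under \<open>f\<close>, both followed by \<Delta>. As \<Delta> negates \<rho>, it can be
  cancelled on weights, and Matsumoto's theorem together with the sets of letters gives J =
  f(J).\<close>

lemma braided_top_2:
  assumes J: "J \<subseteq> I" shows "braided J I 2 \<longleftrightarrow> f ` J = J"
proof -
  let ?x = "lw J" and ?y = "map f (lw J)"
  note x = long_lw[OF J] and y = image_long[OF long_lw[OF J]]
  note xI = lw_lists[OF J] and yI = longD(3)[OF y]
  have b: "braided J I 2 \<longleftrightarrow> ?x @ \<Delta> \<approx> \<Delta> @ ?x"
    using braided_iff[OF J subset_refl x long_top, of 2] by simp
  have D: "\<Delta> \<in> lists I" using longD(3)[OF long_top] .
  show ?thesis
  proof
    assume "braided J I 2"
    then have "?x @ \<Delta> \<approx> ?y @ \<Delta>" using b conj[OF xI] braid_trans by blast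
    then have "act ?x \<rho> = act ?y \<rho>"
      using act_cong[of "?x @ \<Delta>" "?y @ \<Delta>" \<rho>] by (simp add: top_invol act_uminus fun_eq_iff)
    then have "?x \<approx> ?y" using matsumoto longD(2)[OF x] longD(2)[OF y] by blast
    then have "set ?x = set ?y" by (rule set_cong)
    then show "f ` J = J" using set_long[OF J x] by simp
  next
    assume "f ` J = J"
    then have "?y \<approx> ?x" using long_unique[OF J x] y by simp
    then have "?y @ \<Delta> \<approx> ?x @ \<Delta>" using D by (intro braid_append braid_refl)
    then show "braided J I 2" using b conj[OF xI] braid_trans braid_sym by blast
  qed
qed

text \<open>Collecting both copies of \<Delta> at the end leaves \<open>x @ map f x\<close> on one
  side and \<open>map f x @ x\<close> on the other.\<close>

lemma braided_top_4:
  assumes J: "J \<subseteq> I" and x: "long J x" and comm: "x @ map f x \<approx> map f x @ x"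
  shows "braided J I 4"
proof -
  let ?y = "map f x"
  have xI: "x \<in> lists I" and yI: "?y \<in> lists I" using longD(3)[OF x] longD(3)[OF image_long[OF x]] .
  have D: "\<Delta> \<in> lists I" using longD(3)[OF long_top] .
  have b: "braided J I 4 \<longleftrightarrow> x @ \<Delta> @ x @ \<Delta> \<approx> \<Delta> @ x @ \<Delta> @ x"
    using braided_iff[OF J subset_refl x long_top, of 4] by simp
  have Dx: "\<Delta> @ x \<approx> ?y @ \<Delta>" and Dy: "\<Delta> @ ?y \<approx> x @ \<Delta>"
    using conj[OF xI] conj[OF yI] by (simp_all add: f_inv comp_def)
  have 1: "x @ \<Delta> @ x @ \<Delta> \<approx> x @ ?y @ \<Delta> @ \<Delta>"
    using artin.cong_append_context[OF Dx xI D] by simp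
  have "\<Delta> @ x @ \<Delta> @ x \<approx> ?y @ \<Delta> @ ?y @ \<Delta>" using braid_append[OF Dx Dx] by simp
  also have "?y @ \<Delta> @ ?y @ \<Delta> \<approx> ?y @ x @ \<Delta> @ \<Delta>"
    using artin.cong_append_context[OF Dy yI D] by simp
  finally have 2: "\<Delta> @ x @ \<Delta> @ x \<approx> ?y @ x @ \<Delta> @ \<Delta>" .
  have "(x @ ?y) @ \<Delta> @ \<Delta> \<approx> (?y @ x) @ \<Delta> @ \<Delta>"
    by (rule braid_append[OF comm braid_refl]) (use D in simp)
  then show ?thesis using 1 2 b by simp (meson braid_sym braid_trans)
qed

end

end

context finite_matrix_game
begin

lemma small_not_braided:
  assumes "small_ok C f (length \<Delta>) js ks" "set js \<union> set ks = I"
    and "\<And>i j. i \<in> I \<Longrightarrow> j \<in> I \<Longrightarrow> entry M i j = 3 \<Longrightarrow> f i = f j"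
    and "0 < k" "k < 4"
  shows "\<not> braided (set js) (set ks) k"
proof -
  let ?x = "word_of C js" and ?y = "word_of C ks"
  note ok = assms(1)[unfolded small_ok_def]
  have sub: "set js \<subseteq> I" "set ks \<subseteq> I" and l: "long (set js) ?x" "long (set ks) ?y"
    using ok long_okD by blast+
  have 3: "\<not> braided (set js) (set ks) 3" using braided_3_weight[OF _ sub l, of f] ok assms(3) by blast
  have 2: "\<not> braided (set js) (set ks) 2" using braided_2_length[OF _ assms(2) l] ok by auto
  \<comment> \<open>Equal longest elements would satisfy the relation of length 3 trivially.\<close>
  have "\<not> braided (set js) (set ks) (Suc 0)"
    using 3 braided_1[OF sub] lw_lists[OF sub(1)] by (auto simp: braided_def braid_refl)
  moreover have "k = Suc 0 \<or> k = 2 \<or> k = 3" using assms(4,5) by auto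
  ultimately show ?thesis using 2 3 by auto
qed

lemma not_braided_3_length:
  assumes "long_ok C js x" "long_ok C ks y" "length x \<noteq> length y"
  shows "\<not> braided (set js) (set ks) 3"
  using braided_3_length[of "set js" "set ks" x y] assms long_okD by blast

lemma not_braided_4_act:
  assumes "long_ok C js x" "long_ok C ks y" "\<not> same_ok C (x @ y @ x @ y) (y @ x @ y @ x)"
  shows "\<not> braided (set js) (set ks) 4"
  using braid_same[of "x @ y @ x @ y" "y @ x @ y @ x"] assms long_okD
    braided_iff[of "set js" "set ks" x y 4] by auto

lemma proper_if_central:
  assumes "conj_ok (\<lambda>i. i)" "J \<union> K = I" "\<not> braided J K 2"
  obtains a b where "a \<in> I - J" "b \<in> I - K"
proof -
  have "J \<noteq> I" "K \<noteq> I"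
    using central_top_braided_2[OF assms(1), of J] central_top_braided_2[OF assms(1), of K] assms(2,3)
      braided_sym by (metis Un_upper1 Un_upper2)+
  then show thesis using that assms(2) by blast
qed

text \<open>Any vertex missing from \<open>J\<close> forms a surviving pair with any vertex missing
  from \<open>K\<close>; if there is only one such pair, both complements are singletons.\<close>

lemma unique_survivor:
  assumes "tests ts" "covers ts [(p, q)]" "conj_ok (\<lambda>i. i)"
    and "J \<union> K = I" "m \<in> {3, 4}" "braided J K m" "\<not> braided J K 2"
  shows "J = I - {p} \<and> K = I - {q} \<or> J = I - {q} \<and> K = I - {p}"
proof -
  obtain a b where ab: "a \<in> I - J" "b \<in> I - K" by (rule proper_if_central[OF assms(3,4,7)])
  note S = survivors[OF assms(1,2,4,5,6)]
  have S': "a' = p \<and> b' = q \<or> a' = q \<and> b' = p" if "a' \<in> I - J" "b' \<in> I - K" for a' b'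
    using S[OF that] by auto
  have "p \<noteq> q" using S'[OF ab] ab assms(4) by blast
  then have "I - J = {a}" "I - K = {b}" using S' ab by blast+
  then have "J = I - {a}" "K = I - {b}" using assms(4) by blast+
  then show ?thesis using S'[OF ab] by blast
qed

end

subsection \<open>The homomorphisms\<close>

lemma index_minus:
  "{1..4} - {4} = {1, 2, 3 :: nat}" "{1..6} - {5} = {1, 2, 3, 4, 6 :: nat}"
  "{1..7} - {5, 6} = {1, 2, 3, 4, 7 :: nat}" "{1..8} - {7} = {1, 2, 3, 4, 5, 6, 8 :: nat}"
  by auto

lemma index_minus_1:
  "index F4_mat - {1} = {2, 3, 4}" "index (E_mat 6) - {1} = {2, 3, 4, 5, 6}"
  "index (E_mat 7) - {1} = {2, 3, 4, 5, 6, 7}" "index (E_mat 8) - {1} = {2, 3, 4, 5, 6, 7, 8}"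
  by (auto simp: F4_index E_mat_index)

lemma E7_K: "{1, 2, 3, 4, 7} \<union> {6} = {1, 2, 3, 4, 6, 7 :: nat}"
  by auto

context finite_game
begin

lemma standard_hom_exists:
  assumes "J \<subseteq> I" "K \<subseteq> I" "braided J K m"
  shows "\<exists>\<Phi>. hom_given_by m M \<Phi> (T J) (T K) \<and> standard m M \<Phi>"
  using hom_exists[OF assms] hom_standard[OF assms(1,2)] by blast

end

lemma F4_hom_ok: "computed_hom_ok F4_roots [2, 3] [1, 2, 3] [2, 3, 4] [] 4"
  by code_simp

lemmas F4_hom = F4.hom_ok_consequences[OF F4_hom_ok[unfolded computed_hom_ok_def]]

lemma F4_Phi: "\<exists>\<Phi>. is_Phi 4 F4_mat {1, 2, 3} \<Phi> \<and> coxeter_type 4 F4_mat \<Phi>"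
  unfolding is_Phi_def Let_def index_minus_1 using F4_hom(1) by (simp add: insert_commute)

lemma F4_braided: "F4.braided {1, 2, 3} {2, 3, 4} 4"
  using F4_hom(2) by simp

lemma F4_hat_Phi: "\<exists>\<Phi>. is_hat_Phi 4 F4_mat {1, 2, 3} {} \<Phi> \<and> standard 4 F4_mat \<Phi>"
  unfolding is_hat_Phi_def Let_def index_minus_1 Un_empty_right
  by (rule F4.standard_hom_exists[OF _ _ F4_braided]) (auto simp: F4_index)

lemma E6_hom_ok: "computed_hom_ok E6_roots [2, 3, 4, 6] [1, 2, 3, 4, 6] [2, 3, 4, 5, 6] [] 3"
  by code_simp

lemmas E6_hom = E6.hom_ok_consequences[OF E6_hom_ok[unfolded computed_hom_ok_def]]

lemma E6_Phi: "\<exists>\<Phi>. is_Phi 3 (E_mat 6) {1, 2, 3, 4, 6} \<Phi> \<and> coxeter_type 3 (E_mat 6) \<Phi>"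
  unfolding is_Phi_def Let_def index_minus_1 using E6_hom(1) by (simp add: insert_commute)

lemma E6_braided: "E6.braided {1, 2, 3, 4, 6} {2, 3, 4, 5, 6} 3"
  using E6_hom(2) by simp

lemma E6_hat_Phi: "\<exists>\<Phi>. is_hat_Phi 3 (E_mat 6) {1, 2, 3, 4, 6} {} \<Phi> \<and> standard 3 (E_mat 6) \<Phi>"
  unfolding is_hat_Phi_def Let_def index_minus_1 Un_empty_right
  by (rule E6.standard_hom_exists[OF _ _ E6_braided]) (auto simp: E_mat_index)

lemma E7_hom_ok: "computed_hom_ok E7_roots [2, 3, 4, 7] [1, 2, 3, 4, 7] [2, 3, 4, 5, 6, 7] [6] 4"
  by code_simp

lemmas E7_hom = E7.hom_ok_consequences[OF E7_hom_ok[unfolded computed_hom_ok_def]]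

lemma E7_Phi: "\<exists>\<Phi>. is_Phi 4 (E_mat 7) {1, 2, 3, 4, 7} \<Phi> \<and> coxeter_type 4 (E_mat 7) \<Phi>"
  unfolding is_Phi_def Let_def index_minus_1 using E7_hom(1) by (simp add: insert_commute)

lemma E7_braided: "E7.braided {1, 2, 3, 4, 7} {2, 3, 4, 5, 6, 7} 4"
  using E7_hom(2) by simp

lemma E8_hom_ok: "computed_hom_ok E8_roots [2, 3, 4, 5, 6, 8] [1, 2, 3, 4, 5, 6, 8] [2, 3, 4, 5, 6, 7, 8] [] 4"
  by code_simp

lemmas E8_hom = E8.hom_ok_consequences[OF E8_hom_ok[unfolded computed_hom_ok_def]]

lemma E8_Phi: "\<exists>\<Phi>. is_Phi 4 (E_mat 8) {1, 2, 3, 4, 5, 6, 8} \<Phi> \<and> coxeter_type 4 (E_mat 8) \<Phi>"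
  unfolding is_Phi_def Let_def index_minus_1 using E8_hom(1) by (simp add: insert_commute)

lemma E8_braided: "E8.braided {1, 2, 3, 4, 5, 6, 8} {2, 3, 4, 5, 6, 7, 8} 4"
  using E8_hom(2) by simp

lemma E8_hat_Phi: "\<exists>\<Phi>. is_hat_Phi 4 (E_mat 8) {1, 2, 3, 4, 5, 6, 8} {} \<Phi> \<and> standard 4 (E_mat 8) \<Phi>"
  unfolding is_hat_Phi_def Let_def index_minus_1 Un_empty_right
  by (rule E8.standard_hom_exists[OF _ _ E8_braided]) (auto simp: E_mat_index)

lemma E7_braided_6: "E7.braided {1, 2, 3, 4, 6, 7} {2, 3, 4, 5, 6, 7} 4"
proof -
  \<comment> \<open>Vertex 6 is orthogonal to the other vertices of this set, so inserting the
    letter 6 gives a word of its longest element.\<close>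
  have "long_ok E7_roots [1, 2, 3, 4, 6, 7] (word_of E7_roots [2, 3, 4, 7] @ [6] @
      lword E7_roots 64 [1, 2, 3, 4, 7] (lact E7_roots (word_of E7_roots [2, 3, 4, 7]) (ones E7_roots)))"
    by code_simp
  from E7_hom(3)[OF _ _ this] show ?thesis by simp
qed

lemma E7_hat_Phi:
  assumes "K \<in> {{}, {6}}"
  shows "\<exists>\<Phi>. is_hat_Phi 4 (E_mat 7) {1, 2, 3, 4, 7} K \<Phi> \<and> standard 4 (E_mat 7) \<Phi>"
proof -
  consider "K = {}" | "K = {6}" using assms by blast
  then show ?thesis
  proof cases
    case 1
    then show ?thesis unfolding is_hat_Phi_def Let_def index_minus_1 1 Un_empty_right
      by (intro E7.standard_hom_exists[OF _ _ E7_braided]) (auto simp: E_mat_index)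
  next
    case 2
    then show ?thesis unfolding is_hat_Phi_def Let_def index_minus_1 2 E7_K
      by (intro E7.standard_hom_exists[OF _ _ E7_braided_6]) (auto simp: E_mat_index)
  qed
qed

lemma matrices_distinct:
  "F4_mat \<noteq> E_mat 6" "F4_mat \<noteq> E_mat 7" "F4_mat \<noteq> E_mat 8" "E_mat 6 \<noteq> E_mat 7" "E_mat 6 \<noteq> E_mat 8"
  "E_mat 7 \<noteq> E_mat 8"
proof -
  have "index F4_mat \<noteq> index (E_mat 6)" "index F4_mat \<noteq> index (E_mat 7)" "index F4_mat \<noteq> index (E_mat 8)"
    "index (E_mat 6) \<noteq> index (E_mat 7)" "index (E_mat 6) \<noteq> index (E_mat 8)"
    "index (E_mat 7) \<noteq> index (E_mat 8)" by (auto simp: F4_index E_mat_index Icc_eq_Icc)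
  then show "F4_mat \<noteq> E_mat 6" "F4_mat \<noteq> E_mat 7" "F4_mat \<noteq> E_mat 8" "E_mat 6 \<noteq> E_mat 7" "E_mat 6 \<noteq> E_mat 8"
    "E_mat 7 \<noteq> E_mat 8" by metis+
qed

lemmas matrices_neq = matrices_distinct matrices_distinct[symmetric]

definition unfolding_word :: "nat \<Rightarrow> nat list" where
  "unfolding_word i = (if i = 1 then [1, 5] else if i = 2 then [2, 4] else if i = 3 then [3] else [6])"

lemma unfolding_exists: "\<exists>\<upsilon>. is_unfolding \<upsilon>"
proof -
  have lists: "unfolding_word i \<in> lists (index (E_mat 6))" for i
    by (auto simp: unfolding_word_def E_mat_index)
  \<comment> \<open>The bonds are recovered from products of Cartan entries so that the check can be
    evaluated; \<open>F4.bonds\<close> identifies them with the entries of the Coxeter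
    matrix.\<close>
  define bond where "bond i j = (if F4_roots ! (i - 1) ! (j - 1) = 0 then 2
      else if F4_roots ! (i - 1) ! (j - 1) * F4_roots ! (j - 1) ! (i - 1) = 1 then 3 else 4 :: nat)" for i j
  have "list_all (\<lambda>i. list_all (\<lambda>j. i = j \<or>
      braid_ok E6_roots (concat (alternating (unfolding_word i) (unfolding_word j) (bond i j)))
        (concat (alternating (unfolding_word j) (unfolding_word i) (bond i j)))) [1, 2, 3, 4]) [1, 2, 3, 4]"
    unfolding bond_def by code_simp
  note check = this[unfolded list_all_iff, THEN bspec, THEN bspec]
  have "(concat (alternating (unfolding_word i) (unfolding_word j) (entry F4_mat i j)),
      concat (alternating (unfolding_word j) (unfolding_word i) (entry F4_mat i j))) \<in> artin_cong (E_mat 6)"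
    if "i \<in> index F4_mat" "j \<in> index F4_mat" "i \<noteq> j" for i j
  proof -
    have ij: "i \<in> {1..4}" "j \<in> {1..4}" using that by (simp_all only: F4_index)
    have "entry F4_mat i j = bond i j" using F4.bonds[OF ij that(3)] by (auto simp: bond_def)
    moreover have "i \<in> set [1, 2, 3, 4]" "j \<in> set [1, 2, 3, 4]" using ij by auto
    ultimately show ?thesis using check[of i j] that(3) E6.braid_okD by simp
  qed
  then obtain \<upsilon> where "\<upsilon> \<in> monoid_homs (artin_monoid F4_mat) (artin_monoid (E_mat 6))"
    "\<And>i. i \<in> index F4_mat \<Longrightarrow> \<upsilon> (artin_gen F4_mat i) = artin_elem (E_mat 6) (unfolding_word i)"
    using artin_hom_exists[of F4_mat unfolding_word "E_mat 6"] lists by metis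
  then have "is_unfolding \<upsilon>" by (simp add: is_unfolding_def F4_index unfolding_word_def)
  then show ?thesis by blast
qed

text \<open>A homomorphism is determined on an element by any word for it, so it is enough to unfold
  one reduced word and to check that the result is again one of a longest element: {1,2,3} unfolds
  to type A_5 and {2,3,4} to D_4.\<close>

lemma unfolding_longest:
  assumes "is_unfolding \<upsilon>"
  shows "\<upsilon> (F4.T {1, 2, 3}) = E6.T {1, 2, 3, 4, 5}" "\<upsilon> (F4.T {2, 3, 4}) = E6.T {2, 3, 4, 6}"
proof -
  have gens: "\<upsilon> (artin_gen F4_mat i) = artin_elem (E_mat 6) (unfolding_word i)" if "i \<in> index F4_mat" for i
    using that assms unfolding F4_index atLeastAtMost_4 by (auto simp: is_unfolding_def unfolding_word_def)
  have lists: "unfolding_word i \<in> lists (index (E_mat 6))" for i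
    by (auto simp: unfolding_word_def E_mat_index)
  have key: "\<upsilon> (F4.T (set js)) = E6.T (set ks)"
    if "long_ok F4_roots js w" "long_ok E6_roots ks (concat (map unfolding_word w))" for js ks w
  proof -
    note F = F4.long_okD[OF that(1)] and E = E6.long_okD[OF that(2)]
    have "\<upsilon> (artin_elem F4_mat w) = artin_elem (E_mat 6) (concat (map unfolding_word w))"
      using artin_hom_word[of \<upsilon> F4_mat "E_mat 6" unfolding_word w] assms lists gens
        F4.longD(3)[of "set js" w] F by (auto simp: is_unfolding_def)
    then show ?thesis using F4.artin_lift_longest[of "set js" w] E6.artin_lift_longest[of "set ks" "concat (map unfolding_word w)"] F E by simp
  qed
  have "long_ok F4_roots [1, 2, 3] (word_of F4_roots [1, 2, 3])"
    "long_ok E6_roots [1, 2, 3, 4, 5] (concat (map unfolding_word (word_of F4_roots [1, 2, 3])))"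
    "long_ok F4_roots [2, 3, 4] (word_of F4_roots [2, 3, 4])"
    "long_ok E6_roots [2, 3, 4, 6] (concat (map unfolding_word (word_of F4_roots [2, 3, 4])))"
    by code_simp+
  from key[OF this(1,2)] key[OF this(3,4)]
  show "\<upsilon> (F4.T {1, 2, 3}) = E6.T {1, 2, 3, 4, 5}" "\<upsilon> (F4.T {2, 3, 4}) = E6.T {2, 3, 4, 6}" by simp_all
qed

lemma artin_gen_carrier: "i \<in> index N \<Longrightarrow> artin_gen N i \<in> carrier (artin_monoid N)"
  unfolding artin_elem_def by (rule artin.cls_in_carrier) simp

text \<open>Outside the carrier the functions are arbitrary, so the composite is compared with
  \<open>\<Psi>\<close> on the carrier only; there both are determined by the two
  generators.\<close>

lemma unfolded_iff:
  assumes \<Psi>: "\<Psi> \<in> dihedral_homs 4 (E_mat 6)"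
  shows "(\<exists>\<upsilon> \<Phi>0. is_unfolding \<upsilon> \<and> is_hat_Phi 4 F4_mat ({1..4} - {4}) {} \<Phi>0
      \<and> (\<forall>X \<in> carrier (artin_monoid (I2_mat 4)). \<Psi> X = \<upsilon> (\<Phi>0 X))) \<longleftrightarrow>
    hom_given_by 4 (E_mat 6) \<Psi> (E6.T {1, 2, 3, 4, 5}) (E6.T {2, 3, 4, 6})"
  unfolding index_minus
proof
  assume "\<exists>\<upsilon> \<Phi>0. is_unfolding \<upsilon> \<and> is_hat_Phi 4 F4_mat {1, 2, 3} {} \<Phi>0
      \<and> (\<forall>X \<in> carrier (artin_monoid (I2_mat 4)). \<Psi> X = \<upsilon> (\<Phi>0 X))"
  then obtain \<upsilon> \<Phi>0 where u: "is_unfolding \<upsilon>" "is_hat_Phi 4 F4_mat {1, 2, 3} {} \<Phi>0"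
      "\<And>X. X \<in> carrier (artin_monoid (I2_mat 4)) \<Longrightarrow> \<Psi> X = \<upsilon> (\<Phi>0 X)" by blast
  then show "hom_given_by 4 (E_mat 6) \<Psi> (E6.T {1, 2, 3, 4, 5}) (E6.T {2, 3, 4, 6})"
    using \<Psi> unfolding_longest[OF u(1)] artin_gen_carrier[of 1 "I2_mat 4"] artin_gen_carrier[of 2 "I2_mat 4"]
    unfolding is_hat_Phi_def Let_def index_minus_1 Un_empty_right hom_given_by_def by simp
next
  assume h: "hom_given_by 4 (E_mat 6) \<Psi> (E6.T {1, 2, 3, 4, 5}) (E6.T {2, 3, 4, 6})"
  obtain \<upsilon> where u: "is_unfolding \<upsilon>" using unfolding_exists by blast
  obtain \<Phi>0 where \<Phi>0: "is_hat_Phi 4 F4_mat {1, 2, 3} {} \<Phi>0" using F4_hat_Phi by blast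
  then have g: "hom_given_by 4 F4_mat \<Phi>0 (F4.T {1, 2, 3}) (F4.T {2, 3, 4})"
    unfolding is_hat_Phi_def Let_def index_minus_1 Un_empty_right .
  have "\<Psi> X = (\<upsilon> \<circ> \<Phi>0) X" if "X \<in> carrier (artin_monoid (I2_mat 4))" for X
  proof (rule artin_homs_eq[OF \<Psi> _ _ that])
    show "\<upsilon> \<circ> \<Phi>0 \<in> dihedral_homs 4 (E_mat 6)"
      using g u by (intro monoid_homs_comp) (auto simp: hom_given_by_def is_unfolding_def)
    show "\<Psi> (artin_gen (I2_mat 4) i) = (\<upsilon> \<circ> \<Phi>0) (artin_gen (I2_mat 4) i)" if "i \<in> index (I2_mat 4)" for i
      using that g h unfolding_longest[OF u] by (auto simp: hom_given_by_def)
  qed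
  then show "\<exists>\<upsilon> \<Phi>0. is_unfolding \<upsilon> \<and> is_hat_Phi 4 F4_mat {1, 2, 3} {} \<Phi>0
      \<and> (\<forall>X \<in> carrier (artin_monoid (I2_mat 4)). \<Psi> X = \<upsilon> (\<Phi>0 X))"
    using u \<Phi>0 by (intro exI[of _ \<upsilon>] exI[of _ \<Phi>0]) simp
qed

lemma hom_data_iff:
  "(3, F4_mat, J) \<notin> hom_data" "(4, F4_mat, J) \<in> hom_data \<longleftrightarrow> J = {1, 2, 3}"
  "(3, E_mat 6, J) \<in> hom_data \<longleftrightarrow> J = {1, 2, 3, 4, 6}" "(4, E_mat 6, J) \<notin> hom_data"
  "(3, E_mat 7, J) \<notin> hom_data" "(4, E_mat 7, J) \<in> hom_data \<longleftrightarrow> J = {1, 2, 3, 4, 7}"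
  "(3, E_mat 8, J) \<notin> hom_data" "(4, E_mat 8, J) \<in> hom_data \<longleftrightarrow> J = {1, 2, 3, 4, 5, 6, 8}"
  unfolding hom_data_def index_minus by (simp_all add: matrices_neq)

lemma listed_iff:
  "\<not> listed 3 F4_mat \<Psi>" "\<not> listed 3 (E_mat 7) \<Psi>" "\<not> listed 3 (E_mat 8) \<Psi>"
  "listed 4 F4_mat \<Psi> \<longleftrightarrow> hom_given_by 4 F4_mat \<Psi> (F4.T {1, 2, 3}) (F4.T {2, 3, 4})"
  "listed 3 (E_mat 6) \<Psi> \<longleftrightarrow> hom_given_by 3 (E_mat 6) \<Psi> (E6.T {1, 2, 3, 4, 6}) (E6.T {2, 3, 4, 5, 6})"
  "listed 4 (E_mat 7) \<Psi> \<longleftrightarrow> hom_given_by 4 (E_mat 7) \<Psi> (E7.T {1, 2, 3, 4, 7}) (E7.T {2, 3, 4, 5, 6, 7})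
    \<or> hom_given_by 4 (E_mat 7) \<Psi> (E7.T {1, 2, 3, 4, 6, 7}) (E7.T {2, 3, 4, 5, 6, 7})"
  "listed 4 (E_mat 8) \<Psi> \<longleftrightarrow>
    hom_given_by 4 (E_mat 8) \<Psi> (E8.T {1, 2, 3, 4, 5, 6, 8}) (E8.T {2, 3, 4, 5, 6, 7, 8})"
  unfolding listed_def hom_data_iff K_choices_def is_hat_Phi_def Let_def index_minus_1
  by (simp_all add: hom_data_iff matrices_neq insert_commute conj_disj_distribR ex_disj_distrib)

lemma listed_iff_E6:
  assumes "\<Psi> \<in> dihedral_homs 4 (E_mat 6)"
  shows "listed 4 (E_mat 6) \<Psi> \<longleftrightarrow> hom_given_by 4 (E_mat 6) \<Psi> (E6.T {1, 2, 3, 4, 5}) (E6.T {2, 3, 4, 6})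
    \<or> (\<exists>J \<in> E6_choices. hom_given_by 4 (E_mat 6) \<Psi> (E6.T J) (E6.T {1..6}))"
  unfolding listed_def hom_data_iff unfolded_iff[OF assms] is_E6_hom_def by (simp add: hom_data_iff)

subsection \<open>The classification\<close>

lemma index_minus_others:
  "F4.I - {4} = {1, 2, 3}"
  "E6.I - {5} = {1, 2, 3, 4, 6}" "E6.I - {6} = {1, 2, 3, 4, 5}" "E6.I - {1, 5} = {2, 3, 4, 6}"
  "E7.I - {5} = {1, 2, 3, 4, 6, 7}" "E7.I - {6} = {1, 2, 3, 4, 5, 7}" "E7.I - {5, 6} = {1, 2, 3, 4, 7}"
  "E8.I - {7} = {1, 2, 3, 4, 5, 6, 8}"
  by (auto simp: F4_index E_mat_index)

lemmas index_minus_I = index_minus_1 index_minus_others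

lemma F4_conj: "F4.conj_ok (\<lambda>i. i)" unfolding F4.conj_ok_def by code_simp
lemma E7_conj: "E7.conj_ok (\<lambda>i. i)" unfolding E7.conj_ok_def by code_simp
lemma E8_conj: "E8.conj_ok (\<lambda>i. i)" unfolding E8.conj_ok_def by code_simp

lemma F4_covers: "F4.covers F4_tests [(1, 4)]" unfolding F4.covers_def by code_simp
lemma E6_covers: "E6.covers E6_tests [(1, 5), (1, 6), (5, 6)]" unfolding E6.covers_def by code_simp
lemma E7_covers: "E7.covers E7_tests [(1, 5), (1, 6)]" unfolding E7.covers_def by code_simp
lemma E8_covers: "E8.covers E8_tests [(1, 7)]" unfolding E8.covers_def by code_simp

subsubsection \<open>Type \<open>F\<^sub>4\<close>\<close>

text \<open>The two parabolic subgroups have types \<open>B\<^sub>3\<close> and \<open>C\<^sub>3\<close>, so only the number of letters \<open>1\<close> and \<open>2\<close>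
  distinguishes their longest elements.\<close>

lemma F4_small:
  assumes "0 < k" "k < 4" shows "\<not> F4.braided {1, 2, 3} {2, 3, 4} k"
proof -
  have "small_ok F4_roots (\<lambda>i. if i \<le> 2 then 1 else 0) (length F4_top) [1, 2, 3] [2, 3, 4]" by code_simp
  then have "\<not> F4.braided (set [1, 2, 3]) (set [2, 3, 4]) k"
    by (rule F4.small_not_braided) (use assms in \<open>auto simp: F4_index F4_entry split: if_splits\<close>)
  then show ?thesis by simp
qed

lemma F4_complete:
  assumes "J \<union> K = F4.I" "m \<in> {3, 4}" "F4.braided J K m" "\<not> F4.braided J K 2"
  shows "m = 4 \<and> ((J, K) = ({1, 2, 3}, {2, 3, 4}) \<or> (K, J) = ({1, 2, 3}, {2, 3, 4}))"
proof -
  have "J = {2, 3, 4} \<and> K = {1, 2, 3} \<or> J = {1, 2, 3} \<and> K = {2, 3, 4}"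
    using F4.unique_survivor[OF F4_tests F4_covers F4_conj assms] unfolding index_minus_I .
  then show ?thesis using F4_small[of 3] F4.braided_sym[of J K m] assms(2,3) by auto
qed

subsubsection \<open>Type \<open>E\<^sub>8\<close>\<close>

text \<open>The parabolic subgroups have types E_7 and D_7 with 63 and 42 positive roots: the
  numbers differ, and their sum is below 120.\<close>

lemma E8_small:
  assumes "0 < k" "k < 4" shows "\<not> E8.braided {1, 2, 3, 4, 5, 6, 8} {2, 3, 4, 5, 6, 7, 8} k"
proof -
  have "small_ok E8_roots (\<lambda>_. 1) (length E8_top) [1, 2, 3, 4, 5, 6, 8] [2, 3, 4, 5, 6, 7, 8]" by code_simp
  then have "\<not> E8.braided (set [1, 2, 3, 4, 5, 6, 8]) (set [2, 3, 4, 5, 6, 7, 8]) k"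
    by (rule E8.small_not_braided) (use assms in \<open>auto simp: E_mat_index\<close>)
  then show ?thesis by simp
qed

lemma E8_complete:
  assumes "J \<union> K = E8.I" "m \<in> {3, 4}" "E8.braided J K m" "\<not> E8.braided J K 2"
  shows "m = 4 \<and> ((J, K) = ({1, 2, 3, 4, 5, 6, 8}, {2, 3, 4, 5, 6, 7, 8}) \<or>
    (K, J) = ({1, 2, 3, 4, 5, 6, 8}, {2, 3, 4, 5, 6, 7, 8}))"
proof -
  have "J = {2, 3, 4, 5, 6, 7, 8} \<and> K = {1, 2, 3, 4, 5, 6, 8} \<or>
      J = {1, 2, 3, 4, 5, 6, 8} \<and> K = {2, 3, 4, 5, 6, 7, 8}"
    using E8.unique_survivor[OF E8_tests E8_covers E8_conj assms] unfolding index_minus_I .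
  then show ?thesis using E8_small[of 3] E8.braided_sym[of J K m] assms(2,3) by auto
qed

subsubsection \<open>Type \<open>E\<^sub>7\<close>\<close>

text \<open>Types D_5 and D_6 have 20 and 30 positive roots, against 63 for E_7. With vertex 6 added
  in \<open>E7_small_6\<close>, 20 becomes 21.\<close>

lemma E7_small:
  assumes "0 < k" "k < 4" shows "\<not> E7.braided {1, 2, 3, 4, 7} {2, 3, 4, 5, 6, 7} k"
proof -
  have "small_ok E7_roots (\<lambda>_. 1) (length E7_top) [1, 2, 3, 4, 7] [2, 3, 4, 5, 6, 7]" by code_simp
  then have "\<not> E7.braided (set [1, 2, 3, 4, 7]) (set [2, 3, 4, 5, 6, 7]) k"
    by (rule E7.small_not_braided) (use assms in \<open>auto simp: E_mat_index\<close>)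
  then show ?thesis by simp
qed

lemma E7_small_6:
  assumes "0 < k" "k < 4" shows "\<not> E7.braided {1, 2, 3, 4, 6, 7} {2, 3, 4, 5, 6, 7} k"
proof -
  have "small_ok E7_roots (\<lambda>_. 1) (length E7_top) [1, 2, 3, 4, 6, 7] [2, 3, 4, 5, 6, 7]" by code_simp
  then have "\<not> E7.braided (set [1, 2, 3, 4, 6, 7]) (set [2, 3, 4, 5, 6, 7]) k"
    by (rule E7.small_not_braided) (use assms in \<open>auto simp: E_mat_index\<close>)
  then show ?thesis by simp
qed

text \<open>For the subsets \<open>I - {1}\<close> and \<open>I - {6}\<close> the braid relation of length \<open>4\<close> holds both in the Coxeter group
  and in the 0-Hecke monoid. A reduced Burau representation at \<open>q = 2\<close> shows that it fails in the Artin monoid.\<close>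

definition E7_burau :: "int list list" where
  "E7_burau = [[3, -2, 0, 0, 0, 0, 0], [-1, 3, -2, 0, 0, 0, 0], [0, -1, 3, -2, 0, 0, -2],
    [0, 0, -1, 3, -2, 0, 0], [0, 0, 0, -1, 3, -2, 0], [0, 0, 0, 0, -1, 3, 0], [0, 0, -1, 0, 0, 0, 3]]"

lemma E7_burau_lmove:
  "lmove E7_burau (Suc 0) [a, b, c, d, e, f, g] = [- 2 * a, b + 2 * a, c, d, e, f, g]"
  "lmove E7_burau 2 [a, b, c, d, e, f, g] = [a + b, - 2 * b, c + 2 * b, d, e, f, g]"
  "lmove E7_burau 3 [a, b, c, d, e, f, g] = [a, b + c, - 2 * c, d + 2 * c, e, f, g + 2 * c]"
  "lmove E7_burau 4 [a, b, c, d, e, f, g] = [a, b, c + d, - 2 * d, e + 2 * d, f, g]"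
  "lmove E7_burau 5 [a, b, c, d, e, f, g] = [a, b, c, d + e, - 2 * e, f + 2 * e, g]"
  "lmove E7_burau 6 [a, b, c, d, e, f, g] = [a, b, c, d, e + f, - 2 * f, g]"
  "lmove E7_burau 7 [a, b, c, d, e, f, g] = [a, b, c + g, d, e, f, - 2 * g]"
  by (simp_all add: lmove_def E7_burau_def)

lemma E7_burau_relations:
  assumes "i \<in> {1, 2, 3, 4, 5, 6, 7}" "j \<in> {1, 2, 3, 4, 5, 6, 7}" "i \<noteq> j"
  shows "lact E7_burau (alternating i j (entry (E_mat 7) i j)) [a, b, c, d, e, f, g] =
    lact E7_burau (alternating j i (entry (E_mat 7) i j)) [a, b, c, d, e, f, g]"
  using assms unfolding insert_iff empty_iff
  by (elim disjE FalseE; simp add: E_mat_entry E7_burau_lmove)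

lemma E7_burau_cong:
  "(t, u) \<in> artin_cong (E_mat 7) \<Longrightarrow> length xs = 7 \<Longrightarrow> lact E7_burau t xs = lact E7_burau u xs"
proof (rule E7.lact_cong)
  fix i j :: nat and xs :: "int list"
  assume ij: "i \<in> E7.I" "j \<in> E7.I" "i \<noteq> j" and xs: "length xs = 7"
  obtain a b c d e f g where v: "xs = [a, b, c, d, e, f, g]"
    using xs by (auto simp: length_Suc_conv eval_nat_numeral)
  show "lact E7_burau (alternating i j (entry (E_mat 7) i j)) xs =
      lact E7_burau (alternating j i (entry (E_mat 7) i j)) xs"
    unfolding v using ij unfolding E_mat_index atLeastAtMost_7 by (rule E7_burau_relations)
qed (simp_all add: E7_burau_def)

lemma E7_no_braid: "\<not> E7.braided {2, 3, 4, 5, 6, 7} {1, 2, 3, 4, 5, 7} 4"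
proof
  let ?x = "word_of E7_roots [2, 3, 4, 5, 6, 7]" and ?y = "word_of E7_roots [1, 2, 3, 4, 5, 7]"
  assume b: "E7.braided {2, 3, 4, 5, 6, 7} {1, 2, 3, 4, 5, 7} 4"
  have "long_ok E7_roots [2, 3, 4, 5, 6, 7] ?x" "long_ok E7_roots [1, 2, 3, 4, 5, 7] ?y" by code_simp+
  then have "(?x @ ?y @ ?x @ ?y, ?y @ ?x @ ?y @ ?x) \<in> artin_cong (E_mat 7)"
    using E7.long_okD[of "[2, 3, 4, 5, 6, 7]" ?x] E7.long_okD[of "[1, 2, 3, 4, 5, 7]" ?y] b
      E7.braided_iff[of "{2, 3, 4, 5, 6, 7}" "{1, 2, 3, 4, 5, 7}" ?x ?y 4] by simp
  then have "lact E7_burau (?x @ ?y @ ?x @ ?y) [1, 0, 0, 0, 0, 0, 0] =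
      lact E7_burau (?y @ ?x @ ?y @ ?x) [1, 0, 0, 0, 0, 0, 0]"
    using E7_burau_cong by simp
  moreover have "lact E7_burau (?x @ ?y @ ?x @ ?y) [1, 0, 0, 0, 0, 0, 0] \<noteq>
      lact E7_burau (?y @ ?x @ ?y @ ?x) [1, 0, 0, 0, 0, 0, 0]" by code_simp
  ultimately show False by simp
qed

text \<open>Types D_6 and E_6, with 30 and 36 positive roots.\<close>

lemma E7_no_braid_3: "\<not> E7.braided {2, 3, 4, 5, 6, 7} {1, 2, 3, 4, 5, 7} 3"
proof -
  have "long_ok E7_roots [2, 3, 4, 5, 6, 7] (word_of E7_roots [2, 3, 4, 5, 6, 7])"
    "long_ok E7_roots [1, 2, 3, 4, 5, 7] (word_of E7_roots [1, 2, 3, 4, 5, 7])"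
    "length (word_of E7_roots [2, 3, 4, 5, 6, 7]) \<noteq> length (word_of E7_roots [1, 2, 3, 4, 5, 7])"
    by code_simp+
  from E7.not_braided_3_length[OF this] show ?thesis by simp
qed

lemma E7_complete:
  assumes JK: "J \<union> K = E7.I" and m: "m \<in> {3, 4}" and b: "E7.braided J K m" and n: "\<not> E7.braided J K 2"
  defines "L \<equiv> {({1, 2, 3, 4, 7}, {2, 3, 4, 5, 6, 7}), ({1, 2, 3, 4, 6, 7}, {2, 3, 4, 5, 6, 7 :: nat})}"
  shows "m = 4 \<and> ((J, K) \<in> L \<or> (K, J) \<in> L)"
proof -
  \<comment> \<open>With vertex 1 missing on one side, the other complement is {5}, {6} or {5, 6}.
    The first and last are the two choices of K in the list; {6} falls to the Burau representation
    for m = 4 and to lengths for m = 3.\<close>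
  have main: "m = 4 \<and> (B, A) \<in> L"
    if A: "A = E7.I - {1}" and B: "E7.I - B \<subseteq> {5, 6}" "E7.I - B \<noteq> {}" "B \<subseteq> E7.I" and b: "E7.braided A B m" for A B
  proof -
    have "E7.I - B = {5} \<or> E7.I - B = {6} \<or> E7.I - B = {5, 6}" using B(1,2) by blast
    then have "B = E7.I - {5} \<or> B = E7.I - {6} \<or> B = E7.I - {5, 6}" using B(3) by blast
    then have "B = {1, 2, 3, 4, 6, 7} \<or> B = {1, 2, 3, 4, 5, 7} \<or> B = {1, 2, 3, 4, 7}"
      unfolding index_minus_I .
    moreover have "A = {2, 3, 4, 5, 6, 7}" using A unfolding index_minus_I .
    ultimately show ?thesis
      using b m E7_no_braid E7_no_braid_3 E7_small[of 3] E7_small_6[of 3] E7.braided_sym[of A B m] by (auto simp: L_def)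
  qed
  obtain a b where ab: "a \<in> E7.I - J" "b \<in> E7.I - K" by (rule E7.proper_if_central[OF E7_conj JK n])
  have S: "a' = 1 \<and> b' \<in> {5, 6} \<or> b' = 1 \<and> a' \<in> {5, 6}" if "a' \<in> E7.I - J" "b' \<in> E7.I - K" for a' b'
    using E7.survivors[OF E7_tests E7_covers JK m b that] by auto
  have sub: "J \<subseteq> E7.I" "K \<subseteq> E7.I" using JK by auto
  show ?thesis
  proof (cases "a = 1")
    case True
    then have "E7.I - K \<subseteq> {5, 6}" using S[OF ab(1)] by fastforce
    moreover from this have "E7.I - J = {1}" using S[OF _ ab(2)] ab by fastforce
    ultimately show ?thesis using main[of J K] b ab sub by blast
  next
    case False
    then have "E7.I - K = {1}" using S[OF ab(1)] ab by fastforce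
    moreover have "E7.I - J \<subseteq> {5, 6}" using S[OF _ ab(2)] S[OF ab] False ab by fastforce
    ultimately show ?thesis using main[of K J] b E7.braided_sym[of J K m] ab sub by blast
  qed
qed

subsubsection \<open>Type \<open>E\<^sub>6\<close>\<close>

lemma tau_tau: "\<tau> (\<tau> k) = k"
  by (auto simp: \<tau>_def Transposition.transpose_def)

lemma tau_in_iff: "\<tau> k \<in> {1..6} \<longleftrightarrow> k \<in> {1..6}"
  by (auto simp: \<tau>_def Transposition.transpose_def)

lemma tau_E6_cartan: "E6.cartan (\<tau> k) (\<tau> i) = E6.cartan k i"
proof (cases "k \<in> {1..6} \<and> i \<in> {1..6}")
  case True
  have "list_all (\<lambda>k. list_all (\<lambda>i. E6_roots ! (\<tau> i - 1) ! (\<tau> k - 1) = E6_roots ! (i - 1) ! (k - 1))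
      [1, 2, 3, 4, 5, 6]) [1, 2, 3, 4, 5, 6]" by code_simp
  note check = this[unfolded list_all_iff, THEN bspec, THEN bspec]
  have "k \<in> set [1, 2, 3, 4, 5, 6]" "i \<in> set [1, 2, 3, 4, 5, 6]" using True by auto
  then have "E6_roots ! (\<tau> i - 1) ! (\<tau> k - 1) = E6_roots ! (i - 1) ! (k - 1)" by (rule check)
  then show ?thesis using True by (simp only: E6.cartan_def tau_in_iff simp_thms if_True)
next
  case False
  then show ?thesis by (simp only: E6.cartan_def tau_in_iff if_False)
qed

lemma tau_E6_index: "\<tau> ` E6.I \<subseteq> E6.I"
  using tau_in_iff by (auto simp only: E_mat_index)

lemma E6_conj: "u \<in> lists E6.I \<Longrightarrow> (E6_top @ u, map \<tau> u @ E6_top) \<in> artin_cong (E_mat 6)"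
proof -
  have "E6.conj_ok \<tau>" unfolding E6.conj_ok_def by code_simp
  then show "u \<in> lists E6.I \<Longrightarrow> (E6_top @ u, map \<tau> u @ E6_top) \<in> artin_cong (E_mat 6)"
    by (rule E6.top_commute)
qed

lemma E6_top_rho: "E6.act E6_top E6.\<rho> = (\<lambda>k. - E6.\<rho> k)"
proof -
  have "lact E6_roots E6_top (replicate 6 1) = replicate 6 (-1)" by code_simp
  moreover have "E6_top \<in> lists {1..6}" using E6.longD(3)[OF E6.long_top] by (simp only: E_mat_index)
  ultimately have "E6.act E6_top E6.\<rho> = E6.vec (replicate 6 (-1))"
    using E6.act_vec[of E6_top "replicate 6 1"] E6.rho_vec by simp
  then show ?thesis by (auto simp: fun_eq_iff E6.vec_def E6.\<rho>_def E_mat_index)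
qed

lemmas E6_image_long = E6.image_long[OF tau_tau tau_E6_cartan tau_E6_index E6_conj E6_top_rho]
lemmas E6_braided_top_2 = E6.braided_top_2[OF tau_tau tau_E6_cartan tau_E6_index E6_conj E6_top_rho]
lemmas E6_braided_top_4 = E6.braided_top_4[OF tau_tau tau_E6_cartan tau_E6_index E6_conj E6_top_rho]

text \<open>The same Burau representation as for \<open>E\<^sub>7\<close>; in the Coxeter group, the longest elements of
  \<open>{2, 3}\<close> and \<open>{3, 4}\<close> commute.\<close>

definition E6_burau :: "int list list" where
  "E6_burau = [[3, -2, 0, 0, 0, 0], [-1, 3, -2, 0, 0, 0], [0, -1, 3, -2, 0, -2],
    [0, 0, -1, 3, -2, 0], [0, 0, 0, -1, 3, 0], [0, 0, -1, 0, 0, 3]]"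

lemma E6_burau_lmove:
  "lmove E6_burau (Suc 0) [a, b, c, d, e, f] = [- 2 * a, b + 2 * a, c, d, e, f]"
  "lmove E6_burau 2 [a, b, c, d, e, f] = [a + b, - 2 * b, c + 2 * b, d, e, f]"
  "lmove E6_burau 3 [a, b, c, d, e, f] = [a, b + c, - 2 * c, d + 2 * c, e, f + 2 * c]"
  "lmove E6_burau 4 [a, b, c, d, e, f] = [a, b, c + d, - 2 * d, e + 2 * d, f]"
  "lmove E6_burau 5 [a, b, c, d, e, f] = [a, b, c, d + e, - 2 * e, f]"
  "lmove E6_burau 6 [a, b, c, d, e, f] = [a, b, c + f, d, e, - 2 * f]"
  by (simp_all add: lmove_def E6_burau_def)

lemma E6_burau_relations:
  assumes "i \<in> {1, 2, 3, 4, 5, 6}" "j \<in> {1, 2, 3, 4, 5, 6}" "i \<noteq> j"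
  shows "lact E6_burau (alternating i j (entry (E_mat 6) i j)) [a, b, c, d, e, f] =
    lact E6_burau (alternating j i (entry (E_mat 6) i j)) [a, b, c, d, e, f]"
  using assms unfolding insert_iff empty_iff
  by (elim disjE FalseE; simp add: E_mat_entry E6_burau_lmove)

lemma E6_burau_cong:
  "(t, u) \<in> artin_cong (E_mat 6) \<Longrightarrow> length xs = 6 \<Longrightarrow> lact E6_burau t xs = lact E6_burau u xs"
proof (rule E6.lact_cong)
  fix i j :: nat and xs :: "int list"
  assume ij: "i \<in> E6.I" "j \<in> E6.I" "i \<noteq> j" and xs: "length xs = 6"
  obtain a b c d e f where v: "xs = [a, b, c, d, e, f]"
    using xs by (auto simp: length_Suc_conv eval_nat_numeral)
  show "lact E6_burau (alternating i j (entry (E_mat 6) i j)) xs =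
      lact E6_burau (alternating j i (entry (E_mat 6) i j)) xs"
    unfolding v using ij unfolding E_mat_index atLeastAtMost_6 by (rule E6_burau_relations)
qed (simp_all add: E6_burau_def)

definition E6_orthogonal :: "nat list \<Rightarrow> nat list \<Rightarrow> bool" where
  "E6_orthogonal js ks = list_all (\<lambda>j. list_all (\<lambda>k. E6_roots ! (j - 1) ! (k - 1) = 0) ks) js"

lemma E6_orthogonalD:
  assumes "E6_orthogonal js ks" "set js \<subseteq> E6.I" "set ks \<subseteq> E6.I"
  shows "orthogonal_sets (E_mat 6) (set js) (set ks)"
  unfolding orthogonal_sets_def
proof (intro ballI)
  fix j k assume jk: "j \<in> set js" "k \<in> set ks"
  then have z: "E6_roots ! (j - 1) ! (k - 1) = 0"
    using assms(1) by (auto simp: E6_orthogonal_def list_all_iff)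
  have I: "j \<in> {1..6}" "k \<in> {1..6}" using jk assms(2,3) unfolding E_mat_index by blast+
  then have "j \<noteq> k" using z E6.diag by auto
  then show "entry (E_mat 6) j k = 2" using E6.bonds[OF I] z by auto
qed

definition E6_burau_differ :: "nat list \<Rightarrow> bool" where
  "E6_burau_differ w \<longleftrightarrow> lact E6_burau (w @ E6_top @ w @ E6_top) [0, 1, 0, 0, 0, 0] \<noteq>
     lact E6_burau (E6_top @ w @ E6_top @ w) [0, 1, 0, 0, 0, 0]"

text \<open>The converse of \<open>braided_top_4\<close> is settled by running through all 64
  subsets: each is stable under \<tau>, weakly orthogonal to its image, or refuted by the Burau
  representation, for which one test vector separates the two sides in all remaining cases.\<close>

lemma E6_top_4_cases:
  assumes J: "J \<subseteq> E6.I" and b: "E6.braided J E6.I 4" and n: "J \<noteq> \<tau> ` J"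
  shows "weakly_orthogonal_sets (E_mat 6) J (\<tau> ` J)"
proof -
  have "list_all (\<lambda>js. list_all (\<lambda>j. \<tau> j \<in> set js) js \<or>
      E6_orthogonal (filter (\<lambda>j. j \<notin> set (map \<tau> js)) js) (map \<tau> js) \<and>
        E6_orthogonal (filter (\<lambda>j. j \<notin> set js) (map \<tau> js)) js \<or>
      long_ok E6_roots js (word_of E6_roots js) \<and>
        E6_burau_differ (word_of E6_roots js))
      (subseqs [1, 2, 3, 4, 5, 6])"
    by code_simp
  note check = this[unfolded list_all_iff, THEN bspec]
  have "set ` set (subseqs [1, 2, 3, 4, 5, 6 :: nat]) = Pow (set [1, 2, 3, 4, 5, 6])"
    by (rule subseqs_powset)
  also have "set [1, 2, 3, 4, 5, 6] = E6.I" unfolding E_mat_index atLeastAtMost_6 by simp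
  finally obtain js where js: "js \<in> set (subseqs [1, 2, 3, 4, 5, 6])" "J = set js"
    using J by (metis (no_types, lifting) PowI imageE)
  have tJ: "\<tau> ` J \<subseteq> E6.I" using J tau_E6_index by blast
  let ?w = "word_of E6_roots js"
  from check[OF js(1)] consider "\<forall>j\<in>set js. \<tau> j \<in> set js"
    | "E6_orthogonal (filter (\<lambda>j. j \<notin> set (map \<tau> js)) js) (map \<tau> js)"
      "E6_orthogonal (filter (\<lambda>j. j \<notin> set js) (map \<tau> js)) js"
    | "long_ok E6_roots js ?w" "E6_burau_differ ?w" by blast
  then show ?thesis
  proof cases
    case 1
    then have "\<tau> ` J \<subseteq> J" using js(2) by auto
    moreover have "J \<subseteq> \<tau> ` J"
    proof
      fix j assume "j \<in> J"
      then have "\<tau> (\<tau> j) \<in> \<tau> ` J" using 1 js(2) by blast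
      then show "j \<in> \<tau> ` J" by (simp only: tau_tau)
    qed
    ultimately show ?thesis using n by blast
  next
    case 2
    have "set (filter (\<lambda>j. j \<notin> set (map \<tau> js)) js) = J - \<tau> ` J"
      "set (filter (\<lambda>j. j \<notin> set js) (map \<tau> js)) = \<tau> ` J - J" "set (map \<tau> js) = \<tau> ` J"
      by (auto simp: js(2))
    then show ?thesis
      using E6_orthogonalD[OF 2(1)] E6_orthogonalD[OF 2(2)] J tJ js(2)
      unfolding weakly_orthogonal_sets_def by (metis Diff_subset subset_trans)
  next
    case 3
    have w: "E6.long J ?w" using E6.long_okD[OF 3(1)] js(2) by simp
    have "(?w @ E6_top @ ?w @ E6_top, E6_top @ ?w @ E6_top @ ?w) \<in> artin_cong (E_mat 6)"
      using b E6.braided_iff[OF J subset_refl w E6.long_top, of 4] by simp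
    then have "\<not> E6_burau_differ ?w" using E6_burau_cong by (simp add: E6_burau_differ_def)
    then show ?thesis using 3(2) by blast
  qed
qed

lemma E6_choices_subset: "J \<in> E6_choices \<Longrightarrow> J \<subseteq> E6.I"
  by (auto simp: E6_choices_def E_mat_index)

lemma E6_choices_braided: "J \<in> E6_choices \<Longrightarrow> E6.braided J E6.I 4"
proof -
  assume J: "J \<in> E6_choices"
  note sub = E6_choices_subset[OF J]
  note w = E6.long_lw[OF sub]
  from J consider "J = E6.I" | "weakly_orthogonal_sets (E_mat 6) J (\<tau> ` J)"
    unfolding E6_choices_def E_mat_index by blast
  then show ?thesis
  proof cases
    case 1
    then show ?thesis
      using E6.lw_lists[of E6.I] by (simp add: E6.braided_def E6.braid_refl)
  next
    case 2
    have "\<tau> ` J \<subseteq> E6.I" using sub tau_E6_index by blast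
    from E6.weakly_orthogonal_commute[OF 2 sub this w E6_image_long[OF _ w]]
    show ?thesis by (intro E6_braided_top_4[OF _ sub w])
  qed
qed

lemma E6_choices_small:
  assumes J: "J \<in> E6_choices" "J \<noteq> E6.I" and k: "0 < k" "k < 4" shows "\<not> E6.braided J E6.I k"
proof -
  note sub = E6_choices_subset[OF J(1)]
  have "J \<noteq> \<tau> ` J" using J unfolding E6_choices_def E_mat_index by blast
  then have "\<not> E6.braided J E6.I 2" using E6_braided_top_2[OF _ sub] by blast
  moreover have "\<not> E6.braided J E6.I (Suc 0)" using E6.braided_1[OF sub] J(2) by blast
  moreover have "\<not> E6.braided J E6.I 3"
    using E6.braided_3_length[OF _ sub subset_refl E6.long_lw[OF sub] E6.long_top]
      E6.long_length_less[OF sub J(2) E6.long_lw[OF sub]] by auto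
  moreover have "k = Suc 0 \<or> k = 2 \<or> k = 3" using k by auto
  ultimately show ?thesis by blast
qed

lemma E6_hom_exists: "J \<in> E6_choices \<Longrightarrow> \<exists>\<Phi>. is_E6_hom J \<Phi>"
  unfolding is_E6_hom_def using E6.hom_exists[OF E6_choices_subset subset_refl E6_choices_braided]
  by (simp only: E_mat_index)

lemma E6_unfolded_small:
  assumes "0 < k" "k < 4" shows "\<not> E6.braided {1, 2, 3, 4, 5} {2, 3, 4, 6} k"
proof -
  have "small_ok E6_roots (\<lambda>_. 1) (length E6_top) [1, 2, 3, 4, 5] [2, 3, 4, 6]" by code_simp
  then have "\<not> E6.braided (set [1, 2, 3, 4, 5]) (set [2, 3, 4, 6]) k"
    by (rule E6.small_not_braided) (use assms in \<open>auto simp: E_mat_index\<close>)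
  then show ?thesis by simp
qed

text \<open>Both subsets have type D_5, and 20 + 20 exceeds 36, so lengths cannot exclude a
  commuting pair; the relation of length 3 that is already known does.\<close>

lemma E6_small:
  assumes "0 < k" "k < 3" shows "\<not> E6.braided {1, 2, 3, 4, 6} {2, 3, 4, 5, 6} k"
proof -
  have sub: "{1, 2, 3, 4, 6} \<subseteq> E6.I" "{2, 3, 4, 5, 6} \<subseteq> E6.I" by (auto simp: E_mat_index)
  have ne: "{1, 2, 3, 4, 6} \<noteq> {2, 3, 4, 5, 6 :: nat}" by auto
  have "\<not> E6.braided {1, 2, 3, 4, 6} {2, 3, 4, 5, 6} 2"
    using E6.braided_2_3[OF _ E6_braided sub] ne by blast
  moreover have "\<not> E6.braided {1, 2, 3, 4, 6} {2, 3, 4, 5, 6} (Suc 0)"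
    using E6.braided_1[OF sub] ne by blast
  moreover have "k = Suc 0 \<or> k = 2" using assms by auto
  ultimately show ?thesis by blast
qed

text \<open>These pairs survive the 0-Hecke test. The relation of length 4 fails already in the
  Coxeter group, and that of length 3 fails because D_5 and A_5 have 20 and 15 positive
  roots.\<close>

lemma E6_no_braid:
  "\<not> E6.braided {2, 3, 4, 5, 6} {1, 2, 3, 4, 6} 4" "\<not> E6.braided {2, 3, 4, 5, 6} {1, 2, 3, 4, 5} 4"
  "\<not> E6.braided {1, 2, 3, 4, 6} {1, 2, 3, 4, 5} 4"
  "\<not> E6.braided {2, 3, 4, 5, 6} {1, 2, 3, 4, 5} 3" "\<not> E6.braided {1, 2, 3, 4, 6} {1, 2, 3, 4, 5} 3"
proof -
  let ?x = "word_of E6_roots [2, 3, 4, 5, 6]" and ?y = "word_of E6_roots [1, 2, 3, 4, 6]"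
    and ?z = "word_of E6_roots [1, 2, 3, 4, 5]"
  have l: "long_ok E6_roots [2, 3, 4, 5, 6] ?x" "long_ok E6_roots [1, 2, 3, 4, 6] ?y"
    "long_ok E6_roots [1, 2, 3, 4, 5] ?z" by code_simp+
  have a: "\<not> same_ok E6_roots (?x @ ?y @ ?x @ ?y) (?y @ ?x @ ?y @ ?x)"
    "\<not> same_ok E6_roots (?x @ ?z @ ?x @ ?z) (?z @ ?x @ ?z @ ?x)"
    "\<not> same_ok E6_roots (?y @ ?z @ ?y @ ?z) (?z @ ?y @ ?z @ ?y)"
    "length ?x \<noteq> length ?z" "length ?y \<noteq> length ?z" by code_simp+
  show "\<not> E6.braided {2, 3, 4, 5, 6} {1, 2, 3, 4, 6} 4" "\<not> E6.braided {2, 3, 4, 5, 6} {1, 2, 3, 4, 5} 4"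
    "\<not> E6.braided {1, 2, 3, 4, 6} {1, 2, 3, 4, 5} 4"
    "\<not> E6.braided {2, 3, 4, 5, 6} {1, 2, 3, 4, 5} 3" "\<not> E6.braided {1, 2, 3, 4, 6} {1, 2, 3, 4, 5} 3"
    using E6.not_braided_4_act[OF l(1,2) a(1)] E6.not_braided_4_act[OF l(1,3) a(2)]
      E6.not_braided_4_act[OF l(2,3) a(3)] E6.not_braided_3_length[OF l(1,3) a(4)]
      E6.not_braided_3_length[OF l(2,3) a(5)] by simp_all
qed

text \<open>Up to order there are six ways to choose two disjoint nonempty complements inside {1, 5,
  6}.\<close>

lemma complements_E6:
  assumes "A \<subseteq> {1, 5, 6 :: nat}" "B \<subseteq> {1, 5, 6}" "A \<noteq> {}" "B \<noteq> {}" "A \<inter> B = {}"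
  shows "(A, B) \<in> {({1}, {5}), ({1}, {6}), ({5}, {6}), ({1, 5}, {6}), ({1, 6}, {5}), ({1}, {5, 6})} \<or>
    (B, A) \<in> {({1}, {5}), ({1}, {6}), ({5}, {6}), ({1, 5}, {6}), ({1, 6}, {5}), ({1}, {5, 6})}"
  (is "_ \<in> ?S \<or> _")
proof -
  have "\<forall>A\<in>Pow {1, 5, 6 :: nat}. \<forall>B\<in>Pow {1, 5, 6}. A \<noteq> {} \<longrightarrow> B \<noteq> {} \<longrightarrow> A \<inter> B = {} \<longrightarrow>
      (A, B) \<in> ?S \<or>
      (B, A) \<in> ?S"
    by code_simp
  note check = this[THEN bspec, OF PowI[OF assms(1)], THEN bspec, OF PowI[OF assms(2)]]
  show ?thesis by (rule check[THEN mp, OF assms(3), THEN mp, OF assms(4), THEN mp, OF assms(5)])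
qed

lemma E6_proper_cases:
  assumes JK: "J \<union> K = E6.I" and m: "m \<in> {3, 4}" and b: "E6.braided J K m" and p: "J \<noteq> E6.I" "K \<noteq> E6.I"
  shows "m = 3 \<and> ((J, K) = ({1, 2, 3, 4, 6}, {2, 3, 4, 5, 6}) \<or> (K, J) = ({1, 2, 3, 4, 6}, {2, 3, 4, 5, 6})) \<or>
    m = 4 \<and> ((J, K) = ({1, 2, 3, 4, 5}, {2, 3, 4, 6}) \<or> (K, J) = ({1, 2, 3, 4, 5}, {2, 3, 4, 6}))"
proof -
  let ?F = "{({1}, {5}), ({1}, {6}), ({5}, {6}), ({1, 5}, {6})} :: (nat set \<times> nat set) set"
  have sub: "J \<subseteq> E6.I" "K \<subseteq> E6.I" using JK by auto
  obtain a b' where ab: "a \<in> E6.I - J" "b' \<in> E6.I - K" using p sub by blast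
  have S: "x \<in> {1, 5, 6} \<and> y \<in> {1, 5, 6}" if "x \<in> E6.I - J" "y \<in> E6.I - K" for x y
    using E6.survivors[OF E6_tests E6_covers JK m b that] by auto
  define A B where "A = E6.I - J" and "B = E6.I - K"
  have J: "J = E6.I - A" "K = E6.I - B" using sub by (auto simp: A_def B_def)
  have AB: "(A, B) \<in> ?F \<union> {({1, 6}, {5}), ({1}, {5, 6})} \<or>
    (B, A) \<in> ?F \<union> {({1, 6}, {5}), ({1}, {5, 6})}"
    unfolding Un_insert_left Un_empty_left by (rule complements_E6) (use S ab JK in \<open>auto simp: A_def B_def\<close>)
  \<comment> \<open>Of the pairs with a two-element complement, {1, 5} against {6} is not tested: it
    carries the unfolded homomorphism.\<close>
  have "([1, 6], [5], 5) \<in> set E6_tests" "([1], [5, 6], 5) \<in> set E6_tests" by code_simp+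
  note T = E6.testsD[OF E6_tests this(1) JK m b] E6.testsD[OF E6_tests this(2) JK m b]
  have "A \<inter> J = {}" "B \<inter> K = {}" by (auto simp: A_def B_def)
  then have n: "\<not> (A = {1, 6} \<and> B = {5})" "\<not> (B = {1, 6} \<and> A = {5})"
    "\<not> (A = {1} \<and> B = {5, 6})" "\<not> (B = {1} \<and> A = {5, 6})"
    using T[unfolded list.set] by metis+
  have AB': "(A, B) \<in> ?F \<or>
    (B, A) \<in> ?F"
    using AB n unfolding Un_iff insert_iff empty_iff prod.inject by argo
  have main: "m = 3 \<and> (Y, X) = ({1, 2, 3, 4, 6}, {2, 3, 4, 5, 6}) \<or> m = 4 \<and> (Y, X) = ({1, 2, 3, 4, 5}, {2, 3, 4, 6})"
    if X: "X = E6.I - C" "Y = E6.I - D" and CD: "(C, D) \<in> ?F"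
      and XY: "E6.braided X Y m" for X Y C D
  proof -
    from CD consider "C = {1} \<and> D = {5}" | "C = {1} \<and> D = {6}" | "C = {5} \<and> D = {6}" | "C = {1, 5} \<and> D = {6}"
      by blast
    then show ?thesis
    proof cases
      case 1
      then have "X = {2, 3, 4, 5, 6}" "Y = {1, 2, 3, 4, 6}" using X by (simp_all only: index_minus_I)
      then show ?thesis using XY m E6_no_braid by auto
    next
      case 2
      then have "X = {2, 3, 4, 5, 6}" "Y = {1, 2, 3, 4, 5}" using X by (simp_all only: index_minus_I)
      then show ?thesis using XY m E6_no_braid by auto
    next
      case 3
      then have "X = {1, 2, 3, 4, 6}" "Y = {1, 2, 3, 4, 5}" using X by (simp_all only: index_minus_I)
      then show ?thesis using XY m E6_no_braid by auto
    next
      case 4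
      then have XY': "X = {2, 3, 4, 6}" "Y = {1, 2, 3, 4, 5}" using X by (simp_all only: index_minus_I)
      then have "m \<noteq> 3" using XY E6.braided_sym E6_unfolded_small[of 3] by auto
      then show ?thesis using XY' m by simp
    qed
  qed
  have b': "E6.braided K J m" using b E6.braided_sym[of J K m] by simp
  from AB' show ?thesis
  proof
    assume "(A, B) \<in> ?F"
    from main[OF J this b] show ?thesis by argo
  next
    assume "(B, A) \<in> ?F"
    from main[OF J(2,1) this b'] show ?thesis by argo
  qed
qed

lemma E6_complete_3:
  assumes JK: "J \<union> K = E6.I" "J \<noteq> K" and b: "E6.braided J K 3"
  shows "(J, K) = ({1, 2, 3, 4, 6}, {2, 3, 4, 5, 6}) \<or> (K, J) = ({1, 2, 3, 4, 6}, {2, 3, 4, 5, 6})"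
proof -
  \<comment> \<open>A proper subset has a shorter longest element than the whole index set, whereas
    a relation of length 3 forces equal lengths.\<close>
  have np: "\<not> E6.braided X E6.I 3" if "X \<subseteq> E6.I" "X \<noteq> E6.I" for X
    using E6.braided_3_length[OF _ that(1) subset_refl E6.long_lw[OF that(1)] E6.long_top]
      E6.long_length_less[OF that E6.long_lw[OF that(1)]] by auto
  have "J \<noteq> E6.I" using np[of K] JK b E6.braided_sym by blast
  moreover have "K \<noteq> E6.I" using np[of J] JK b by blast
  ultimately show ?thesis using E6_proper_cases[OF JK(1) _ b] by auto
qed

lemma E6_complete_4:
  assumes JK: "J \<union> K = E6.I" "J \<noteq> K" and b: "E6.braided J K 4" and n: "\<not> E6.braided J K 2"
  defines "L \<equiv> insert ({1, 2, 3, 4, 5}, {2, 3, 4, 6}) ((\<lambda>J. (J, E6.I)) ` E6_choices)"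
  shows "(J, K) \<in> L \<or> (K, J) \<in> L"
proof -
  have top: "(X, E6.I) \<in> L" if X: "X \<subseteq> E6.I" and "E6.braided X E6.I 4" "\<not> E6.braided X E6.I 2" for X
  proof -
    have "X \<noteq> \<tau> ` X" using E6_braided_top_2[OF _ X] that(3) by metis
    then have "X \<in> E6_choices"
      using E6_top_4_cases[OF X that(2)] X unfolding E6_choices_def E_mat_index by blast
    then show ?thesis by (auto simp: L_def)
  qed
  consider "K = E6.I" | "J = E6.I" | "J \<noteq> E6.I" "K \<noteq> E6.I" by blast
  then show ?thesis
  proof cases
    case 1
    then show ?thesis using top[of J] JK b n by blast
  next
    case 2
    then show ?thesis using top[of K] JK b n E6.braided_sym by blast
  next
    case 3
    then show ?thesis using E6_proper_cases[OF JK(1) _ b] by (auto simp: L_def)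
  qed
qed

lemma classification:
  assumes "m \<in> {3, 4}" "M \<in> {F4_mat, E_mat 6, E_mat 7, E_mat 8}" "\<Phi> \<in> dihedral_homs m M"
  shows "fully_supported_standard m M \<Phi> \<and> optimal m M \<Phi> \<longleftrightarrow>
    listed m M \<Phi> \<or> (\<exists>\<sigma>. swap_aut m \<sigma> \<and> listed m M (\<Phi> \<circ> \<sigma>)) \<or> degenerate m M \<Phi>"
proof -
  note F4 = classify[OF F4.finite_game_axioms] and E6 = classify[OF E6.finite_game_axioms]
    and E7 = classify[OF E7.finite_game_axioms] and E8 = classify[OF E8.finite_game_axioms]
  from assms(1,2) consider "m = 3" "M = F4_mat" | "m = 4" "M = F4_mat" | "m = 3" "M = E_mat 6" | "m = 4" "M = E_mat 6"
    | "m = 3" "M = E_mat 7" | "m = 4" "M = E_mat 7" | "m = 3" "M = E_mat 8" | "m = 4" "M = E_mat 8" by blast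
  then show ?thesis
  proof cases
    case 1
    show ?thesis unfolding 1
    proof (rule F4[where L = "{}"])
      show "(J, K) \<in> {} \<or> (K, J) \<in> {}" if "J \<union> K = F4.I" "J \<noteq> K" "F4.braided J K 3" "\<not> F4.braided J K 2" for J K
        using F4_complete[OF that(1) _ that(3,4)] by simp
    qed (use assms(3) 1 in \<open>simp_all add: listed_iff\<close>)
  next
    case 2
    let ?L = "{({1, 2, 3}, {2, 3, 4})}"
    show ?thesis unfolding 2
    proof (rule F4[where L = "?L"])
      show "(J, K) \<in> ?L \<or> (K, J) \<in> ?L"
        if "J \<union> K = F4.I" "J \<noteq> K" "F4.braided J K 4" "\<not> F4.braided J K 2" for J K
        using F4_complete[OF that(1) _ that(3,4)] by simp
      show "\<not> F4.braided J K k" if "(J, K) \<in> ?L" "0 < k" "k < 4" for J K k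
        using F4_small[OF that(2,3)] that(1) by auto
    qed (use assms(3) 2 in \<open>auto simp: listed_iff F4_index\<close>)
  next
    case 3
    let ?L = "{({1, 2, 3, 4, 6}, {2, 3, 4, 5, 6})}"
    show ?thesis unfolding 3
    proof (rule E6[where L = "?L"])
      show "(J, K) \<in> ?L \<or> (K, J) \<in> ?L"
        if "J \<union> K = E6.I" "J \<noteq> K" "E6.braided J K 3" for J K
        using E6_complete_3[OF that] by simp
      show "\<not> E6.braided J K k" if "(J, K) \<in> ?L" "0 < k" "k < 3" for J K k
        using E6_small[OF that(2,3)] that(1) by auto
    qed (use assms(3) 3 in \<open>auto simp: listed_iff E_mat_index\<close>)
  next
    case 4
    \<comment> \<open>This list contains the pair of the whole index set with itself, which is also
      the degenerate homomorphism; optimality is therefore asked only for J \<noteq> K.\<close>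
    let ?L = "insert ({1, 2, 3, 4, 5}, {2, 3, 4, 6}) ((\<lambda>J. (J, E6.I)) ` E6_choices)"
    show ?thesis unfolding 4
    proof (rule E6[where L = "?L"])
      show "(J, K) \<in> ?L \<or>
          (K, J) \<in> ?L"
        if "J \<union> K = E6.I" "J \<noteq> K" "E6.braided J K 4" "\<not> E6.braided J K 2" for J K
        using E6_complete_4[OF that] by simp
      show "\<not> E6.braided J K k"
        if "(J, K) \<in> ?L" "J \<noteq> K" "0 < k" "k < 4"
        for J K k
        using E6_choices_small[OF _ _ that(3,4)] E6_unfolded_small[OF that(3,4)] that(1,2) by auto
      show "J \<union> K = E6.I" if "(J, K) \<in> ?L" for J K
      proof -
        have "{1, 2, 3, 4, 5} \<union> {2, 3, 4, 6} = E6.I" by (auto simp: E_mat_index)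
        then show ?thesis using that E6_choices_subset by blast
      qed
      show "listed 4 (E_mat 6) \<Psi> \<longleftrightarrow>
          (\<exists>(J, K)\<in>?L.
            hom_given_by 4 (E_mat 6) \<Psi> (E6.T J) (E6.T K))" if "\<Psi> \<in> dihedral_homs 4 (E_mat 6)" for \<Psi>
        using listed_iff_E6[OF that] unfolding E_mat_index by auto
    qed (use assms(3) 4 in simp_all)
  next
    case 5
    show ?thesis unfolding 5
    proof (rule E7[where L = "{}"])
      show "(J, K) \<in> {} \<or> (K, J) \<in> {}" if "J \<union> K = E7.I" "J \<noteq> K" "E7.braided J K 3" "\<not> E7.braided J K 2" for J K
        using E7_complete[OF that(1) _ that(3,4)] by simp
    qed (use assms(3) 5 in \<open>simp_all add: listed_iff\<close>)
  next
    case 6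
    let ?L = "{({1, 2, 3, 4, 7}, {2, 3, 4, 5, 6, 7}), ({1, 2, 3, 4, 6, 7}, {2, 3, 4, 5, 6, 7})}"
    show ?thesis unfolding 6
    proof (rule E7[where L = "?L"])
      show "(J, K) \<in> ?L \<or>
          (K, J) \<in> ?L"
        if "J \<union> K = E7.I" "J \<noteq> K" "E7.braided J K 4" "\<not> E7.braided J K 2" for J K
        using E7_complete[OF that(1) _ that(3,4)] by simp
      show "\<not> E7.braided J K k"
        if "(J, K) \<in> ?L" "0 < k" "k < 4" for J K k
        using E7_small[OF that(2,3)] E7_small_6[OF that(2,3)] that(1) by auto
    qed (use assms(3) 6 in \<open>auto simp: listed_iff E_mat_index\<close>)
  next
    case 7
    show ?thesis unfolding 7
    proof (rule E8[where L = "{}"])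
      show "(J, K) \<in> {} \<or> (K, J) \<in> {}" if "J \<union> K = E8.I" "J \<noteq> K" "E8.braided J K 3" "\<not> E8.braided J K 2" for J K
        using E8_complete[OF that(1) _ that(3,4)] by simp
    qed (use assms(3) 7 in \<open>simp_all add: listed_iff\<close>)
  next
    case 8
    let ?L = "{({1, 2, 3, 4, 5, 6, 8}, {2, 3, 4, 5, 6, 7, 8})}"
    show ?thesis unfolding 8
    proof (rule E8[where L = "?L"])
      show "(J, K) \<in> ?L \<or>
          (K, J) \<in> ?L"
        if "J \<union> K = E8.I" "J \<noteq> K" "E8.braided J K 4" "\<not> E8.braided J K 2" for J K
        using E8_complete[OF that(1) _ that(3,4)] by simp
      show "\<not> E8.braided J K k" if "(J, K) \<in> ?L" "0 < k" "k < 4" for J K k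
        using E8_small[OF that(2,3)] that(1) by auto
    qed (use assms(3) 8 in \<open>auto simp: listed_iff E_mat_index\<close>)
  qed
qed

theorem proposition6p23:
  shows
    "(\<forall>(m, M, J\<^sub>1) \<in> hom_data. \<exists>\<Phi>. is_Phi m M J\<^sub>1 \<Phi> \<and> coxeter_type m M \<Phi>)
   \<and> (\<forall>(m, M, J\<^sub>1) \<in> hom_data. \<forall>K \<in> K_choices m M.
        \<exists>\<Phi>. is_hat_Phi m M J\<^sub>1 K \<Phi> \<and> standard m M \<Phi>)
   \<and> (\<exists>\<upsilon>. is_unfolding \<upsilon>)
   \<and> (\<forall>J \<in> E6_choices. \<exists>\<Phi>. is_E6_hom J \<Phi>)
   \<and> (\<forall>m \<in> {3, 4}. \<forall>M \<in> {F4_mat, E_mat 6, E_mat 7, E_mat 8}. \<forall>\<Phi> \<in> dihedral_homs m M.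
        fully_supported_standard m M \<Phi> \<and> optimal m M \<Phi>
        \<longleftrightarrow> listed m M \<Phi> \<or> (\<exists>\<sigma>. swap_aut m \<sigma> \<and> listed m M (\<Phi> \<circ> \<sigma>)) \<or> degenerate m M \<Phi>)"
proof (intro conjI)
  have K: "K_choices 4 F4_mat = {{}}" "K_choices 3 (E_mat 6) = {{}}" "K_choices 4 (E_mat 7) = {{}, {6}}"
    "K_choices 4 (E_mat 8) = {{}}" by (simp_all add: K_choices_def matrices_neq)
  show "\<forall>(m, M, J\<^sub>1) \<in> hom_data. \<exists>\<Phi>. is_Phi m M J\<^sub>1 \<Phi> \<and> coxeter_type m M \<Phi>"
    unfolding hom_data_def index_minus using F4_Phi E6_Phi E7_Phi E8_Phi by blast
  show "\<forall>(m, M, J\<^sub>1) \<in> hom_data. \<forall>K \<in> K_choices m M. \<exists>\<Phi>. is_hat_Phi m M J\<^sub>1 K \<Phi> \<and> standard m M \<Phi>"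
    unfolding hom_data_def index_minus using F4_hat_Phi E6_hat_Phi E7_hat_Phi E8_hat_Phi K by auto
  show "\<exists>\<upsilon>. is_unfolding \<upsilon>" by (rule unfolding_exists)
  show "\<forall>J \<in> E6_choices. \<exists>\<Phi>. is_E6_hom J \<Phi>" using E6_hom_exists by blast
  show "\<forall>m \<in> {3, 4}. \<forall>M \<in> {F4_mat, E_mat 6, E_mat 7, E_mat 8}. \<forall>\<Phi> \<in> dihedral_homs m M.
      fully_supported_standard m M \<Phi> \<and> optimal m M \<Phi>
      \<longleftrightarrow> listed m M \<Phi> \<or> (\<exists>\<sigma>. swap_aut m \<sigma> \<and> listed m M (\<Phi> \<circ> \<sigma>)) \<or> degenerate m M \<Phi>"
    using classification by blast
qed

end
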